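(* Let $k$ be an algebraically closed field, $R=k[x,y,z]$, and let $I\subset R$ be the base ideal of a rational map $F:\mathbb P^2\dashrightarrow\mathbb P^2$ without fixed part, with weighted cluster of base points $\mathcal K=(K,\boldsymbol\mu)$. Then $$I\subset\bar I\subset\tilde I\subset I_{\mathcal K}\subset\mathfrak F_{\mathcal K}.$$
   Context: $R$ is standard graded. A rational map $F:\mathbb P^2\dashrightarrow\mathbb P^2$ of degree $d$ without fixed part is given by three forms of degree $d$ with no nontrivial common factor; its base ideal $I$ is generated by these forms. $\bar I$ is the integral closure of $I$. Weighted cluster: $e_p(D)$ is the order of vanishing at $p$ of a local equation of the curve $D$ (on a smooth surface). The proper base points of $F$ are the points of $V(I)\subset\mathbb P^2$; for such $p$ put $\mu_p=\min\{e_p(f): f\in I_d\}$ and $U_p=\{f\in I_d: e_p(f)=\mu_p\}$. A point $q$ on the exceptional curve of the blowup of $p$ is a base point infinitely near to $p$ if it lies on the proper transform of every $V(f)$, $f\in U_p$; $\mu_q$ is the minimum of the multiplicities at $q$ of these proper transforms; one repeats successively. $K$ is the set of all base points (proper and infinitely near), $\boldsymbol\mu=(\mu_p)_{p\in K}$, $\mathcal K=(K,\boldsymbol\mu)$. Fat ideal: $\mathfrak F_{\mathcal K}=\bigcap_j I(p_j)^{\mu_{p_j}}$, over the proper points $p_j\in K$, with $I(p_j)\subset R$ the homogeneous prime ideal of $p_j$. Full ideal of curves: let $\mathcal B_K$ be the surface obtained by successively blowing up the points of $K$. A plane curve $C$ passes virtually through $\mathcal K$ if the divisor $\bar C^K-\sum_{p\in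 K}\mu_p\bar E_p^K$ on $\mathcal B_K$ is effective, where $\bar C^K$ is the total transform of $C$ and $\bar E_p^K$ is the total transform on $\mathcal B_K$ of the exceptional curve of the blowup of $p$. $I_{\mathcal K}=\bigoplus_{m\ge0}\ell_{\mathcal K}(m)$, where $\ell_{\mathcal K}(m)\subset R_m$ is the space of forms $f$ of degree $m$ such that $V(f)$ passes virtually through $\mathcal K$ (including $f=0$). Divisorial cover ideal: a valuation ring $(V,\mathfrak m_V)$ of the fraction field of $R$ containing $R$ is divisorial on $R$ if the transcendence degree of $V/\mathfrak m_V$ over the residue field of $R$ at $\mathfrak m_V\cap R$ is $\operatorname{ht}(\mathfrak m_V\cap R)-1$. $\mathrm D(R)$ is the set of the corresponding (divisorial) valuations; for $v\in\mathrm D(R)$, $v(I)=\min\{v(f): f\in I\}$. $\tilde I=\bigoplus_{m\ge0}\tilde I(m)$ with $\tilde I(m)=\bigcap_{v\in\mathrm D(R)}\{f\in R_m: v(f)\ge v(I)\}$. *)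

theory Defs
  imports
    "HOL-Algebra.Algebraic_Closure_Type"
    "HOL-Algebra.Ideal_Product"
    "HOL-Algebra.Generated_Fields"
    "HOL-Algebra.Finite_Extensions"
    "HOL-Algebra.QuotRing"
    "HOL-Library.Extended_Nat"
begin

section \<open>The graded ring in three variables\<close>

text \<open>
  The ring k[x,y,z] is the iterated polynomial type k[x][y][z]: the innermost variable is x, the
  outermost is z. As a record, it is \<^const>\<open>ring_of_type_algebra\<close> on that type.
  Likewise k[u,v] is k[u][v].
\<close>

type_synonym 'k poly2 = "'k poly poly"
type_synonym 'k poly3 = "'k poly poly poly"

abbreviation Rxyz :: "'k::field poly3 ring" where
  "Rxyz \<equiv> ring_of_type_algebra"

definition forms :: "nat \<Rightarrow> 'k::field poly3 set" where
  "forms m = {f. \<forall>i j l. Polynomial.coeff (Polynomial.coeff (Polynomial.coeff f l) j) i \<noteq> 0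
                   \<longrightarrow> i + j + l = m}"

definition graded_sum :: "(nat \<Rightarrow> 'k::field poly3 set) \<Rightarrow> 'k poly3 set" where
  "graded_sum J = {f. \<exists>N g. (\<forall>m. g m \<in> J m) \<and> f = (\<Sum>m\<le>N. g m)}"

definition ideal_power :: "'k::field poly3 set \<Rightarrow> nat \<Rightarrow> 'k poly3 set" where
  "ideal_power I n = I [^]\<^bsub>ideals_set Rxyz\<^esub> n"

definition integral_closure :: "'k::field poly3 set \<Rightarrow> 'k poly3 set" where
  "integral_closure I = {f. \<exists>n a. n \<ge> 1 \<and> (\<forall>i\<in>{1..n}. a i \<in> ideal_power I i)
                              \<and> f ^ n + (\<Sum>i=1..n. a i * f ^ (n - i)) = 0}"


section \<open>Divisorial valuations\<close>

type_synonym 'k frac3 = "'k poly3 fract"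

abbreviation Frac :: "'k::field frac3 ring" where
  "Frac \<equiv> ring_of_type_algebra"

definition valuation_ring :: "'k::field frac3 set \<Rightarrow> bool" where
  "valuation_ring V \<longleftrightarrow> subring V Frac \<and> (\<forall>a. a \<noteq> 0 \<longrightarrow> a \<in> V \<or> inverse a \<in> V)"

definition val_max_ideal :: "'k::field frac3 set \<Rightarrow> 'k frac3 set" where
  "val_max_ideal V = V - Units (Frac\<lparr>carrier := V\<rparr>)"

definition val_residue_field :: "'k::field frac3 set \<Rightarrow> 'k frac3 set ring" where
  "val_residue_field V = (Frac\<lparr>carrier := V\<rparr>) Quot (val_max_ideal V)"

definition val_center :: "'k::field frac3 set \<Rightarrow> 'k poly3 set" where
  "val_center V = {r. Fract r 1 \<in> val_max_ideal V}"

text \<open>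
  The residue field of R at the center P of V, as a subfield of the residue field of V: the image
  of the local ring of R at P under V \<rightarrow> V/m. The kernel of this map is the maximal ideal of the
  local ring, since V dominates it.
\<close>

definition center_residue_field :: "'k::field frac3 set \<Rightarrow> 'k frac3 set set" where
  "center_residue_field V =
     (\<lambda>a. val_max_ideal V +>\<^bsub>Frac\<lparr>carrier := V\<rparr>\<^esub> a) ` {Fract r s | r s. s \<notin> val_center V}"

text \<open>
  B is algebraically independent over K iff each b in B is transcendental over the field generated
  by K and the other elements of B.
\<close>

definition transcendence_basis :: "'a ring \<Rightarrow> 'a set \<Rightarrow> 'a set \<Rightarrow> bool" where
  "transcendence_basis L K B \<longleftrightarrow>
     B \<subseteq> carrier L \<and>
     (\<forall>b\<in>B. ring.transcendental L (generate_field L (K \<union> (B - {b}))) b) \<and>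
     (\<forall>x\<in>carrier L. \<not> ring.transcendental L (generate_field L (K \<union> B)) x)"

definition has_trdeg :: "'a ring \<Rightarrow> 'a set \<Rightarrow> nat \<Rightarrow> bool" where
  "has_trdeg L K n \<longleftrightarrow> (\<exists>B. transcendence_basis L K B \<and> finite B \<and> card B = n)"

definition prime_height :: "'k::field poly3 set \<Rightarrow> enat" where
  "prime_height P = Sup {enat n | n. \<exists>c :: nat \<Rightarrow> 'k poly3 set.
     (\<forall>i\<le>n. primeideal (c i) Rxyz) \<and> (\<forall>i<n. c i \<subset> c (Suc i)) \<and> c n = P}"

definition divisorial :: "'k::field frac3 set \<Rightarrow> bool" where
  "divisorial V \<longleftrightarrow>
     valuation_ring V \<and> (\<forall>r. Fract r 1 \<in> V) \<and>
     (\<exists>n. has_trdeg (val_residue_field V) (center_residue_field V) n \<and>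
          prime_height (val_center V) = enat (n + 1))"

text \<open>
  The order of the value group of V, on R: the value of f is at most that of g iff g lies in fV.
\<close>

definition val_le :: "'k::field frac3 set \<Rightarrow> 'k poly3 \<Rightarrow> 'k poly3 \<Rightarrow> bool" where
  "val_le V f g \<longleftrightarrow> (\<exists>c\<in>V. Fract g 1 = Fract f 1 * c)"

definition val_ideal_le :: "'k::field frac3 set \<Rightarrow> 'k poly3 set \<Rightarrow> 'k poly3 \<Rightarrow> bool" where
  "val_ideal_le V I f \<longleftrightarrow> (\<exists>g\<in>I. (\<forall>h\<in>I. val_le V g h) \<and> val_le V g f)"

definition divisorial_cover :: "'k::field poly3 set \<Rightarrow> 'k poly3 set" where
  "divisorial_cover I =
     graded_sum (\<lambda>m. {f \<in> forms m. \<forall>V. divisorial V \<longrightarrow> val_ideal_le V I f})"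


section \<open>Proper and infinitely near points of the plane\<close>

abbreviation cst :: "'k::field \<Rightarrow> 'k poly2" where "cst c \<equiv> [:[:c:]:]"
abbreviation varU :: "'k::field poly2" where "varU \<equiv> [:[:0, 1:]:]"
abbreviation varV :: "'k::field poly2" where "varV \<equiv> [:0, 1:]"

definition subst2 :: "'k::field poly2 \<Rightarrow> 'k poly2 \<Rightarrow> 'k poly2 \<Rightarrow> 'k poly2" where
  "subst2 g a b = poly (map_poly (\<lambda>h. poly (map_poly cst h) a) g) b"

definition subst3 :: "'k::field poly3 \<Rightarrow> 'k poly2 \<Rightarrow> 'k poly2 \<Rightarrow> 'k poly2 \<Rightarrow> 'k poly2" where
  "subst3 f a b c = poly (map_poly (\<lambda>g. subst2 g a b) f) c"

text \<open>
  Each point of the projective plane has exactly one of the homogeneous coordinates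
  (a:b:1), (a:1:0), (1:0:0).
\<close>

datatype 'k plane_point = Affine 'k 'k | Line_Inf 'k | Point_Inf

fun homog_coords :: "'k::field plane_point \<Rightarrow> 'k \<times> 'k \<times> 'k" where
  "homog_coords (Affine a b) = (a, b, 1)"
| "homog_coords (Line_Inf a) = (a, 1, 0)"
| "homog_coords Point_Inf = (1, 0, 0)"

definition vanishes_at :: "'k::field poly3 \<Rightarrow> 'k plane_point \<Rightarrow> bool" where
  "vanishes_at f p \<longleftrightarrow>
     (case homog_coords p of (a, b, c) \<Rightarrow> poly (poly (poly f [:[:c:]:]) [:b:]) a = 0)"

definition point_ideal :: "'k::field plane_point \<Rightarrow> 'k poly3 set" where
  "point_ideal p = Idl\<^bsub>Rxyz\<^esub> {f. (\<exists>m. f \<in> forms m) \<and> vanishes_at f p}"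

text \<open>Dehomogenization at p, in affine coordinates u, v centered at p.\<close>

fun local_equation :: "'k::field poly3 \<Rightarrow> 'k plane_point \<Rightarrow> 'k poly2" where
  "local_equation f (Affine a b) = subst3 f (cst a + varU) (cst b + varV) 1"
| "local_equation f (Line_Inf a) = subst3 f (cst a + varU) 1 varV"
| "local_equation f Point_Inf = subst3 f 1 varU varV"

text \<open>
  The exceptional curve of the blowup of a point with local coordinates u, v consists of the tangent
  directions: Slope c is the direction v = c u, with local coordinates u, v/u - c on the blowup,
  and Vertical is the direction u = 0, with local coordinates u/v, v on the blowup.
  So every proper or infinitely near point carries local coordinates, and local equations there are
  in k[u,v]. Near q t is the point t on the exceptional curve of the blowup of q.
\<close>

datatype 'k direction = Slope 'k | Vertical

datatype 'k near_point = Proper "'k plane_point" | Near "'k near_point" "'k direction"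

fun blow_up :: "'k::field direction \<Rightarrow> 'k poly2 \<Rightarrow> 'k poly2" where
  "blow_up (Slope c) g = subst2 g varU (varU * (varV + cst c))"
| "blow_up Vertical g = subst2 g (varU * varV) varV"

fun exc_equation :: "'k::field direction \<Rightarrow> 'k poly2" where
  "exc_equation (Slope c) = varU"
| "exc_equation Vertical = varV"

definition mult0 :: "'k::field poly2 \<Rightarrow> nat" where
  "mult0 g = (LEAST n. \<exists>i j. i + j = n \<and> Polynomial.coeff (Polynomial.coeff g j) i \<noteq> 0)"

text \<open>
  Local equations at a point of the total and the proper transform of the curve of a nonzero form f.
  The division in \<open>proper_transform\<close> is exact.
\<close>

fun total_transform :: "'k::field poly3 \<Rightarrow> 'k near_point \<Rightarrow> 'k poly2" where
  "total_transform f (Proper p) = local_equation f p"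
| "total_transform f (Near q t) = blow_up t (total_transform f q)"

fun proper_transform :: "'k::field poly3 \<Rightarrow> 'k near_point \<Rightarrow> 'k poly2" where
  "proper_transform f (Proper p) = local_equation f p"
| "proper_transform f (Near q t) =
     blow_up t (proper_transform f q) div exc_equation t ^ mult0 (proper_transform f q)"

definition multiplicity_at :: "'k::field poly3 \<Rightarrow> 'k near_point \<Rightarrow> nat" where
  "multiplicity_at f q = mult0 (proper_transform f q)"

text \<open>
  Local equation at a point of the total transform of the exceptional curve of the blowup of p. It is
  1 at the points that are not infinitely near to p.
\<close>

fun exc_total_transform :: "'k::field near_point \<Rightarrow> 'k near_point \<Rightarrow> 'k poly2" where
  "exc_total_transform p (Proper _) = 1"
| "exc_total_transform p (Near q t) =
     (if q = p then exc_equation t else blow_up t (exc_total_transform p q))"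

fun predecessors :: "'k near_point \<Rightarrow> 'k near_point set" where
  "predecessors (Proper _) = {}"
| "predecessors (Near q t) = insert q (predecessors q)"


section \<open>The cluster of base points\<close>

text \<open>
  \<open>base_system I d (Near q t)\<close>, which does not depend on t, is the set of forms whose proper
  transforms have minimal multiplicity at q, among the forms with this property at all predecessors
  of q. These are the forms that decide which points on the exceptional curve of the blowup of q are
  base points, and with which multiplicity.
\<close>

fun base_system :: "'k::field poly3 set \<Rightarrow> nat \<Rightarrow> 'k near_point \<Rightarrow> 'k poly3 set" where
  "base_system I d (Proper p) = {f \<in> I \<inter> forms d. f \<noteq> 0}"
| "base_system I d (Near q t) =
     {f \<in> base_system I d q. multiplicity_at f q = (INF g\<in>base_system I d q. multiplicity_at g q)}"

definition base_mult :: "'k::field poly3 set \<Rightarrow> nat \<Rightarrow> 'k near_point \<Rightarrow> nat" where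
  "base_mult I d q = (INF f\<in>base_system I d q. multiplicity_at f q)"

fun is_base_point :: "'k::field poly3 set \<Rightarrow> nat \<Rightarrow> 'k near_point \<Rightarrow> bool" where
  "is_base_point I d (Proper p) \<longleftrightarrow> (\<forall>f\<in>I. vanishes_at f p)"
| "is_base_point I d (Near q t) \<longleftrightarrow>
     is_base_point I d q \<and>
     (\<forall>f\<in>base_system I d (Near q t). poly (poly (proper_transform f (Near q t)) 0) 0 = 0)"

definition base_points :: "'k::field poly3 set \<Rightarrow> nat \<Rightarrow> 'k near_point set" where
  "base_points I d = {q. is_base_point I d q}"


section \<open>The fat ideal and the full ideal of curves of a weighted cluster\<close>

definition fat_ideal :: "'k::field near_point set \<Rightarrow> ('k near_point \<Rightarrow> nat) \<Rightarrow> 'k poly3 set" where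
  "fat_ideal K \<mu> = (\<Inter>p\<in>{p. Proper p \<in> K}. ideal_power (point_ideal p) (\<mu> (Proper p)))"

text \<open>
  The points of the surface obtained by blowing up the points of K, where K contains the
  predecessors of its points: a point of this surface is a point outside K all of whose predecessors
  are in K, and its local ring is k[u,v] localized at the origin.
\<close>

definition blowup_surface :: "'k near_point set \<Rightarrow> 'k near_point set" where
  "blowup_surface K = {x. x \<notin> K \<and> predecessors x \<subseteq> K}"

text \<open>
  A divisor is effective iff its local equation at each point is regular there, that is, iff the
  local equation of the part that is subtracted divides that of the total transform of the curve in
  the local ring. At x, only the total exceptional curves of the predecessors of x contribute.
\<close>

definition passes_virtually ::
  "'k::field near_point set \<Rightarrow> ('k near_point \<Rightarrow> nat) \<Rightarrow> 'k poly3 \<Rightarrow> bool" where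
  "passes_virtually K \<mu> f \<longleftrightarrow>
     (\<forall>x\<in>blowup_surface K. \<exists>s. poly (poly s 0) 0 \<noteq> 0 \<and>
        (\<Prod>p\<in>predecessors x. exc_total_transform p x ^ \<mu> p) dvd s * total_transform f x)"

definition full_ideal :: "'k::field near_point set \<Rightarrow> ('k near_point \<Rightarrow> nat) \<Rightarrow> 'k poly3 set" where
  "full_ideal K \<mu> = graded_sum (\<lambda>m. {f \<in> forms m. f = 0 \<or> passes_virtually K \<mu> f})"

end

theory Submission
  imports Defs
begin

text \<open>
  The inclusion of I in its integral closure is the equation f - f = 0. The other three
  inclusions all say that certain orders of vanishing are large enough.

  Integral closure in divisorial cover: let V be a valuation ring that contains R, and let g be
  an element of least value in I. Dividing an integral equation of degree n for f by the n-th
  power of g shows that f/g is integral over V, so it lies in V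
  (\<open>integral_in_valuation_ideal\<close>). The cover is defined by homogeneous components,
  so the same is needed for the components of f. The scalings (x,y,z) \<mapsto> (cx,cy,cz)
  preserve I, so they turn f into elements that also have value at least v(g); these elements
  are the combinations of the components of f with coefficients \<open>c ^ m\<close>, and since
  k is infinite, the components are linear combinations of them
  (\<open>components_in_subspace\<close>).

  Divisorial cover in full ideal: passing virtually through the cluster means that at every
  point x the total transform of f is divisible by the exceptional part
  \<open>exceptional_part\<close>, the product of the equations of the total exceptional curves
  with the multiplicities as exponents. This is shown by induction along the sequence of blowups
  that leads to x. If h is the quotient at the point q, then the step to the exceptional curve
  of q needs order of h at least \<mu>(q). So the order of the total transform at q, which is
  the order of f along that exceptional curve, must be at least that of the exceptional part
  plus \<mu>(q). The elements of I satisfy this bound. For the forms that define \<mu>(q) this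
  holds by definition, and it extends to all of I in degree d because these forms are generic: a
  form of I in degree d plus a multiple of one of them is again one of them, for all but
  finitely many factors (\<open>base_system_facts\<close>). The bound passes to f because the
  order along the exceptional curve extends to a divisorial valuation of Frac R
  (\<open>divisorial_exceptional_curve\<close>). The extension is the order in u of the image of
  f in k[u,v,w], where a form of degree m goes to \<open>w ^ m\<close> times its total
  transform, so that w has value 0. Its residue field is k(v,w). Its center is the prime of the
  proper point below q, whose residue field is k(w) and whose height is two
  (\<open>prime_height_cone\<close>).

  Full ideal in fat ideal: the exceptional curve of a proper base point p contains a point that
  is not a base point, since the proper transform of a generic form meets this curve in the
  zeros of a nonzero polynomial. At such a point, passing virtually means that f has
  multiplicity at least \<mu>(p) at p. Written in linear coordinates of which two vanish at p,
  the form f then has only monomials of degree at least \<mu>(p) in these two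
  (\<open>form_in_point_ideal_power\<close>).
\<close>

section \<open>Ring homomorphisms out of polynomial rings\<close>

definition ring_map :: "('a::comm_ring_1 \<Rightarrow> 'b::comm_ring_1) \<Rightarrow> bool" where
  "ring_map \<phi> \<longleftrightarrow> \<phi> 1 = 1 \<and> (\<forall>a b. \<phi> (a + b) = \<phi> a + \<phi> b) \<and> (\<forall>a b. \<phi> (a * b) = \<phi> a * \<phi> b)"

lemma ring_mapI:
  "\<phi> 1 = 1 \<Longrightarrow> (\<And>a b. \<phi> (a + b) = \<phi> a + \<phi> b) \<Longrightarrow> (\<And>a b. \<phi> (a * b) = \<phi> a * \<phi> b) \<Longrightarrow> ring_map \<phi>"
  by (simp add: ring_map_def)

context
  fixes \<phi> :: "'a::comm_ring_1 \<Rightarrow> 'b::comm_ring_1"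
  assumes hom: "ring_map \<phi>"
begin

lemma ring_map_one: "\<phi> 1 = 1" and ring_map_add: "\<phi> (a + b) = \<phi> a + \<phi> b"
  and ring_map_mult: "\<phi> (a * b) = \<phi> a * \<phi> b"
  using hom by (auto simp: ring_map_def)

lemma ring_map_zero: "\<phi> 0 = 0"
  using ring_map_add[of 0 0] by simp

lemma ring_map_uminus: "\<phi> (- a) = - \<phi> a"
  using ring_map_add[of a "- a"] ring_map_zero by (simp add: eq_neg_iff_add_eq_0 add.commute)

lemma ring_map_diff: "\<phi> (a - b) = \<phi> a - \<phi> b"
  using ring_map_add[of a "- b"] by (simp add: ring_map_uminus)

lemma ring_map_power: "\<phi> (a ^ n) = \<phi> a ^ n"
  by (induction n) (simp_all add: ring_map_one ring_map_mult)

lemma ring_map_sum: "\<phi> (sum f A) = (\<Sum>x\<in>A. \<phi> (f x))"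
  by (induction A rule: infinite_finite_induct) (simp_all add: ring_map_zero ring_map_add)

lemma ring_map_prod: "\<phi> (prod f A) = (\<Prod>x\<in>A. \<phi> (f x))"
  by (induction A rule: infinite_finite_induct) (simp_all add: ring_map_one ring_map_mult)

lemma ring_map_dvd: "a dvd b \<Longrightarrow> \<phi> a dvd \<phi> b"
  by (auto simp: dvd_def ring_map_mult)

end

lemmas ring_map_simps = ring_map_one ring_map_add ring_map_mult ring_map_zero ring_map_uminus
  ring_map_diff ring_map_power ring_map_sum

lemma ring_map_comp: "ring_map \<phi> \<Longrightarrow> ring_map \<psi> \<Longrightarrow> ring_map (\<lambda>x. \<phi> (\<psi> x))"
  by (simp add: ring_map_def)

lemma ring_map_id: "ring_map (\<lambda>x. x)"
  by (simp add: ring_map_def)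

lemma ring_map_const: "ring_map (\<lambda>c::'a::comm_ring_1. [:c:])"
  by (rule ring_mapI) (simp_all add: one_pCons)

lemma ring_map_poly: "ring_map (\<lambda>p::'a::comm_ring_1 poly. poly p a)"
  by (rule ring_mapI) simp_all

definition eval_map :: "('a::comm_ring_1 \<Rightarrow> 'b::comm_ring_1) \<Rightarrow> 'b \<Rightarrow> 'a poly \<Rightarrow> 'b" where
  "eval_map \<phi> a p = poly (map_poly \<phi> p) a"

lemma eval_map_pCons: "\<phi> 0 = 0 \<Longrightarrow> eval_map \<phi> a (pCons c p) = \<phi> c + a * eval_map \<phi> a p"
  by (simp add: eval_map_def map_poly_pCons)

lemma eval_map_0: "eval_map \<phi> a 0 = 0"
  by (simp add: eval_map_def)

lemma eval_map_const: "\<phi> 0 = 0 \<Longrightarrow> eval_map \<phi> a [:c:] = \<phi> c"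
  by (simp add: eval_map_pCons eval_map_0)

lemma ring_map_eval_map:
  assumes "ring_map \<phi>" shows "ring_map (eval_map \<phi> a)"
proof (rule ring_mapI)
  note s = ring_map_simps[OF assms] eval_map_pCons[of \<phi>, OF ring_map_zero[OF assms]] eval_map_0
  show "eval_map \<phi> a 1 = 1"
    by (simp add: one_pCons s)
  show add: "eval_map \<phi> a (p + q) = eval_map \<phi> a p + eval_map \<phi> a q" for p q
  proof (induction p arbitrary: q)
    case (pCons c p)
    obtain b r where q: "q = pCons b r" by (cases q)
    show ?case unfolding q by (simp add: s pCons.IH) (simp add: algebra_simps)
  qed (simp add: s)
  have smult: "eval_map \<phi> a (Polynomial.smult c q) = \<phi> c * eval_map \<phi> a q" for c q
    by (induction q) (simp_all add: s algebra_simps)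
  show "eval_map \<phi> a (p * q) = eval_map \<phi> a p * eval_map \<phi> a q" for p q
    by (induction p) (simp_all add: s add smult algebra_simps)
qed

lemma ring_map_eqI_poly:
  assumes "ring_map \<phi>" "ring_map \<psi>" and c: "\<And>c. \<phi> [:c:] = \<psi> [:c:]" and X: "\<phi> [:0, 1:] = \<psi> [:0, 1:]"
  shows "\<phi> p = \<psi> p"
proof (induction p)
  case (pCons a p)
  have "\<theta> (pCons a p) = \<theta> [:a:] + \<theta> [:0, 1:] * \<theta> p" if "ring_map \<theta>" for \<theta> :: "'a poly \<Rightarrow> 'b"
    using ring_map_add[OF that, of "[:a:]" "[:0, 1:] * p"] ring_map_mult[OF that, of "[:0, 1:]" p] by simp
  from this[OF assms(1)] this[OF assms(2)] show ?case by (simp add: pCons c X)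
qed (simp add: ring_map_zero[OF assms(1)] ring_map_zero[OF assms(2)])

lemma eval_map_var:
  assumes "ring_map \<phi>" shows "eval_map \<phi> a [:0, 1:] = a"
  using eval_map_pCons[of \<phi> a 0 "[:1:]"] eval_map_const[of \<phi> a 1] ring_map_zero[OF assms] ring_map_one[OF assms]
  by (simp del: pCons_one)

definition ev2 :: "('a::comm_ring_1 \<Rightarrow> 'b::comm_ring_1) \<Rightarrow> 'b \<Rightarrow> 'b \<Rightarrow> 'a poly poly \<Rightarrow> 'b" where
  "ev2 \<kappa> a b = eval_map (eval_map \<kappa> a) b"

definition ev3 :: "('a::comm_ring_1 \<Rightarrow> 'b::comm_ring_1) \<Rightarrow> 'b \<Rightarrow> 'b \<Rightarrow> 'b \<Rightarrow> 'a poly poly poly \<Rightarrow> 'b" where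
  "ev3 \<kappa> a b c = eval_map (ev2 \<kappa> a b) c"

lemma subst2_eq_ev2: "subst2 g a b = ev2 cst a b g"
  by (simp add: subst2_def ev2_def eval_map_def[abs_def])

lemma subst3_eq_ev3: "subst3 f a b c = ev3 cst a b c f"
  by (simp add: subst3_def ev3_def eval_map_def subst2_eq_ev2)

abbreviation const3 :: "'k::field \<Rightarrow> 'k poly3" where "const3 c \<equiv> [:[:[:c:]:]:]"
abbreviation varX3 :: "'k::field poly3" where "varX3 \<equiv> [:[:[:0, 1:]:]:]"
abbreviation varY3 :: "'k::field poly3" where "varY3 \<equiv> [:[:0, 1:]:]"
abbreviation varZ3 :: "'k::field poly3" where "varZ3 \<equiv> [:0, 1:]"

lemma ring_map_ev2: "ring_map \<kappa> \<Longrightarrow> ring_map (ev2 \<kappa> a b)"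
  unfolding ev2_def by (intro ring_map_eval_map)

lemma ring_map_ev3: "ring_map \<kappa> \<Longrightarrow> ring_map (ev3 \<kappa> a b c)"
  unfolding ev3_def by (intro ring_map_eval_map ring_map_ev2)

lemma ring_map_cst: "ring_map (cst :: 'k::field \<Rightarrow> _)"
  by (intro ring_map_comp[of "\<lambda>c. [:c:]" "\<lambda>c. [:c:]"] ring_map_const)

lemma ring_map_const3: "ring_map (const3 :: 'k::field \<Rightarrow> _)"
  by (intro ring_map_comp[of "\<lambda>c. [:c:]" cst] ring_map_const ring_map_cst)

lemma
  assumes "ring_map \<kappa>"
  shows ev2_const: "ev2 \<kappa> a b [:[:k:]:] = \<kappa> k"
    and ev2_varU: "ev2 \<kappa> a b [:[:0, 1:]:] = a"
    and ev2_varV: "ev2 \<kappa> a b [:0, 1:] = b"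
  using assms by (simp_all add: ev2_def eval_map_pCons eval_map_0 ring_map_zero[OF assms] ring_map_one[OF assms]
      ring_map_zero[OF ring_map_eval_map] ring_map_one[OF ring_map_eval_map])

lemma ev2_1: "ring_map \<kappa> \<Longrightarrow> ev2 \<kappa> a b 1 = 1"
  and ev2_0: "ring_map \<kappa> \<Longrightarrow> ev2 \<kappa> a b 0 = 0"
  by (simp_all add: ring_map_one[OF ring_map_ev2] ring_map_zero[OF ring_map_ev2])

lemma
  assumes "ring_map \<kappa>"
  shows ev3_const: "ev3 \<kappa> a b c (const3 k) = \<kappa> k"
    and ev3_varX: "ev3 \<kappa> a b c varX3 = a"
    and ev3_varY: "ev3 \<kappa> a b c varY3 = b"
    and ev3_varZ: "ev3 \<kappa> a b c varZ3 = c"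
  using assms
  by (simp_all add: ev3_def eval_map_pCons eval_map_0 ev2_const ev2_varU ev2_varV ev2_1 ev2_0)

lemmas ev2_vars = ev2_const ev2_varU ev2_varV
lemmas ev3_vars = ev3_const ev3_varX ev3_varY ev3_varZ

lemma ring_map_eqI2:
  fixes \<phi> \<psi> :: "'k::field poly2 \<Rightarrow> 'b::comm_ring_1"
  assumes "ring_map \<phi>" "ring_map \<psi>" "\<And>c. \<phi> (cst c) = \<psi> (cst c)" "\<phi> varU = \<psi> varU" "\<phi> varV = \<psi> varV"
  shows "\<phi> p = \<psi> p"
proof (rule ring_map_eqI_poly[OF assms(1,2) _ assms(5)])
  show "\<phi> [:c:] = \<psi> [:c:]" for c
    by (rule ring_map_eqI_poly[OF ring_map_comp[OF assms(1) ring_map_const] ring_map_comp[OF assms(2) ring_map_const]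
          assms(3,4)])
qed

lemma ring_map_eqI3:
  fixes \<phi> \<psi> :: "'k::field poly3 \<Rightarrow> 'b::comm_ring_1"
  assumes "ring_map \<phi>" "ring_map \<psi>" "\<And>c. \<phi> (const3 c) = \<psi> (const3 c)"
    "\<phi> varX3 = \<psi> varX3" "\<phi> varY3 = \<psi> varY3" "\<phi> varZ3 = \<psi> varZ3"
  shows "\<phi> p = \<psi> p"
proof (rule ring_map_eqI_poly[OF assms(1,2) _ assms(6)])
  show "\<phi> [:c:] = \<psi> [:c:]" for c
    by (rule ring_map_eqI2[OF ring_map_comp[OF assms(1) ring_map_const] ring_map_comp[OF assms(2) ring_map_const]
          assms(3,4,5)])
qed

section \<open>Forms\<close>

abbreviation mono3 :: "'k::field \<Rightarrow> nat \<Rightarrow> nat \<Rightarrow> nat \<Rightarrow> 'k poly3" where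
  "mono3 c i j l \<equiv> Polynomial.monom (Polynomial.monom (Polynomial.monom c i) j) l"

abbreviation coeff3 :: "'k::field poly3 \<Rightarrow> nat \<Rightarrow> nat \<Rightarrow> nat \<Rightarrow> 'k" where
  "coeff3 f i j l \<equiv> Polynomial.coeff (Polynomial.coeff (Polynomial.coeff f l) j) i"

lemma poly_additive_induct:
  assumes "P 0" "\<And>a b. P a \<Longrightarrow> P b \<Longrightarrow> P (a + b)"
    and "\<And>l. P (Polynomial.monom (Polynomial.coeff f l) l)"
  shows "P (f :: 'a::comm_monoid_add poly)"
proof -
  have "P (\<Sum>i\<in>A. Polynomial.monom (Polynomial.coeff f i) i)" if "finite A" for A
    using that by (induction A rule: finite_induct) (use assms in auto)
  from this[of "{..Polynomial.degree f}"] show ?thesis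
    by (simp add: poly_as_sum_of_monoms)
qed

lemma poly3_monomial_induct:
  assumes "P 0" "\<And>a b. P a \<Longrightarrow> P b \<Longrightarrow> P (a + b)" "\<And>i j l. P (mono3 (coeff3 f i j l) i j l)"
  shows "P f"
proof (rule poly_additive_induct[of P])
  fix l
  show "P (Polynomial.monom (Polynomial.coeff f l) l)"
  proof (rule poly_additive_induct[of "\<lambda>g. P (Polynomial.monom g l)"])
    fix j
    show "P (Polynomial.monom (Polynomial.monom (Polynomial.coeff (Polynomial.coeff f l) j) j) l)"
      by (rule poly_additive_induct[of "\<lambda>g. P (Polynomial.monom (Polynomial.monom g j) l)"])
        (use assms in \<open>auto simp flip: add_monom\<close>)
  qed (use assms in \<open>auto simp flip: add_monom\<close>)
qed (use assms in auto)

lemma forms_induct [consumes 1, case_names zero add monomial]: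
  assumes "f \<in> forms m" "P 0" "\<And>a b. P a \<Longrightarrow> P b \<Longrightarrow> P (a + b)"
    "\<And>c i j l. i + j + l = m \<Longrightarrow> P (mono3 c i j l)"
  shows "P f"
proof (rule poly3_monomial_induct[of P])
  fix i j l
  show "P (mono3 (coeff3 f i j l) i j l)"
    using assms by (cases "coeff3 f i j l = 0") (auto simp: forms_def)
qed (use assms in auto)

lemma mono3_eq: "mono3 c i j l = const3 c * varX3 ^ i * varY3 ^ j * varZ3 ^ l"
proof -
  have "varX3 ^ i = [:[:Polynomial.monom (1::'a) i:]:]"
    by (simp add: poly_const_pow monom_altdef)
  moreover have "varY3 ^ j = [:Polynomial.monom (1 :: 'a poly) j:]"
    by (simp add: poly_const_pow monom_altdef)
  ultimately show ?thesis
    by (simp add: smult_monom flip: monom_altdef[of 1, simplified])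
qed

lemma forms_mono3: "i + j + l = m \<Longrightarrow> mono3 c i j l \<in> forms m"
  by (auto simp: forms_def split: if_splits)

lemma forms_0: "0 \<in> forms m"
  by (simp add: forms_def)

lemma forms_add: "f \<in> forms m \<Longrightarrow> g \<in> forms m \<Longrightarrow> f + g \<in> forms m"
  by (auto simp: forms_def) (metis add.right_neutral)

lemma mono3_mult: "mono3 c i j l * mono3 c' i' j' l' = mono3 (c * c') (i + i') (j + j') (l + l')"
  by (simp add: mult_monom)

lemma forms_mult:
  assumes "f \<in> forms m" "g \<in> forms n" shows "f * g \<in> forms (m + n)"
  using assms(1)
proof (induction rule: forms_induct)
  case (monomial c i j l)
  from assms(2) show ?case
  proof (induction rule: forms_induct)
    case (monomial c' i' j' l')
    then show ?case using \<open>i + j + l = m\<close> by (auto simp: mono3_mult intro: forms_mono3)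
  qed (auto simp: forms_0 forms_add distrib_left)
qed (auto simp: forms_0 forms_add distrib_right)

lemma forms_const: "const3 c \<in> forms 0"
  using forms_mono3[of 0 0 0 0 c] by (simp add: monom_0)

lemma forms_varX: "varX3 \<in> forms 1" and forms_varY: "varY3 \<in> forms 1"
  and forms_varZ: "varZ3 \<in> forms 1"
  using forms_mono3[of 1 0 0 1 1] forms_mono3[of 0 1 0 1 1] forms_mono3[of 0 0 1 1 1]
  by (simp_all add: monom_0 monom_Suc flip: one_pCons)

lemma forms_const_mult: "f \<in> forms m \<Longrightarrow> const3 c * f \<in> forms m"
  using forms_mult[OF forms_const, of f m c] by simp

lemma forms_diff: "f \<in> forms m \<Longrightarrow> g \<in> forms m \<Longrightarrow> f - g \<in> forms m"
proof -
  have "const3 (-1) = (-1 :: 'a poly3)"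
    using ring_map_uminus[OF ring_map_const3, of "1::'a"] ring_map_one[OF ring_map_const3[where 'k='a]]
    by (simp only:)
  then show "f \<in> forms m \<Longrightarrow> g \<in> forms m \<Longrightarrow> f - g \<in> forms m"
    using forms_add[of f m "const3 (-1) * g"] forms_const_mult[of g m "-1"]
    by (simp only: mult_minus_left mult_1 add_uminus_conv_diff)
qed

lemma forms_power: "f \<in> forms m \<Longrightarrow> f ^ n \<in> forms (n * m)"
proof (induction n)
  case 0
  then show ?case using forms_const[of 1] by (simp flip: one_pCons)
next
  case (Suc n)
  then show ?case using forms_mult[of f m "f ^ n" "n * m"] by simp
qed

lemma ev3_mono3:
  assumes "ring_map \<kappa>"
  shows "ev3 \<kappa> a b c (mono3 k i j l) = \<kappa> k * a ^ i * b ^ j * c ^ l"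
  unfolding mono3_eq
  by (simp add: ring_map_mult[OF ring_map_ev3] ring_map_power[OF ring_map_ev3] ev3_vars assms del: mult_pCons_left)

lemma ev3_homogeneous:
  assumes "ring_map \<kappa>" "f \<in> forms m"
  shows "ev3 \<kappa> (w * a) (w * b) (w * c) f = w ^ m * ev3 \<kappa> a b c f"
  using assms(2)
proof (induction rule: forms_induct)
  case (monomial k i j l)
  show ?case unfolding ev3_mono3[OF assms(1)] monomial[symmetric]
    by (simp add: power_mult_distrib power_add mult_ac)
qed (simp_all add: ring_map_simps[OF ring_map_ev3] assms distrib_left)

text \<open>
  The vanishing beyond N allows the decompositions of two polynomials to be added without
  adjusting their lengths.
\<close>

lemma homogeneous_decomposition:
  "\<exists>N g. (\<forall>m. g m \<in> forms m) \<and> (\<forall>m>N. g m = 0) \<and> f = (\<Sum>m\<le>N. g m)"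
proof (rule poly3_monomial_induct[of "\<lambda>f. \<exists>N g. (\<forall>m. g m \<in> forms m) \<and> (\<forall>m>N. g m = 0) \<and> f = (\<Sum>m\<le>N. g m)"])
  show "\<exists>N g. (\<forall>m. g m \<in> forms m) \<and> (\<forall>m>N. g m = 0) \<and> (0 :: 'a poly3) = (\<Sum>m\<le>N. g m)"
    by (intro exI[of _ 0] exI[of _ "\<lambda>_. 0"]) (simp add: forms_0)
next
  fix a b :: "'a poly3"
  assume "\<exists>N g. (\<forall>m. g m \<in> forms m) \<and> (\<forall>m>N. g m = 0) \<and> a = (\<Sum>m\<le>N. g m)"
    "\<exists>N g. (\<forall>m. g m \<in> forms m) \<and> (\<forall>m>N. g m = 0) \<and> b = (\<Sum>m\<le>N. g m)"
  then obtain N g N' g' where g: "\<forall>m. g m \<in> forms m" "\<forall>m>N. g m = 0" "a = (\<Sum>m\<le>N. g m)"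
    and g': "\<forall>m. g' m \<in> forms m" "\<forall>m>N'. g' m = 0" "b = (\<Sum>m\<le>N'. g' m)" by blast
  have "a = (\<Sum>m\<le>max N N'. g m)" unfolding g(3)
    by (rule sum.mono_neutral_left) (use g in auto)
  moreover have "b = (\<Sum>m\<le>max N N'. g' m)" unfolding g'(3)
    by (rule sum.mono_neutral_left) (use g' in auto)
  ultimately show "\<exists>N g. (\<forall>m. g m \<in> forms m) \<and> (\<forall>m>N. g m = 0) \<and> a + b = (\<Sum>m\<le>N. g m)"
    using g g' by (intro exI[of _ "max N N'"] exI[of _ "\<lambda>m. g m + g' m"])
      (auto simp: sum.distrib intro: forms_add)
next
  fix i j l
  let ?c = "mono3 (coeff3 f i j l) i j l"
  have "?c = (\<Sum>m\<le>i+j+l. if m = i+j+l then ?c else 0)"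
    by (subst sum.delta) auto
  then show "\<exists>N g. (\<forall>m. g m \<in> forms m) \<and> (\<forall>m>N. g m = 0) \<and> ?c = (\<Sum>m\<le>N. g m)"
    by (intro exI[of _ "i+j+l"] exI[of _ "\<lambda>m. if m = i+j+l then ?c else 0"])
      (auto simp: forms_0 forms_mono3)
qed


section \<open>Ideals and powers\<close>

lemma ring_of_type_algebra_simps:
  "carrier (ring_of_type_algebra :: 'a::ring_1 ring) = UNIV"
  "monoid.mult (ring_of_type_algebra :: 'a::ring_1 ring) a b = a * b"
  "ring.add (ring_of_type_algebra :: 'a::ring_1 ring) a b = a + b"
  "monoid.one (ring_of_type_algebra :: 'a::ring_1 ring) = 1"
  "ring.zero (ring_of_type_algebra :: 'a::ring_1 ring) = 0"
  by (simp_all add: ring_of_type_algebra_def)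

lemma ideal_closed:
  assumes "ideal J (ring_of_type_algebra :: 'a::comm_ring_1 ring)"
  shows "0 \<in> J" "a \<in> J \<Longrightarrow> b \<in> J \<Longrightarrow> a + b \<in> J" "a \<in> J \<Longrightarrow> r * a \<in> J" "a \<in> J \<Longrightarrow> a * r \<in> J"
  using ideal.I_l_closed[OF assms] ideal.I_r_closed[OF assms]
    additive_subgroup.zero_closed[OF ideal.axioms(1)[OF assms]]
    additive_subgroup.a_closed[OF ideal.axioms(1)[OF assms]]
  by (auto simp: ring_of_type_algebra_simps)

lemma ideal_sum:
  assumes "ideal J (ring_of_type_algebra :: 'a::comm_ring_1 ring)" "\<And>x. x \<in> A \<Longrightarrow> f x \<in> J"
  shows "sum f A \<in> J"
  using assms(2) by (induction A rule: infinite_finite_induct) (auto intro: ideal_closed[OF assms(1)])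

lemma idealI_type:
  assumes "0 \<in> J" "\<And>a b. a \<in> J \<Longrightarrow> b \<in> J \<Longrightarrow> a + b \<in> J" "\<And>a r. a \<in> J \<Longrightarrow> r * a \<in> J"
  shows "ideal J (ring_of_type_algebra :: 'a::comm_ring_1 ring)"
proof -
  interpret ring "ring_of_type_algebra :: 'a ring" by (rule ring_from_type_algebra)
  have inv: "\<ominus>\<^bsub>ring_of_type_algebra\<^esub> a = - a" for a :: 'a
    by (rule minus_equality) (auto simp: ring_of_type_algebra_simps)
  show ?thesis
  proof (rule idealI[OF ring_axioms])
    show "subgroup J (add_monoid (ring_of_type_algebra :: 'a ring))"
    proof (rule add.subgroupI)
      fix a assume "a \<in> J"
      then show "\<ominus>\<^bsub>ring_of_type_algebra\<^esub> a \<in> J" using assms(3)[of a "-1"] by (simp add: inv)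
    qed (use assms in \<open>auto simp: ring_of_type_algebra_simps\<close>)
  qed (use assms(3) in \<open>auto simp: ring_of_type_algebra_simps mult.commute\<close>)
qed

lemma genideal_ideal_type: "ideal (Idl\<^bsub>ring_of_type_algebra\<^esub> S) (ring_of_type_algebra :: 'a::comm_ring_1 ring)"
proof -
  interpret ring "ring_of_type_algebra :: 'a ring" by (rule ring_from_type_algebra)
  show ?thesis by (rule genideal_ideal) (simp add: ring_of_type_algebra_simps)
qed

lemma genideal_incl: "S \<subseteq> Idl\<^bsub>(ring_of_type_algebra :: 'a::comm_ring_1 ring)\<^esub> S"
proof -
  interpret ring "ring_of_type_algebra :: 'a ring" by (rule ring_from_type_algebra)
  show ?thesis by (rule genideal_self) (simp add: ring_of_type_algebra_simps)
qed

lemma genideal_least: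
  "ideal J (ring_of_type_algebra :: 'a::comm_ring_1 ring) \<Longrightarrow> S \<subseteq> J \<Longrightarrow> Idl\<^bsub>ring_of_type_algebra\<^esub> S \<subseteq> J"
proof -
  interpret ring "ring_of_type_algebra :: 'a ring" by (rule ring_from_type_algebra)
  show "ideal J (ring_of_type_algebra :: 'a::comm_ring_1 ring) \<Longrightarrow> S \<subseteq> J \<Longrightarrow> Idl\<^bsub>ring_of_type_algebra\<^esub> S \<subseteq> J"
    by (rule genideal_minimal)
qed

lemma ideal_power_0: "ideal_power J 0 = UNIV"
  by (simp add: ideal_power_def ideals_set_def ring_of_type_algebra_simps)

lemma ideal_power_Suc: "ideal_power J (Suc n) = ideal_prod Rxyz (ideal_power J n) J"
  by (simp add: ideal_power_def ideals_set_def)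

lemma ideal_power_ideal:
  assumes "ideal J Rxyz" shows "ideal (ideal_power J n) Rxyz"
proof -
  interpret ring "Rxyz :: 'a poly3 ring" by (rule ring_from_type_algebra)
  show ?thesis
  proof (induction n)
    case 0
    show ?case using oneideal by (simp add: ideal_power_0 ring_of_type_algebra_simps)
  qed (simp add: ideal_power_Suc ideal_prod_is_ideal assms)
qed

lemma ideal_power_mult: "a \<in> ideal_power J n \<Longrightarrow> b \<in> J \<Longrightarrow> a * b \<in> ideal_power J (Suc n)"
  using ideal_prod.prod[of a "ideal_power J n" b J Rxyz] by (simp add: ideal_power_Suc ring_of_type_algebra_simps)

lemma ideal_power_1: "J \<subseteq> ideal_power J 1"
  using ideal_power_mult[of 1 J 0] by (auto simp: ideal_power_0)

lemma power_mult_in_ideal_power: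
  assumes "ideal J Rxyz" "a \<in> J" "b \<in> J" "n \<le> i + j"
  shows "a ^ i * b ^ j * c \<in> ideal_power J n"
proof -
  have pow: "b ^ j \<in> ideal_power J j" if "b \<in> J" for j b
    by (induction j) (use that in \<open>auto simp: ideal_power_0 power_Suc2 intro: ideal_power_mult simp del: power_Suc\<close>)
  have step: "x * b ^ j \<in> ideal_power J (i + j)" if "x \<in> ideal_power J i" for x i j
  proof (induction j)
    case (Suc j)
    show ?case using ideal_power_mult[OF Suc assms(3)] by (simp add: mult_ac)
  qed (use that in simp)
  have mono: "ideal_power J (n + m) \<subseteq> ideal_power J n" for n m
  proof (induction m)
    case (Suc m)
    have "ideal_prod Rxyz (ideal_power J (n + m)) J \<subseteq> ideal_power J (n + m)"
      using ring.ideal_prod_inter[OF ring_from_type_algebra ideal_power_ideal[OF assms(1)] assms(1)] by blast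
    then show ?case using Suc by (simp add: ideal_power_Suc)
  qed simp
  have "a ^ i * b ^ j \<in> ideal_power J (i + j)" by (rule step[OF pow[OF assms(2)]])
  then have "a ^ i * b ^ j \<in> ideal_power J n"
    using mono[of n "i + j - n"] assms(4) by auto
  then show ?thesis by (rule ideal_closed(4)[OF ideal_power_ideal[OF assms(1)]])
qed


section \<open>The integral closure is contained in the divisorial cover\<close>

lemma ideal_subset_integral_closure:
  assumes "ideal J Rxyz" shows "J \<subseteq> integral_closure J"
proof
  fix f assume f: "f \<in> J"
  have "- f \<in> ideal_power J 1"
    using ideal_power_1 ideal_closed(3)[OF assms f, of "-1"] by auto
  with f show "f \<in> integral_closure J"
    unfolding integral_closure_def by (intro CollectI exI[of _ 1] exI[of _ "\<lambda>_. - f"]) auto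
qed

lemma valuation_ring_closed:
  assumes "valuation_ring V"
  shows "0 \<in> V" "1 \<in> V" "a \<in> V \<Longrightarrow> b \<in> V \<Longrightarrow> a + b \<in> V" "a \<in> V \<Longrightarrow> b \<in> V \<Longrightarrow> a * b \<in> V"
    "a \<in> V \<Longrightarrow> - a \<in> V" "a \<in> V \<or> inverse a \<in> V"
proof -
  have sub: "subring V Frac" using assms by (simp add: valuation_ring_def)
  interpret ring "Frac :: 'a frac3 ring" by (rule ring_from_type_algebra)
  have inv: "\<ominus>\<^bsub>Frac\<^esub> a = - a" for a :: "'a frac3"
    by (rule minus_equality) (auto simp: ring_of_type_algebra_simps)
  show "0 \<in> V" using subringE(2)[OF sub] by (simp add: ring_of_type_algebra_simps)
  then show "a \<in> V \<or> inverse a \<in> V" using assms by (cases "a = 0") (auto simp: valuation_ring_def)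
  show "1 \<in> V" "a \<in> V \<Longrightarrow> b \<in> V \<Longrightarrow> a + b \<in> V" "a \<in> V \<Longrightarrow> b \<in> V \<Longrightarrow> a * b \<in> V"
    "a \<in> V \<Longrightarrow> - a \<in> V"
    using subringE(3,5,6,7)[OF sub] by (auto simp: ring_of_type_algebra_simps inv)
qed

lemma valuation_ring_sum: "valuation_ring V \<Longrightarrow> (\<And>x. x \<in> A \<Longrightarrow> f x \<in> V) \<Longrightarrow> sum f A \<in> V"
  by (induction A rule: infinite_finite_induct) (auto intro: valuation_ring_closed)

lemma valuation_ring_power: "valuation_ring V \<Longrightarrow> a \<in> V \<Longrightarrow> a ^ n \<in> V"
  by (induction n) (auto intro: valuation_ring_closed)

text \<open>
  If u is not in V, then its inverse is. Multiplying the equation by the power n - 1 of the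
  inverse expresses u as a polynomial in the inverse, with coefficients in V.
\<close>

lemma valuation_ring_integrally_closed:
  assumes V: "valuation_ring V" and n: "n \<ge> 1" and b: "\<And>i. i \<in> {1..n} \<Longrightarrow> b i \<in> V"
    and eq: "u ^ n + (\<Sum>i=1..n. b i * u ^ (n - i)) = 0"
  shows "u \<in> V"
proof (rule ccontr)
  assume nu: "u \<notin> V"
  then have inv: "inverse u \<in> V" and u0: "u \<noteq> 0"
    using valuation_ring_closed(1)[OF V] valuation_ring_closed(6)[OF V, of u] by auto
  obtain m where m: "n = Suc m" using n by (cases n) auto
  have "u ^ n = - (\<Sum>i=1..n. b i * u ^ (n - i))" using eq by (simp add: eq_neg_iff_add_eq_0)
  then have "inverse u ^ m * u ^ n = - (\<Sum>i=1..n. b i * (inverse u ^ m * u ^ (n - i)))"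
    by (simp add: sum_distrib_left mult_ac)
  also have "inverse u ^ m * u ^ n = u" using u0 by (simp add: m field_simps)
  also have "(\<Sum>i=1..n. b i * (inverse u ^ m * u ^ (n - i))) = (\<Sum>i=1..n. b i * inverse u ^ (i - 1))"
  proof (rule sum.cong[OF refl])
    fix i assume i: "i \<in> {1..n}"
    then have "m = (i - 1) + (n - i)" using m by auto
    then have "inverse u ^ m = inverse u ^ (i - 1) * inverse u ^ (n - i)" by (metis power_add)
    then show "b i * (inverse u ^ m * u ^ (n - i)) = b i * inverse u ^ (i - 1)"
      using u0 by (simp add: power_mult_distrib[symmetric])
  qed
  finally have "u = - (\<Sum>i=1..n. b i * inverse u ^ (i - 1))" .
  moreover have "\<dots> \<in> V"
    by (intro valuation_ring_closed[OF V] valuation_ring_sum[OF V] valuation_ring_power[OF V] b inv)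
  ultimately show False using nu by simp
qed

text \<open>
  The i-th power of J is mapped into \<open>g ^ i\<close> V, so an integral equation for f,
  divided by the n-th power of g, is an integral equation for \<open>\<chi> f / g\<close> over
  V. The homomorphism \<chi> will be the inclusion of R in its field of fractions composed with
  a scaling of the variables.
\<close>

lemma integral_in_valuation_ideal:
  assumes V: "valuation_ring V" and \<chi>: "ring_map \<chi>" and g: "g \<noteq> 0"
    and RV: "\<And>r. \<chi> r \<in> V"
    and J: "\<And>h. h \<in> J \<Longrightarrow> \<exists>c\<in>V. \<chi> h = g * c" and f: "f \<in> integral_closure J"
  shows "\<exists>c\<in>V. \<chi> f = g * c"
proof -
  obtain n a where n: "n \<ge> 1" and a: "\<And>i. i \<in> {1..n} \<Longrightarrow> a i \<in> ideal_power J i"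
    and eq: "f ^ n + (\<Sum>i=1..n. a i * f ^ (n - i)) = 0"
    using f unfolding integral_closure_def by blast
  have pow: "\<exists>c\<in>V. \<chi> h = g ^ i * c" if "h \<in> ideal_power J i" for h i
    using that
  proof (induction i arbitrary: h)
    case 0
    then show ?case using RV[of h] by auto
  next
    case (Suc i)
    from Suc.prems show ?case unfolding ideal_power_Suc
    proof (induction rule: ideal_prod.induct)
      case (prod p q)
      obtain c c' where "c \<in> V" "c' \<in> V" "\<chi> p = g ^ i * c" "\<chi> q = g * c'"
        using Suc.IH[OF prod(1)] J[OF prod(2)] by blast
      then show ?case by (intro bexI[of _ "c * c'"])
          (auto simp: ring_of_type_algebra_simps ring_map_mult[OF \<chi>] intro: valuation_ring_closed[OF V])
    next
      case (sum p q)
      then obtain c c' where "c \<in> V" "c' \<in> V" "\<chi> p = g ^ Suc i * c" "\<chi> q = g ^ Suc i * c'" by blast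
      then show ?case by (intro bexI[of _ "c + c'"])
          (auto simp: ring_of_type_algebra_simps ring_map_add[OF \<chi>] algebra_simps intro: valuation_ring_closed[OF V])
    qed
  qed
  define b where "b i = \<chi> (a i) / g ^ i" for i
  have b: "b i \<in> V" if i: "i \<in> {1..n}" for i
    using pow[OF a[OF i]] g by (auto simp: b_def)
  have "\<chi> f / g \<in> V"
  proof (rule valuation_ring_integrally_closed[OF V n])
    have summand: "b i * (\<chi> f / g) ^ (n - i) = \<chi> (a i * f ^ (n - i)) / g ^ n" if "i \<in> {1..n}" for i
    proof -
      have "g ^ n = g ^ i * g ^ (n - i)" using that by (simp flip: power_add)
      then show ?thesis
        by (simp add: b_def ring_map_mult[OF \<chi>] ring_map_power[OF \<chi>] power_divide)
    qed
    have "(\<Sum>i=1..n. b i * (\<chi> f / g) ^ (n - i)) = (\<Sum>i=1..n. \<chi> (a i * f ^ (n - i)) / g ^ n)"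
      by (rule sum.cong[OF refl summand])
    then have "(\<chi> f / g) ^ n + (\<Sum>i=1..n. b i * (\<chi> f / g) ^ (n - i)) =
       \<chi> (f ^ n + (\<Sum>i=1..n. a i * f ^ (n - i))) / g ^ n"
      by (simp add: ring_map_add[OF \<chi>] ring_map_sum[OF \<chi>] ring_map_power[OF \<chi>] power_divide
          add_divide_distrib sum_divide_distrib)
    then show "(\<chi> f / g) ^ n + (\<Sum>i=1..n. b i * (\<chi> f / g) ^ (n - i)) = 0"
      unfolding eq by (simp add: ring_map_zero[OF \<chi>])
  qed (use b in auto)
  then show ?thesis using g by (intro bexI[of _ "\<chi> f / g"]) auto
qed

lemma alg_closed_infinite: "infinite (UNIV :: 'k::alg_closed_field set)"
proof
  assume fin: "finite (UNIV :: 'k set)"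
  define p where "p = (\<Prod>a\<in>(UNIV :: 'k set). [:- a, 1:]) + 1"
  have eval: "poly p x = 1" for x
    using fin by (auto simp: p_def poly_prod intro!: prod_zero)
  have "Polynomial.degree p > 0"
  proof -
    have "Polynomial.degree (\<Prod>a\<in>(UNIV :: 'k set). [:- a, 1:]) = card (UNIV :: 'k set)"
      by (subst degree_prod_eq_sum_degree) auto
    moreover have "card (UNIV :: 'k set) > 0"
      using fin by (simp add: card_gt_0_iff)
    ultimately show ?thesis
      unfolding p_def by (subst degree_add_eq_left) auto
  qed
  then obtain x where "poly p x = 0" using alg_closed_imp_poly_has_root by blast
  with eval show False by simp
qed

lemma exists_non_root_of_unity:
  "\<exists>c::'k::alg_closed_field. \<forall>j. 1 \<le> j \<and> j \<le> n \<longrightarrow> c ^ j \<noteq> 1 \<and> c \<noteq> 0"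
proof -
  define q where "q = [:0, 1:] * (\<Prod>j\<in>{1..n}. Polynomial.monom (1::'k) j - 1)"
  have "Polynomial.monom (1::'k) j - 1 \<noteq> 0" if "j \<in> {1..n}" for j
    using that by (metis Polynomial.degree_1 atLeastAtMost_iff degree_monom_eq eq_iff_diff_eq_0 not_one_le_zero one_neq_zero)
  then have "q \<noteq> 0" unfolding q_def by auto
  then have "finite {x. poly q x = 0}" by (rule poly_roots_finite)
  then obtain c where "poly q c \<noteq> 0"
    using alg_closed_infinite[where 'k='k] by (metis (mono_tags, lifting) UNIV_I finite_subset mem_Collect_eq subsetI)
  then show ?thesis by (intro exI[of _ c]) (auto simp: q_def poly_prod poly_monom)
qed

text \<open>
  Induction on N. Write P(c) for the sum. The combination \<open>P (c * e) - e ^ (N + 1) * P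
  c\<close> has no term of index N + 1, and its term of index m is multiplied by \<open>e ^ m -
  e ^ (N + 1)\<close>, which is nonzero if e is not a root of unity of order at most N + 1.
\<close>

lemma components_in_subspace:
  fixes S :: "'k::alg_closed_field poly3 set"
  assumes S0: "0 \<in> S" and add: "\<And>a b. a \<in> S \<Longrightarrow> b \<in> S \<Longrightarrow> a + b \<in> S"
    and smult: "\<And>c a. a \<in> S \<Longrightarrow> const3 c * a \<in> S"
  shows "(\<And>c. (\<Sum>m\<le>N. const3 (c ^ m) * g m) \<in> S) \<Longrightarrow> m \<le> N \<Longrightarrow> g m \<in> S"
proof (induction N arbitrary: g m)
  case 0
  have "(\<Sum>m\<le>0. const3 (0 ^ m) * g m) = g 0" by (simp flip: one_pCons)
  then show ?case using 0(1)[of 0] 0(2) by (simp only: le_zero_eq)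
next
  case (Suc N)
  have diff: "a - b \<in> S" if "a \<in> S" "b \<in> S" for a b
  proof -
    have "const3 (-1) * b = - b"
      using ring_map_uminus[OF ring_map_const3, of "1::'k"] ring_map_one[OF ring_map_const3[where 'k='k]]
      by (metis mult_minus1)
    then show ?thesis using add[OF that(1) smult[OF that(2), of "-1"]] by (simp only: add_uminus_conv_diff)
  qed
  note cm = ring_map_mult[OF ring_map_const3] and cd = ring_map_diff[OF ring_map_const3]
  obtain e :: 'k where e: "\<And>j. 1 \<le> j \<Longrightarrow> j \<le> Suc N \<Longrightarrow> e ^ j \<noteq> 1 \<and> e \<noteq> 0"
    using exists_non_root_of_unity by blast
  have unit: "x \<in> S" if "a * b = 1" "a * (b * x) \<in> S" for a b x
    using that(2) by (simp only: mult.assoc[symmetric] that(1) mult_1)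
  have low: "g m \<in> S" if m: "m \<le> N" for m
  proof -
    have "const3 (e ^ m - e ^ Suc N) * g m \<in> S"
    proof (rule Suc.IH[of "\<lambda>m. const3 (e ^ m - e ^ Suc N) * g m", OF _ m])
      fix c
      have "(\<Sum>m\<le>N. const3 (c ^ m) * (const3 (e ^ m - e ^ Suc N) * g m))
        = (\<Sum>m\<le>Suc N. const3 (c ^ m) * (const3 (e ^ m - e ^ Suc N) * g m))"
        by simp
      also have "\<dots> = (\<Sum>m\<le>Suc N. const3 ((c * e) ^ m) * g m) - const3 (e ^ Suc N) * (\<Sum>m\<le>Suc N. const3 (c ^ m) * g m)"
        unfolding sum_distrib_left sum_subtractf[symmetric] power_mult_distrib cm cd
        by (rule sum.cong[OF refl]) (simp only: algebra_simps)
      also have "\<dots> \<in> S"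
        by (intro diff smult Suc.prems)
      finally show "(\<Sum>m\<le>N. const3 (c ^ m) * (const3 (e ^ m - e ^ Suc N) * g m)) \<in> S" .
    qed
    then have "const3 (inverse (e ^ m - e ^ Suc N)) * (const3 (e ^ m - e ^ Suc N) * g m) \<in> S"
      by (rule smult)
    moreover have "e ^ m - e ^ Suc N \<noteq> 0"
    proof -
      have "e ^ Suc N = e ^ m * e ^ (Suc N - m)" using m by (metis le_Suc_eq le_add_diff_inverse power_add)
      then show ?thesis using e[of "Suc N - m"] m by auto
    qed
    then have "const3 (inverse (e ^ m - e ^ Suc N)) * const3 (e ^ m - e ^ Suc N) = 1"
      unfolding cm[symmetric] by (subst Fields.left_inverse) (auto simp flip: one_pCons)
    ultimately show ?thesis
      by (rule unit[rotated])
  qed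
  have top: "g (Suc N) = (\<Sum>m\<le>Suc N. const3 (1 ^ m) * g m) - (\<Sum>m\<le>N. g m)"
    by (simp flip: one_pCons)
  have "(\<Sum>m\<in>A. g m) \<in> S" if "A \<subseteq> {..N}" for A
    using that by (induction A rule: infinite_finite_induct) (auto intro: S0 add low)
  then have "g (Suc N) \<in> S" unfolding top by (intro diff Suc.prems(1)) auto
  then show ?case using low Suc.prems(2) by (auto simp: le_Suc_eq)
qed


lemma ring_map_Fract: "ring_map (\<lambda>r::'a::idom. Fract r 1)"
  by (rule ring_mapI) (simp_all add: One_fract_def)

lemma Fract_1_eq_0_iff: "Fract (r::'a::idom) 1 = 0 \<longleftrightarrow> r = 0"
  by (simp add: Zero_fract_def eq_fract)

lemma val_le_refl: "valuation_ring V \<Longrightarrow> val_le V f f"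
  unfolding val_le_def using valuation_ring_closed(2)[of V] by (intro bexI[of _ 1]) auto

lemma val_le_trans: "valuation_ring V \<Longrightarrow> val_le V f g \<Longrightarrow> val_le V g h \<Longrightarrow> val_le V f h"
  unfolding val_le_def using valuation_ring_closed(4)[of V] by (auto simp: mult.assoc)

lemma val_le_total: 
  assumes V: "valuation_ring V" shows "val_le V f g \<or> val_le V g f"
proof (cases "Fract f 1 = 0 \<or> Fract g 1 = 0")
  case True
  then show ?thesis
    unfolding val_le_def using valuation_ring_closed(1)[OF V] by (auto intro: bexI[of _ 0])
next
  case False
  have "Fract g 1 = Fract f 1 * (Fract g 1 / Fract f 1)" "Fract f 1 = Fract g 1 * (Fract f 1 / Fract g 1)"
    using False by (simp_all del: divide_fract mult_fract)
  moreover have "inverse (Fract g 1 / Fract f 1) = Fract f 1 / Fract g 1"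
    by (simp del: divide_fract inverse_fract)
  ultimately show ?thesis
    unfolding val_le_def using valuation_ring_closed(6)[OF V, of "Fract g 1 / Fract f 1"] by metis
qed

lemma val_le_ideal:
  assumes V: "valuation_ring V" and R: "\<And>r. Fract r 1 \<in> V"
  shows "ideal {h. val_le V g h} Rxyz"
proof (rule idealI_type)
  show "0 \<in> {h. val_le V g h}"
    unfolding val_le_def using valuation_ring_closed(1)[OF V]
    by (auto intro!: bexI[of _ 0] simp: Zero_fract_def)
next
  fix a b assume "a \<in> {h. val_le V g h}" "b \<in> {h. val_le V g h}"
  then obtain c d where cd: "c \<in> V" "d \<in> V" "Fract a 1 = Fract g 1 * c" "Fract b 1 = Fract g 1 * d"
    unfolding val_le_def by blast
  have "Fract (a + b) 1 = Fract g 1 * (c + d)"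
    unfolding ring_map_add[OF ring_map_Fract] cd by (rule distrib_left[symmetric])
  then show "a + b \<in> {h. val_le V g h}"
    unfolding val_le_def using valuation_ring_closed(3)[OF V cd(1,2)] by blast
next
  fix a r assume "a \<in> {h. val_le V g h}"
  then obtain c where c: "c \<in> V" "Fract a 1 = Fract g 1 * c" unfolding val_le_def by blast
  have "Fract (r * a) 1 = Fract g 1 * (Fract r 1 * c)"
    unfolding ring_map_mult[OF ring_map_Fract] c(2) by (rule mult.left_commute)
  then show "r * a \<in> {h. val_le V g h}"
    unfolding val_le_def using valuation_ring_closed(4)[OF V R c(1)] by blast
qed

lemma val_le_minimum:
  assumes V: "valuation_ring V" and "finite S" "S \<noteq> {}"
  shows "\<exists>g\<in>S. \<forall>h\<in>S. val_le V g h"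
  using assms(2,3)
proof (induction rule: finite_ne_induct)
  case (singleton x)
  then show ?case using val_le_refl[OF V] by simp
next
  case (insert x F)
  then obtain g where g: "g \<in> F" "\<forall>h\<in>F. val_le V g h" by blast
  show ?case
    using val_le_total[OF V, of g x] val_le_trans[OF V, of x g] val_le_refl[OF V, of x] g by blast
qed

lemma ev3_vars_id: "ev3 const3 varX3 varY3 varZ3 f = f"
  by (rule ring_map_eqI3[OF ring_map_ev3[OF ring_map_const3] ring_map_id]) (rule ev3_vars[OF ring_map_const3])+

abbreviation scaling :: "'k::field \<Rightarrow> 'k poly3 \<Rightarrow> 'k poly3" where
  "scaling c \<equiv> ev3 const3 (const3 c * varX3) (const3 c * varY3) (const3 c * varZ3)"

lemma scaling_forms:
  assumes "f \<in> forms m" shows "scaling c f = const3 (c ^ m) * f"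
  unfolding ev3_homogeneous[OF ring_map_const3 assms] ev3_vars_id ring_map_power[OF ring_map_const3] ..

text \<open>
  An integral element need not be homogeneous, and its components are reached through its
  scalings: these are again bounded by the minimal value on I, because I is generated by forms.
\<close>

lemma integral_closure_subset_divisorial_cover:
  fixes S :: "'k::alg_closed_field poly3 set"
  assumes S: "finite S" "S \<subseteq> forms d" "\<not> S \<subseteq> {0}" and I: "I = Idl\<^bsub>Rxyz\<^esub> S"
  shows "integral_closure I \<subseteq> divisorial_cover I"
proof
  fix f assume f: "f \<in> integral_closure I"
  have idI: "ideal I Rxyz" and SI: "S \<subseteq> I" unfolding I by (rule genideal_ideal_type genideal_incl)+
  obtain N g where g: "\<And>m. g m \<in> forms m" "\<And>m. m > N \<Longrightarrow> g m = 0" and fg: "f = (\<Sum>m\<le>N. g m)"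
    using homogeneous_decomposition by blast
  have "val_ideal_le V I (g m)" if div: "divisorial V" for V m
  proof -
    have V: "valuation_ring V" and R: "\<And>r. Fract r 1 \<in> V"
      using div by (auto simp: divisorial_def)
    obtain s where s: "s \<in> S" "\<And>h. h \<in> S \<Longrightarrow> val_le V s h"
      using val_le_minimum[OF V S(1)] S(3) by auto
    have "s \<noteq> 0"
    proof
      assume "s = 0"
      then have "Fract h 1 = 0" if "h \<in> S" for h
        using s(2)[OF that] unfolding val_le_def by (auto simp: Zero_fract_def[symmetric])
      then show False using S(3) unfolding Fract_1_eq_0_iff by blast
    qed
    have min: "val_le V s h" if "h \<in> I" for h
      using genideal_least[OF val_le_ideal[OF V R, of s], of S] s(2) that unfolding I by blast
    let ?J = "{h. val_le V s h}"
    note J = ideal_closed[OF val_le_ideal[OF V R, of s]]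
    have "(\<Sum>m\<le>N. const3 (c ^ m) * g m) \<in> ?J" for c
    proof -
      have scI: "scaling c h \<in> I" if "h \<in> I" for h
      proof -
        note sc = ring_map_ev3[OF ring_map_const3, of "const3 c * varX3" "const3 c * varY3" "const3 c * varZ3"]
        have "ideal {h. scaling c h \<in> I} Rxyz"
          by (rule idealI_type; unfold mem_Collect_eq ring_map_zero[OF sc] ring_map_add[OF sc] ring_map_mult[OF sc])
            (intro ideal_closed[OF idI]; assumption)+
        moreover have "scaling c h \<in> I" if "h \<in> S" for h
          using that S(2) SI by (subst scaling_forms[of _ d]) (auto intro!: ideal_closed(3)[OF idI] simp del: mult_pCons_left)
        ultimately have "I \<subseteq> {h. scaling c h \<in> I}" unfolding I by (intro genideal_least) auto
        with that show ?thesis by blast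
      qed
      have "\<exists>v\<in>V. Fract (scaling c f) 1 = Fract s 1 * v"
      proof (rule integral_in_valuation_ideal[where \<chi> = "\<lambda>f. Fract (scaling c f) 1" and J = I, OF V _ _ _ _ f])
        show "ring_map (\<lambda>f. Fract (scaling c f) 1)"
          by (rule ring_map_comp[OF ring_map_Fract ring_map_ev3[OF ring_map_const3]])
        show "Fract s 1 \<noteq> 0" unfolding Fract_1_eq_0_iff by fact
        show "\<exists>v\<in>V. Fract (scaling c h) 1 = Fract s 1 * v" if "h \<in> I" for h
          using min[OF scI[OF that]] unfolding val_le_def .
      qed (rule R)
      moreover have "scaling c f = (\<Sum>m\<le>N. const3 (c ^ m) * g m)"
        unfolding fg ring_map_sum[OF ring_map_ev3[OF ring_map_const3]] scaling_forms[OF g(1)] ..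
      ultimately show ?thesis unfolding val_le_def by simp
    qed
    then have "m \<le> N \<Longrightarrow> g m \<in> ?J"
      using components_in_subspace[where S = ?J and N = N and g = g and m = m] J(1-3) by blast
    then have "val_le V s (g m)" using g(2)[of m] J(1) by (cases "m \<le> N") auto
    with s min SI show ?thesis unfolding val_ideal_le_def by blast
  qed
  with g fg show "f \<in> divisorial_cover I"
    unfolding divisorial_cover_def graded_sum_def by blast
qed


section \<open>The prime of a point has height two\<close>

text \<open>
  An elementwise form of \<open>primeideal\<close>, in which the preimage of a prime under a
  ring homomorphism between types is visibly prime.
\<close>

definition prime_set :: "'a::comm_ring_1 set \<Rightarrow> bool" where
  "prime_set Q \<longleftrightarrow> 0 \<in> Q \<and> (\<forall>a\<in>Q. \<forall>b\<in>Q. a + b \<in> Q) \<and> (\<forall>a\<in>Q. \<forall>r. r * a \<in> Q) \<and> 1 \<notin> Q \<and>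
     (\<forall>a b. a * b \<in> Q \<longrightarrow> a \<in> Q \<or> b \<in> Q)"

lemma prime_set_closed:
  assumes "prime_set Q"
  shows "0 \<in> Q" "a \<in> Q \<Longrightarrow> b \<in> Q \<Longrightarrow> a + b \<in> Q" "a \<in> Q \<Longrightarrow> r * a \<in> Q" "1 \<notin> Q"
    "a * b \<in> Q \<Longrightarrow> a \<in> Q \<or> b \<in> Q" "a \<in> Q \<Longrightarrow> b \<in> Q \<Longrightarrow> a - b \<in> Q"
proof -
  show 1: "0 \<in> Q" "a \<in> Q \<Longrightarrow> b \<in> Q \<Longrightarrow> a + b \<in> Q" "a \<in> Q \<Longrightarrow> r * a \<in> Q" "1 \<notin> Q"
    "a * b \<in> Q \<Longrightarrow> a \<in> Q \<or> b \<in> Q" for a b r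
    using assms unfolding prime_set_def by blast+
  show "a \<in> Q \<Longrightarrow> b \<in> Q \<Longrightarrow> a - b \<in> Q"
    using 1(2)[of a "-1 * b"] 1(3)[of b "-1"] by simp
qed

lemma primeideal_iff_prime_set:
  "primeideal Q (ring_of_type_algebra :: 'a::comm_ring_1 ring) \<longleftrightarrow> prime_set Q"
proof
  assume Q: "primeideal Q (ring_of_type_algebra :: 'a ring)"
  note id = primeideal.axioms(1)[OF Q]
  have "1 \<notin> Q"
    using primeideal.I_notcarr[OF Q] ideal_closed(3)[OF id, of 1] by (auto simp: ring_of_type_algebra_simps)
  then show "prime_set Q"
    using ideal_closed[OF id] primeideal.I_prime[OF Q]
    unfolding prime_set_def by (auto simp: ring_of_type_algebra_simps)
next
  assume Q: "prime_set Q"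
  show "primeideal Q (ring_of_type_algebra :: 'a ring)"
  proof (rule primeidealI)
    show "ideal Q (ring_of_type_algebra :: 'a ring)"
      by (rule idealI_type) (use prime_set_closed[OF Q] in auto)
    show "cring (ring_of_type_algebra :: 'a ring)" by (rule cring_from_type_algebra)
  qed (use prime_set_closed[OF Q] in \<open>auto simp: ring_of_type_algebra_simps\<close>)
qed

lemma prime_set_vimage:
  assumes "ring_map \<phi>" "prime_set Q" shows "prime_set (\<phi> -` Q)"
  unfolding prime_set_def vimage_eq ring_map_zero[OF assms(1)] ring_map_one[OF assms(1)]
    ring_map_add[OF assms(1)] ring_map_mult[OF assms(1)]
  using prime_set_closed[OF assms(2)] by simp

lemma prime_set_0: "prime_set {0 :: 'a::idom}"
  by (simp add: prime_set_def)

lemma prime_set_power: "prime_set Q \<Longrightarrow> a ^ n \<in> Q \<Longrightarrow> a \<in> Q"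
  by (induction n) (auto dest: prime_set_closed)

text \<open>
  If Q contains no nonzero constant, let r be an element of least degree in Q. By
  pseudo-division, r divides a nonzero constant multiple of every element of Q. Applied to an
  element of least degree in Q', this gives r in Q', since the cofactor has smaller degree;
  applied to any element of Q, it then gives that Q is contained in Q'.
\<close>

lemma prime_chain_meets_coefficients:
  fixes Q Q' :: "'a::idom poly set"
  assumes Q': "prime_set Q'" and Q: "prime_set Q" and sub: "Q' \<subset> Q" and ne: "Q' \<noteq> {0}"
  shows "\<exists>a. a \<noteq> 0 \<and> [:a:] \<in> Q"
proof (rule ccontr)
  assume "\<not> ?thesis"
  then have cst: "a = 0" if "[:a:] \<in> Q" for a using that by blast
  note Qc = prime_set_closed[OF Q] and Qc' = prime_set_closed[OF Q']
  have min: "\<exists>r\<in>A. r \<noteq> 0 \<and> (\<forall>t\<in>A. t \<noteq> 0 \<longrightarrow> Polynomial.degree r \<le> Polynomial.degree t)"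
    if A: "A \<noteq> {0}" "0 \<in> A" for A :: "'a poly set"
  proof -
    obtain r where "r \<in> A \<and> r \<noteq> 0" using A by blast
    from ex_has_least_nat[of "\<lambda>r. r \<in> A \<and> r \<noteq> 0", OF this, of Polynomial.degree] show ?thesis by blast
  qed
  obtain t where t: "t \<in> Q'" "t \<noteq> 0" "\<And>s. s \<in> Q' \<Longrightarrow> s \<noteq> 0 \<Longrightarrow> Polynomial.degree t \<le> Polynomial.degree s"
    using min[OF ne Qc'(1)] by blast
  have "Q \<noteq> {0}" using t(1,2) sub by blast
  then obtain r where r: "r \<in> Q" "r \<noteq> 0" "\<And>s. s \<in> Q \<Longrightarrow> s \<noteq> 0 \<Longrightarrow> Polynomial.degree r \<le> Polynomial.degree s"
    using min[OF _ Qc(1)] by blast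
  have deg_r: "Polynomial.degree r > 0"
  proof (rule ccontr)
    assume "\<not> ?thesis"
    then obtain a where "r = [:a:]" by (auto elim: degree_eq_zeroE)
    with cst r show False by auto
  qed
  have div: "\<exists>a q. a \<noteq> 0 \<and> Polynomial.smult a h = r * q" if h: "h \<in> Q" for h
  proof -
    obtain a q where a: "a \<noteq> 0" "Polynomial.smult a h = r * q + pseudo_mod h r"
      and s: "pseudo_mod h r = 0 \<or> Polynomial.degree (pseudo_mod h r) < Polynomial.degree r"
      using pseudo_mod[OF r(2), of h] by blast
    have "pseudo_mod h r = [:a:] * h - q * r" using a(2) by (simp add: mult.commute)
    also have "\<dots> \<in> Q" by (intro Qc(6,3) h r(1))
    finally have "pseudo_mod h r = 0" using s r(3) by force
    with a show ?thesis by auto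
  qed
  have "r \<in> Q'"
  proof -
    obtain a q where a: "a \<noteq> 0" "Polynomial.smult a t = r * q" using div t(1) sub by blast
    have q0: "q \<noteq> 0" using a t(2) by auto
    have "Polynomial.degree t = Polynomial.degree r + Polynomial.degree q"
      using arg_cong[OF a(2), of Polynomial.degree] a(1) r(2) q0 by (simp add: degree_mult_eq)
    then have "q \<notin> Q'" using t(3)[of q] q0 deg_r by auto
    moreover have "r * q \<in> Q'" using Qc'(3)[OF t(1), of "[:a:]"] a(2) by simp
    ultimately show ?thesis using Qc'(5) by blast
  qed
  have "h \<in> Q'" if h: "h \<in> Q" for h
  proof -
    obtain a q where a: "a \<noteq> 0" "Polynomial.smult a h = r * q" using div h by blast
    have "[:a:] * h \<in> Q'" using Qc'(3)[OF \<open>r \<in> Q'\<close>, of q] a(2) by (simp add: mult.commute)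
    then show ?thesis using Qc'(5) cst[of a] a(1) sub by blast
  qed
  with sub show False by blast
qed

text \<open>
  In the coordinates given by \<chi>, every element of P vanishes on the line where the second
  and the third coordinate are zero. The previous lemma gives a nonzero polynomial a in the first two
  coordinates that lies in c2. Split off the highest power of the second coordinate: the other
  factor does not vanish on the line, so it is not in c2, and the second coordinate is.
\<close>

lemma prime_chain_contains_coordinate:
  fixes \<chi> :: "'k::field poly3 \<Rightarrow> 'k poly3"
  assumes \<chi>: "ring_map \<chi>" "surj \<chi>" and c1: "prime_set c1" "c1 \<noteq> {0}" and c2: "prime_set c2"
    and sub: "c1 \<subset> c2" "c2 \<subseteq> P"
    and P: "\<And>g. \<chi> g \<in> P \<Longrightarrow> poly (poly g 0) 0 = 0"
  shows "\<chi> varY3 \<in> c2"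
proof -
  have "\<chi> -` c1 \<subset> \<chi> -` c2" using \<chi>(2) sub(1) by (metis surj_image_vimage_eq psubset_eq subset_vimage_iff vimage_mono)
  moreover have "\<chi> -` c1 \<noteq> {0}"
  proof
    assume "\<chi> -` c1 = {0}"
    then have "c1 \<subseteq> {\<chi> 0}" using \<chi>(2) by (metis image_empty image_insert order_refl surj_image_vimage_eq)
    then show False using c1(2) prime_set_closed(1)[OF c1(1)] by (auto simp: ring_map_zero[OF \<chi>(1)])
  qed
  ultimately obtain a where a: "a \<noteq> 0" "\<chi> [:a:] \<in> c2"
    using prime_chain_meets_coefficients[OF prime_set_vimage[OF \<chi>(1) c1(1)] prime_set_vimage[OF \<chi>(1) c2]] by auto
  obtain b where b: "a = [:0, 1:] ^ order 0 a * b" "\<not> [:0, 1:] dvd b"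
    using order_decomp[OF a(1), of 0] by auto
  have "\<chi> [:a:] = \<chi> varY3 ^ order 0 a * \<chi> [:b:]"
    by (subst b(1)) (simp only: ring_map_mult[OF ring_map_const] ring_map_power[OF ring_map_const] ring_map_mult[OF \<chi>(1)] ring_map_power[OF \<chi>(1)])
  moreover have "\<chi> [:b:] \<notin> c2"
    using b(2) P[of "[:b:]"] sub(2) by (auto simp: poly_eq_0_iff_dvd)
  ultimately show ?thesis using a(2) prime_set_closed(5)[OF c2] prime_set_power[OF c2] by metis
qed

text \<open>
  Linear coordinates adapted to a point: their local equations there are u, v and 1
  (\<open>local_equation_lin\<close>).
\<close>

fun linX :: "'k::field plane_point \<Rightarrow> 'k poly3" where
  "linX (Affine a b) = varX3 - const3 a * varZ3"
| "linX (Line_Inf a) = varX3 - const3 a * varY3"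
| "linX Point_Inf = varY3"

fun linY :: "'k::field plane_point \<Rightarrow> 'k poly3" where
  "linY (Affine a b) = varY3 - const3 b * varZ3"
| "linY (Line_Inf a) = varZ3"
| "linY Point_Inf = varZ3"

fun linW :: "'k::field plane_point \<Rightarrow> 'k poly3" where
  "linW (Affine a b) = varZ3"
| "linW (Line_Inf a) = varY3"
| "linW Point_Inf = varX3"

lemma forms_lin: "linX p \<in> forms 1" "linY p \<in> forms 1" "linW p \<in> forms 1"
  by (cases p; simp only: linX.simps linY.simps linW.simps;
      intro forms_diff forms_const_mult forms_varX forms_varY forms_varZ)+

lemma coordinates_from_lin:
  assumes "\<And>r s. r \<in> A \<Longrightarrow> s \<in> A \<Longrightarrow> r + s \<in> A" "\<And>c r. r \<in> A \<Longrightarrow> const3 c * r \<in> A"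
    and "linX p \<in> A" "linY p \<in> A" "linW p \<in> A"
  shows "varX3 \<in> A" "varY3 \<in> A" "varZ3 \<in> A"
proof -
  have *: "r \<in> A" if "r - const3 a * s \<in> A" "s \<in> A" for r s a
    using assms(1)[OF that(1) assms(2)[OF that(2), of a]] by (simp only: diff_add_cancel)
  have "varX3 \<in> A \<and> varY3 \<in> A \<and> varZ3 \<in> A"
  proof (cases p)
    case (Affine a b)
    then show ?thesis using assms(3-5) *[of varX3 a varZ3] *[of varY3 b varZ3]
      by (simp only: linX.simps linY.simps linW.simps)
  next
    case (Line_Inf a)
    then show ?thesis using assms(3-5) *[of varX3 a varY3]
      by (simp only: linX.simps linY.simps linW.simps)
  next
    case Point_Inf
    then show ?thesis using assms(3-5) by (simp only: linX.simps linY.simps linW.simps)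
  qed
  then show "varX3 \<in> A" "varY3 \<in> A" "varZ3 \<in> A" by blast+
qed

lemma poly3_in_subring:
  assumes "\<And>c. const3 c \<in> A" "\<And>r s. r \<in> A \<Longrightarrow> s \<in> A \<Longrightarrow> r + s \<in> A" "\<And>r s. r \<in> A \<Longrightarrow> s \<in> A \<Longrightarrow> r * s \<in> A"
    and "varX3 \<in> A" "varY3 \<in> A" "varZ3 \<in> A"
  shows "f \<in> A"
proof (rule poly3_monomial_induct[of "\<lambda>f. f \<in> A"])
  have "1 \<in> A" using assms(1)[of 1] by (simp flip: one_pCons)
  then have pow: "r ^ n \<in> A" if "r \<in> A" for r n
    by (induction n) (use that assms(3) in auto)
  show "mono3 (coeff3 f i j l) i j l \<in> A" for i j l
    unfolding mono3_eq by (intro assms(3) pow assms(1,4-6))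
  show "0 \<in> A" using assms(1)[of 0] by simp
qed (rule assms(2))

lemma surj_if_lin_in_range:
  assumes \<chi>: "ring_map \<chi>" and c: "\<And>c. \<chi> (const3 c) = const3 c"
    and "linX p \<in> range \<chi>" "linY p \<in> range \<chi>" "linW p \<in> range \<chi>"
  shows "surj \<chi>"
proof -
  have 1: "const3 c \<in> range \<chi>" for c using c[of c] by (metis rangeI)
  have 2: "r + s \<in> range \<chi>" "r * s \<in> range \<chi>" if "r \<in> range \<chi>" "s \<in> range \<chi>" for r s
    using that by (auto simp: ring_map_add[OF \<chi>, symmetric] ring_map_mult[OF \<chi>, symmetric])
  have "f \<in> range \<chi>" for f
    by (rule poly3_in_subring[OF 1 2 coordinates_from_lin[OF 2(1) 2(2)[OF 1] assms(3-5)]])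
  then show ?thesis by blast
qed

text \<open>
  Restriction to the line in affine space that a point of the plane stands for, parametrized by
  the coordinate \<open>linW\<close>, and to a plane that contains this line. Their kernels are
  the primes of height two and one in a chain below the homogeneous prime of the point.
\<close>

definition cone_map :: "'k::field plane_point \<Rightarrow> 'k poly3 \<Rightarrow> 'k poly" where
  "cone_map p = (case homog_coords p of (a, b, c) \<Rightarrow> ev3 (\<lambda>c. [:c:]) [:0, a:] [:0, b:] [:0, c:])"

lemma ring_map_cone_map: "ring_map (cone_map p)"
  unfolding cone_map_def by (auto split: prod.split intro: ring_map_ev3 ring_map_const)

lemma cone_map_const: "cone_map p (const3 c) = [:c:]"
  unfolding cone_map_def by (auto split: prod.split simp: ev3_vars ring_map_const)

lemma cone_map_lin: "cone_map p (linX p) = 0" "cone_map p (linY p) = 0" "cone_map p (linW p) = [:0, 1:]"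
proof -
  note r = ring_map_ev3[OF ring_map_const]
  show "cone_map p (linX p) = 0" "cone_map p (linY p) = 0" "cone_map p (linW p) = [:0, 1:]"
    by (cases p; simp only: cone_map_def homog_coords.simps linX.simps linY.simps linW.simps prod.case
      ring_map_diff[OF r] ring_map_mult[OF r] ev3_vars[OF ring_map_const]; simp)+
qed

fun plane_map :: "'k::field plane_point \<Rightarrow> 'k poly3 \<Rightarrow> 'k poly2" where
  "plane_map (Affine a b) = ev3 cst (cst a * varU) (cst b * varU + varV) varU"
| "plane_map (Line_Inf a) = ev3 cst (cst a * varU) varU varV"
| "plane_map Point_Inf = ev3 cst varU 0 varV"

lemma ring_map_plane_map: "ring_map (plane_map p)"
  by (cases p) (simp_all only: plane_map.simps ring_map_ev3 ring_map_cst)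

lemma plane_map_lin: "plane_map p (linX p) = 0" "plane_map p (linY p) = varV"
proof -
  note r = ring_map_ev3[OF ring_map_cst]
  show "plane_map p (linX p) = 0" "plane_map p (linY p) = varV"
    by (cases p; simp only: plane_map.simps linX.simps linY.simps
      ring_map_diff[OF r] ring_map_mult[OF r] ev3_vars[OF ring_map_cst]; simp)+
qed

lemma cone_map_plane_map: "cone_map p f = poly (plane_map p f) 0"
proof (rule ring_map_eqI3[OF ring_map_cone_map ring_map_comp[OF ring_map_poly ring_map_plane_map]])
  show "cone_map p (const3 c) = poly (plane_map p (const3 c)) 0" for c
    by (cases p) (simp_all only: cone_map_const plane_map.simps ev3_vars[OF ring_map_cst], simp_all)
  show "cone_map p varX3 = poly (plane_map p varX3) 0" "cone_map p varY3 = poly (plane_map p varY3) 0"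
    "cone_map p varZ3 = poly (plane_map p varZ3) 0"
    by (cases p; simp only: cone_map_def homog_coords.simps prod.case plane_map.simps ev3_vars[OF ring_map_cst] ev3_vars[OF ring_map_const]; simp)+
qed

lemma lin_nonzero: "linX p \<noteq> 0"
  by (cases p) auto

text \<open>
  A prime that is strictly below the prime of the line and strictly above a nonzero prime
  contains both linear forms that vanish on the line, by
  \<open>prime_chain_contains_coordinate\<close> with either of them as second coordinate. Hence
  it is the whole prime of the line. So no chain is longer than 0, the prime of a plane, the
  prime of the line.
\<close>

lemma prime_height_cone:
  "prime_height {f. cone_map p f = 0} = enat 2"
proof -
  let ?P = "{f. cone_map p f = 0}"
  have P: "prime_set ?P"
    using prime_set_vimage[OF ring_map_cone_map prime_set_0, of p] by (simp add: vimage_def)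
  have bound: "n \<le> 2" if c: "\<And>i. i \<le> n \<Longrightarrow> prime_set (c i)" "\<And>i. i < n \<Longrightarrow> c i \<subset> c (Suc i)" "c n = ?P" for n c
  proof (rule ccontr)
    assume "\<not> n \<le> 2"
    then obtain m where m: "n = Suc (Suc (Suc m))" by (metis less_Suc_eq_le not_less_eq numeral_2_eq_2 old.nat.exhaust not_less zero_less_Suc)
    let ?c1 = "c (Suc m)" and ?c2 = "c (Suc (Suc m))"
    have pr: "prime_set ?c1" "prime_set ?c2" "prime_set (c m)" using c(1) m by auto
    have sub: "c m \<subset> ?c1" "?c1 \<subset> ?c2" "?c2 \<subset> ?P"
      using c(2)[of m] c(2)[of "Suc m"] c(2)[of "Suc (Suc m)"] c(3) m by auto
    have "?c1 \<noteq> {0}" using sub(1) prime_set_closed(1)[OF pr(3)] by auto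
    have coord: "\<chi> varY3 \<in> ?c2"
      if \<chi>: "\<chi> = ev3 const3 (linW p) a b" and ab: "{a, b} = {linX p, linY p}" for \<chi> a b
    proof (rule prime_chain_contains_coordinate[OF _ _ pr(1) \<open>?c1 \<noteq> {0}\<close> pr(2) sub(2)])
      show r: "ring_map \<chi>" unfolding \<chi> by (intro ring_map_ev3 ring_map_const3)
      have rng: "linW p \<in> range \<chi>" "a \<in> range \<chi>" "b \<in> range \<chi>"
        unfolding \<chi> by (rule range_eqI ev3_vars[OF ring_map_const3, symmetric])+
      show "surj \<chi>"
        by (rule surj_if_lin_in_range[OF r, of p])
          (use ab rng in \<open>auto simp: \<chi> ev3_vars ring_map_const3 doubleton_eq_iff\<close>)
      show "c (Suc (Suc m)) \<subseteq> ?P" using sub(3) by blast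
      show "poly (poly g 0) 0 = 0" if g: "\<chi> g \<in> ?P" for g
      proof -
        have "cone_map p (\<chi> g) = poly (poly g 0) 0"
        proof (rule ring_map_eqI3[OF ring_map_comp[OF ring_map_cone_map r] ring_map_comp[OF ring_map_poly ring_map_poly]])
          have "cone_map p a = 0" "cone_map p b = 0"
            using ab cone_map_lin(1,2)[of p] by (auto simp: doubleton_eq_iff)
          then show "cone_map p (\<chi> varX3) = poly (poly varX3 0) 0" "cone_map p (\<chi> varY3) = poly (poly varY3 0) 0"
            "cone_map p (\<chi> varZ3) = poly (poly varZ3 0) 0" "\<And>c. cone_map p (\<chi> (const3 c)) = poly (poly (const3 c) 0) 0"
            unfolding \<chi> by (simp_all only: ev3_vars[OF ring_map_const3] cone_map_lin cone_map_const) simp_all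
        qed
        with g show ?thesis by simp
      qed
    qed
    have linc: "linX p \<in> ?c2" "linY p \<in> ?c2"
      using coord[OF refl, of "linX p" "linY p"] coord[OF refl, of "linY p" "linX p"]
      by (simp_all only: ev3_vars[OF ring_map_const3] insert_commute simp_thms refl)
    \<comment> \<open>modulo the two linear forms, every polynomial is a polynomial in the third coordinate\<close>
    have mod: "\<exists>h. f - eval_map const3 (linW p) h \<in> ?c2" for f
    proof -
      note e = ring_map_eval_map[OF ring_map_const3, of "linW p"]
      note Q = prime_set_closed[OF pr(2)]
      let ?A = "{f. \<exists>h. f - eval_map const3 (linW p) h \<in> ?c2}"
      have 1: "const3 c \<in> ?A" for c
        using Q(1) by (auto intro!: exI[of _ "[:c:]"] simp: eval_map_const)
      have 2: "r + s \<in> ?A" "r * s \<in> ?A" if rs: "r \<in> ?A" "s \<in> ?A" for r s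
      proof -
        obtain h k where hk: "r - eval_map const3 (linW p) h \<in> ?c2" "s - eval_map const3 (linW p) k \<in> ?c2"
          using rs by blast
        have "r + s - eval_map const3 (linW p) (h + k) =
          (r - eval_map const3 (linW p) h) + (s - eval_map const3 (linW p) k)"
          by (simp add: ring_map_add[OF e])
        then have "r + s - eval_map const3 (linW p) (h + k) \<in> ?c2" using Q(2)[OF hk] by (simp only:)
        then show "r + s \<in> ?A" by blast
        have "r * s - eval_map const3 (linW p) (h * k) =
          s * (r - eval_map const3 (linW p) h) + eval_map const3 (linW p) h * (s - eval_map const3 (linW p) k)"
          by (simp add: ring_map_mult[OF e] algebra_simps)
        then have "r * s - eval_map const3 (linW p) (h * k) \<in> ?c2"
          using Q(2)[OF Q(3)[OF hk(1)] Q(3)[OF hk(2)]] by (simp only:)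
        then show "r * s \<in> ?A" by blast
      qed
      have W: "eval_map const3 (linW p) [:0, 1:] = linW p"
        by (simp add: eval_map_pCons eval_map_0 ring_map_one[OF e] flip: one_pCons)
      have "r \<in> ?A" if "r \<in> ?c2" for r
        using that by (intro CollectI exI[of _ 0]) (simp add: eval_map_0)
      moreover have "linW p \<in> ?A"
        using Q(1) by (intro CollectI exI[of _ "[:0, 1:]"]) (simp add: W)
      ultimately have 3: "linX p \<in> ?A" "linY p \<in> ?A" "linW p \<in> ?A"
        using linc by blast+
      show ?thesis using poly3_in_subring[OF 1 2 coordinates_from_lin[OF 2(1) 2(2)[OF 1] 3], of f] by blast
    qed
    have ev: "cone_map p (eval_map const3 (linW p) h) = h" for h
      by (rule ring_map_eqI_poly[OF ring_map_comp[OF ring_map_cone_map ring_map_eval_map[OF ring_map_const3]] ring_map_id])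
        (simp_all add: eval_map_pCons eval_map_0 cone_map_const cone_map_lin ring_map_one[OF ring_map_eval_map[OF ring_map_const3]]
          ring_map_one[OF ring_map_cone_map] ring_map_add[OF ring_map_cone_map] ring_map_mult[OF ring_map_cone_map] flip: one_pCons)
    have "?P \<subseteq> ?c2"
    proof
      fix f assume f: "f \<in> ?P"
      obtain h where h: "f - eval_map const3 (linW p) h \<in> ?c2" using mod by blast
      then have "cone_map p (f - eval_map const3 (linW p) h) = 0" using sub(3) by blast
      then have "h = 0" using f by (simp add: ring_map_diff[OF ring_map_cone_map] ev)
      with h show "f \<in> ?c2" by (simp add: eval_map_0)
    qed
    with sub(3) show False by blast
  qed
  let ?c = "\<lambda>i::nat. if i = 0 then {0} else if i = 1 then {f. plane_map p f = 0} else ?P"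
  have plane: "prime_set {f. plane_map p f = 0}"
    using prime_set_vimage[OF ring_map_plane_map prime_set_0, of p] by (simp add: vimage_def)
  have "{0} \<subset> {f. plane_map p f = 0}"
    using plane_map_lin(1)[of p] lin_nonzero[of p] ring_map_zero[OF ring_map_plane_map, of p] by blast
  moreover have "{f. plane_map p f = 0} \<subset> ?P"
  proof
    show "{f. plane_map p f = 0} \<subseteq> ?P" by (auto simp: cone_map_plane_map)
    have "linY p \<in> ?P" "linY p \<notin> {f. plane_map p f = 0}"
      using plane_map_lin(2)[of p] cone_map_lin(2)[of p] by simp_all
    then show "{f. plane_map p f = 0} \<noteq> ?P" by blast
  qed
  ultimately have chain: "(\<forall>i\<le>2. prime_set (?c i)) \<and> (\<forall>i<2. ?c i \<subset> ?c (Suc i)) \<and> ?c 2 = ?P"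
    using P plane prime_set_0 by (auto simp: less_2_cases_iff)
  show ?thesis
    unfolding prime_height_def primeideal_iff_prime_set
  proof (rule antisym)
    let ?N = "{enat n |n. \<exists>c. (\<forall>i\<le>n. prime_set (c i)) \<and> (\<forall>i<n. c i \<subset> c (Suc i)) \<and> c n = ?P}"
    show "Sup ?N \<le> enat 2"
    proof (rule Sup_least)
      fix e assume "e \<in> ?N"
      then obtain n c where "e = enat n" "\<forall>i\<le>n. prime_set (c i)" "\<forall>i<n. c i \<subset> c (Suc i)" "c n = ?P"
        by blast
      with bound[of n c] show "e \<le> enat 2" by simp
    qed
    show "enat 2 \<le> Sup ?N"
      by (rule Sup_upper, rule CollectI, rule exI[of _ 2], rule conjI[OF refl], rule exI[of _ ?c], rule chain)
  qed
qed


section \<open>Order of vanishing and blowing up\<close>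

abbreviation coeff2 :: "'k::field poly2 \<Rightarrow> nat \<Rightarrow> nat \<Rightarrow> 'k" where
  "coeff2 F i j \<equiv> Polynomial.coeff (Polynomial.coeff F j) i"

abbreviation mono2 :: "'k::field \<Rightarrow> nat \<Rightarrow> nat \<Rightarrow> 'k poly2" where
  "mono2 c i j \<equiv> Polynomial.monom (Polynomial.monom c i) j"

text \<open>
  The relation \<open>n \<le> mult0 F\<close> for nonzero F. It also holds for F = 0, where the
  value of \<open>mult0\<close> is arbitrary, so it is closed under addition.
\<close>

definition ord_ge :: "nat \<Rightarrow> 'k::field poly2 \<Rightarrow> bool" where
  "ord_ge n F \<longleftrightarrow> (\<forall>i j. i + j < n \<longrightarrow> coeff2 F i j = 0)"

lemma poly2_monomial_induct:
  assumes "P 0" "\<And>a b. P a \<Longrightarrow> P b \<Longrightarrow> P (a + b)" "\<And>c i j. P (mono2 c i j)"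
  shows "P F"
proof (rule poly_additive_induct[of P])
  fix j
  show "P (Polynomial.monom (Polynomial.coeff F j) j)"
    by (rule poly_additive_induct[of "\<lambda>g. P (Polynomial.monom g j)"])
      (use assms in \<open>auto simp flip: add_monom\<close>)
qed (use assms in auto)

lemma mono2_eq: "mono2 c i j = cst c * varU ^ i * varV ^ j"
proof -
  have "varU ^ i = [:Polynomial.monom (1::'a) i:]"
    by (simp add: poly_const_pow monom_altdef)
  then show ?thesis
    by (simp add: smult_monom flip: monom_altdef[of 1, simplified])
qed

lemma ev2_mono2:
  assumes "ring_map \<kappa>"
  shows "ev2 \<kappa> a b (mono2 k i j) = \<kappa> k * a ^ i * b ^ j"
  unfolding mono2_eq ring_map_mult[OF ring_map_ev2[OF assms]] ring_map_power[OF ring_map_ev2[OF assms]]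
    ev2_vars[OF assms] ..

lemma varU_power: "varU ^ n = [:Polynomial.monom 1 n:]"
  by (simp add: poly_const_pow monom_altdef)

lemma varU_power_dvd_iff: "varU ^ n dvd F \<longleftrightarrow> (\<forall>i j. i < n \<longrightarrow> coeff2 F i j = 0)"
  unfolding varU_power const_poly_dvd_iff monom_1_dvd_iff' by blast

lemma varV_power_dvd_iff: "varV ^ n dvd F \<longleftrightarrow> (\<forall>i j. j < n \<longrightarrow> coeff2 F i j = 0)"
proof -
  have *: "varV ^ n = Polynomial.monom 1 n" by (simp add: monom_altdef)
  show ?thesis unfolding * monom_1_dvd_iff' poly_eq_iff[where q = 0] by auto
qed

lemma blow_up_Slope: "blow_up (Slope c) = ev2 cst varU (varU * (varV + cst c))"
  by (simp add: subst2_eq_ev2 fun_eq_iff del: mult_pCons_left)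

lemma blow_up_Vertical: "blow_up Vertical = ev2 cst (varU * varV) varV"
  by (simp add: subst2_eq_ev2 fun_eq_iff del: mult_pCons_left)

lemma ring_map_blow_up: "ring_map (blow_up t)"
  by (cases t) (simp_all only: blow_up_Slope blow_up_Vertical ring_map_ev2 ring_map_cst)

lemma blow_up_cst: "blow_up t (cst c) = cst c"
  by (cases t) (simp_all only: blow_up_Slope blow_up_Vertical ev2_vars ring_map_cst)

lemma coeff2_blow_up_Slope_0:
  "coeff2 (blow_up (Slope 0) F) a b = (if b \<le> a then coeff2 F (a - b) b else 0)"
proof -
  note r = ring_map_blow_up[of "Slope (0::'a)"]
  have "\<forall>a b. coeff2 (blow_up (Slope 0) F) a b = (if b \<le> a then coeff2 F (a - b) b else 0)"
  proof (rule poly2_monomial_induct[where P = "\<lambda>F. \<forall>a b. coeff2 (blow_up (Slope 0) F) a b = (if b \<le> a then coeff2 F (a - b) b else 0)"])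
    fix c :: 'a and i j
    have "blow_up (Slope 0) (mono2 c i j) = cst c * varU ^ i * (varU * (varV + cst 0)) ^ j"
      unfolding blow_up_Slope by (rule ev2_mono2[OF ring_map_cst])
    also have "\<dots> = mono2 c (i + j) j"
      unfolding mono2_eq by (simp add: power_add power_mult_distrib mult_ac del: mult_pCons_left mult_pCons_right)
    finally show "\<forall>a b. coeff2 (blow_up (Slope 0) (mono2 c i j)) a b = (if b \<le> a then coeff2 (mono2 c i j) (a - b) b else 0)"
      by auto
  qed (simp_all add: ring_map_zero[OF r] ring_map_add[OF r] del: blow_up.simps)
  then show ?thesis by blast
qed

lemma coeff2_blow_up_Vertical:
  "coeff2 (blow_up Vertical F) a b = (if a \<le> b then coeff2 F a (b - a) else 0)"
proof -
  note r = ring_map_blow_up[of "Vertical :: 'a direction"]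
  have "\<forall>a b. coeff2 (blow_up Vertical F) a b = (if a \<le> b then coeff2 F a (b - a) else 0)"
  proof (rule poly2_monomial_induct[where P = "\<lambda>F. \<forall>a b. coeff2 (blow_up Vertical F) a b = (if a \<le> b then coeff2 F a (b - a) else 0)"])
    fix c :: 'a and i j
    have "blow_up Vertical (mono2 c i j) = cst c * (varU * varV) ^ i * varV ^ j"
      unfolding blow_up_Vertical by (rule ev2_mono2[OF ring_map_cst])
    also have "\<dots> = mono2 c i (i + j)"
      unfolding mono2_eq by (simp add: power_add power_mult_distrib mult_ac del: mult_pCons_left mult_pCons_right)
    finally show "\<forall>a b. coeff2 (blow_up Vertical (mono2 c i j)) a b = (if a \<le> b then coeff2 (mono2 c i j) a (b - a) else 0)"
      by auto
  qed (simp_all add: ring_map_zero[OF r] ring_map_add[OF r] del: blow_up.simps)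
  then show ?thesis by blast
qed

text \<open>
  The translation along the exceptional curve u = 0 that relates the charts centered at its
  points.
\<close>

definition shift :: "'k::field \<Rightarrow> 'k poly2 \<Rightarrow> 'k poly2" where
  "shift c = ev2 cst varU (varV + cst c)"

lemma ring_map_shift: "ring_map (shift c)"
  unfolding shift_def by (intro ring_map_ev2 ring_map_cst)

lemma shift_vars: "shift c (cst k) = cst k" "shift c varU = varU" "shift c varV = varV + cst c"
  unfolding shift_def by (rule ev2_vars[OF ring_map_cst])+

lemma shift_shift: "shift (- c) (shift c F) = F"
  by (rule ring_map_eqI2[OF ring_map_comp[OF ring_map_shift ring_map_shift] ring_map_id])
    (simp_all only: shift_vars ring_map_add[OF ring_map_shift], simp)

lemma blow_up_Slope_shift: "blow_up (Slope c) F = shift c (blow_up (Slope 0) F)"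
proof (rule ring_map_eqI2[OF ring_map_blow_up ring_map_comp[OF ring_map_shift ring_map_blow_up]])
  have s0: "shift c 0 = 0" by (rule ring_map_zero[OF ring_map_shift])
  show "blow_up (Slope c) (cst k) = shift c (blow_up (Slope 0) (cst k))" for k
    by (simp only: blow_up_cst shift_vars)
  show "blow_up (Slope c) varU = shift c (blow_up (Slope 0) varU)" 
    "blow_up (Slope c) varV = shift c (blow_up (Slope 0) varV)"
    by (simp_all only: blow_up_Slope ev2_vars[OF ring_map_cst] shift_vars ring_map_mult[OF ring_map_shift]
        ring_map_add[OF ring_map_shift], simp)
qed

lemma varU_power_dvd_shift_iff: "varU ^ n dvd shift c F \<longleftrightarrow> varU ^ n dvd F"
proof -
  have *: "varU ^ n dvd shift c F" if "varU ^ n dvd F" for c :: 'a and F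
    using ring_map_dvd[OF ring_map_shift that, of c] by (simp only: ring_map_power[OF ring_map_shift] shift_vars)
  show ?thesis using *[of F c] *[of "shift c F" "- c"] by (auto simp only: shift_shift)
qed

text \<open>
  The order of a curve at a point is its order along the exceptional curve, in every chart: the
  monomial \<open>u ^ i * v ^ j\<close> becomes \<open>u ^ (i + j) * (v + c) ^ j\<close> or
  \<open>u ^ i * v ^ (i + j)\<close>.
\<close>

lemma exc_power_dvd_blow_up_iff: "exc_equation t ^ n dvd blow_up t F \<longleftrightarrow> ord_ge n F"
proof (cases t)
  case (Slope c)
  have "exc_equation t ^ n dvd blow_up t F \<longleftrightarrow> varU ^ n dvd blow_up (Slope 0) F"
    unfolding Slope exc_equation.simps blow_up_Slope_shift[of c] varU_power_dvd_shift_iff ..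
  also have "\<dots> \<longleftrightarrow> ord_ge n F"
    unfolding varU_power_dvd_iff coeff2_blow_up_Slope_0 ord_ge_def
    by (metis add_diff_cancel_right' le_add2 le_add_diff_inverse2)
  finally show ?thesis .
next
  case Vertical
  show ?thesis
    unfolding Vertical exc_equation.simps varV_power_dvd_iff coeff2_blow_up_Vertical ord_ge_def
    by (metis add_diff_cancel_left' le_add1 le_add_diff_inverse)
qed

lemma poly2_nonzero_coeff: "F \<noteq> 0 \<Longrightarrow> \<exists>i j. coeff2 F i j \<noteq> 0"
  by (metis coeff_0 poly_eqI)

lemma ord_ge_mult0_iff:
  assumes "F \<noteq> 0" shows "ord_ge n F \<longleftrightarrow> n \<le> mult0 F"
proof -
  let ?P = "\<lambda>n. \<exists>i j. i + j = n \<and> coeff2 F i j \<noteq> 0"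
  have ex: "\<exists>n. ?P n" using poly2_nonzero_coeff[OF assms] by blast
  have "?P (mult0 F)" unfolding mult0_def by (rule LeastI_ex[OF ex])
  moreover have "mult0 F \<le> k" if "?P k" for k unfolding mult0_def by (rule Least_le[of ?P, OF that])
  ultimately show ?thesis unfolding ord_ge_def by (metis leD le_less_trans not_le)
qed

lemma blow_up_eq_0_iff: "blow_up t F = 0 \<longleftrightarrow> F = 0"
proof
  assume "blow_up t F = 0"
  then have "ord_ge n F" for n by (metis dvd_0_right exc_power_dvd_blow_up_iff)
  then show "F = 0" using ord_ge_mult0_iff[of F "Suc (mult0 F)"] by (auto simp del: blow_up.simps)
qed (simp only: ring_map_zero[OF ring_map_blow_up])

lemma exc_equation_nonzero: "exc_equation t \<noteq> 0"
  by (cases t) auto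

lemma prime_elem_power_dvd_multD:
  fixes p :: "'a::algebraic_semidom"
  assumes "prime_elem p" and "\<not> p dvd a" and "p ^ n dvd a * b"
  shows "p ^ n dvd b"
  using prime_elem_power_dvd_cases[OF assms(3), of 1 n] assms(1,2) by simp

lemma prime_elem_varU: "prime_elem (varU :: 'k::field poly2)"
  by (simp add: prime_elem_const_poly_iff prime_elem_linear_field_poly)

lemma prime_elem_varX3: "prime_elem (varX3 :: 'k::field poly3)"
  by (simp add: prime_elem_const_poly_iff prime_elem_linear_field_poly)

lemma varU_power_decomp:
  assumes "F \<noteq> 0" shows "\<exists>n G. F = varU ^ n * G \<and> \<not> varU dvd G"
proof -
  obtain i j where ij: "coeff2 F i j \<noteq> 0" using poly2_nonzero_coeff[OF assms] by blast
  then have bound: "n \<le> i" if "varU ^ n dvd F" for n using that varU_power_dvd_iff[of n F] by (meson not_le)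
  define n where "n = (GREATEST n. varU ^ n dvd F)"
  have n: "varU ^ n dvd F" unfolding n_def
    by (rule GreatestI_nat[of "\<lambda>n. varU ^ n dvd F" 0 i]) (use bound in auto)
  have "\<not> varU ^ Suc n dvd F"
    using Greatest_le_nat[of "\<lambda>n. varU ^ n dvd F" "Suc n" i] bound unfolding n_def by fastforce
  moreover from n obtain G where "F = varU ^ n * G" by (auto elim: dvdE)
  ultimately show ?thesis by (intro exI[of _ n] exI[of _ G]) (metis dvd_refl mult_dvd_mono power_Suc2)
qed


section \<open>Total transforms\<close>

lemma local_equation_eq:
  "local_equation f p = (case p of Affine a b \<Rightarrow> ev3 cst (cst a + varU) (cst b + varV) 1 f
     | Line_Inf a \<Rightarrow> ev3 cst (cst a + varU) 1 varV f | Point_Inf \<Rightarrow> ev3 cst 1 varU varV f)"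
  by (cases p) (simp_all only: local_equation.simps subst3_eq_ev3 plane_point.case)

lemma ring_map_local_equation: "ring_map (\<lambda>f. local_equation f p)"
  unfolding local_equation_eq by (cases p) (simp_all only: plane_point.case ring_map_ev3 ring_map_cst)

lemma local_equation_const: "local_equation (const3 c) p = cst c"
  unfolding local_equation_eq by (cases p) (simp_all only: plane_point.case ev3_vars ring_map_cst)

lemma local_equation_lin:
  "local_equation (linX p) p = varU" "local_equation (linY p) p = varV" "local_equation (linW p) p = 1"
  unfolding local_equation_eq
  by (cases p; simp only: plane_point.case linX.simps linY.simps linW.simps ev3_vars[OF ring_map_cst]
     ring_map_diff[OF ring_map_ev3[OF ring_map_cst]] ring_map_mult[OF ring_map_ev3[OF ring_map_cst]]; simp)+

abbreviation lin_map :: "'k::field plane_point \<Rightarrow> 'k poly3 \<Rightarrow> 'k poly3" where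
  "lin_map p \<equiv> ev3 const3 (linX p) (linY p) (linW p)"

lemma local_equation_lin_map: "local_equation (lin_map p g) p = poly g 1"
proof (rule ring_map_eqI3[OF ring_map_comp[OF ring_map_local_equation ring_map_ev3[OF ring_map_const3]] ring_map_poly])
qed (simp_all only: ev3_vars[OF ring_map_const3] local_equation_lin local_equation_const, simp_all)

text \<open>
  In the adapted coordinates, dehomogenizing at p means setting the last coordinate to 1, so
  that the coefficients of the local equation of f are those of g.
\<close>

lemma forms_eq_lin_map:
  assumes "f \<in> forms m" shows "\<exists>g\<in>forms m. f = lin_map p g"
proof -
  note r = ring_map_ev3[OF ring_map_const3, of "linX p" "linY p" "linW p"]
  from assms show ?thesis
  proof (induction rule: forms_induct)
    case zero
    show ?case using forms_0 ring_map_zero[OF r, symmetric] by (rule bexI[rotated])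
  next
    case (add a b)
    then obtain g h where "g \<in> forms m" "h \<in> forms m" "a = lin_map p g" "b = lin_map p h" by blast
    then show ?case by (intro bexI[of _ "g + h"]) (simp_all add: forms_add ring_map_add[OF r])
  next
    case (monomial c i j l)
    let ?A = "lin_map p ` forms 1"
    have add: "r + s \<in> ?A" if "r \<in> ?A" "s \<in> ?A" for r s
      using that by (auto simp: ring_map_add[OF r, symmetric] simp del: One_nat_def intro!: imageI forms_add)
    have cm: "const3 c * r \<in> ?A" if r': "r \<in> ?A" for r c
    proof -
      obtain s where s: "s \<in> forms 1" "r = lin_map p s" using r' by blast
      have "const3 c * r = lin_map p (const3 c * s)"
        unfolding s(2) ring_map_mult[OF r] ev3_vars[OF ring_map_const3] ..
      then show ?thesis using forms_const_mult[OF s(1)] by blast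
    qed
    have lin: "linX p \<in> ?A" "linY p \<in> ?A" "linW p \<in> ?A"
      by (rule image_eqI ev3_vars(2-4)[OF ring_map_const3, symmetric] forms_varX forms_varY forms_varZ)+
    have "varX3 \<in> ?A" "varY3 \<in> ?A" "varZ3 \<in> ?A"
      by (rule coordinates_from_lin[OF add cm lin]; assumption)+
    then obtain x y z where xyz: "x \<in> forms 1" "y \<in> forms 1" "z \<in> forms 1"
      and eq: "varX3 = lin_map p x" "varY3 = lin_map p y" "varZ3 = lin_map p z"
      unfolding image_iff by blast
    have "mono3 c i j l = lin_map p (const3 c * x ^ i * y ^ j * z ^ l)"
      unfolding mono3_eq ring_map_mult[OF r] ring_map_power[OF r] ev3_const[OF ring_map_const3] eq[symmetric] ..
    moreover have "const3 c * x ^ i * y ^ j * z ^ l \<in> forms (0 + i * 1 + j * 1 + l * 1)"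
      by (intro forms_mult forms_power forms_const xyz)
    ultimately show ?case using monomial by auto
  qed
qed

lemma coeff2_dehomogenization:
  assumes "g \<in> forms m"
  shows "coeff2 (poly g 1) i j = (if i + j \<le> m then coeff3 g i j (m - i - j) else 0)"
  using assms by (induction rule: forms_induct) (auto simp: poly_monom)

lemma coeff3_dehomogenization:
  assumes "g \<in> forms m"
  shows "coeff3 g i j l \<noteq> 0 \<Longrightarrow> coeff2 (poly g 1) i j = coeff3 g i j l"
proof -
  assume *: "coeff3 g i j l \<noteq> 0"
  then have "i + j + l = m" using assms by (auto simp: forms_def)
  then show ?thesis using coeff2_dehomogenization[OF assms, where i = i and j = j] by auto
qed

lemma local_equation_eq_0_iff:
  assumes "f \<in> forms m" shows "local_equation f p = 0 \<longleftrightarrow> f = 0"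
proof
  assume eq: "local_equation f p = 0"
  obtain g where g: "g \<in> forms m" "f = lin_map p g" using forms_eq_lin_map[OF assms] by blast
  have "poly g 1 = 0" using eq unfolding g(2) local_equation_lin_map .
  then have "coeff3 g i j l = 0" for i j l using coeff3_dehomogenization[OF g(1), where i = i and j = j and l = l] by auto
  then have "g = 0" by (simp add: poly_eq_iff)
  then show "f = 0" by (simp add: g(2) ring_map_zero[OF ring_map_ev3[OF ring_map_const3]])
qed (simp only: ring_map_zero[OF ring_map_local_equation])

lemma ring_map_total_transform: "ring_map (\<lambda>f. total_transform f q)"
  by (induction q) (simp_all only: total_transform.simps ring_map_local_equation ring_map_comp[OF ring_map_blow_up])

lemma total_transform_const: "total_transform (const3 c) q = cst c"
  by (induction q) (simp_all only: total_transform.simps local_equation_const blow_up_cst)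

lemma total_transform_eq_0_iff: "f \<in> forms m \<Longrightarrow> total_transform f q = 0 \<longleftrightarrow> f = 0"
  by (induction q) (simp_all only: total_transform.simps local_equation_eq_0_iff blow_up_eq_0_iff)


section \<open>The exceptional part of the total transforms of a linear system\<close>

text \<open>
  Local equation at q of the divisor that is the sum of the total exceptional curves of the
  points p of the sequence leading to q, with multiplicities \<open>\<mu> p\<close>.
\<close>

definition exceptional_part :: "('k::field near_point \<Rightarrow> nat) \<Rightarrow> 'k near_point \<Rightarrow> 'k poly2" where
  "exceptional_part \<mu> q = (\<Prod>p\<in>predecessors q. exc_total_transform p q ^ \<mu> p)"

lemma finite_predecessors: "finite (predecessors q)"
  by (induction q) auto

lemma predecessors_size: "p \<in> predecessors q \<Longrightarrow> size p < size q"
  by (induction q) auto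

lemma exceptional_part_Proper: "exceptional_part \<mu> (Proper p) = 1"
  by (simp add: exceptional_part_def)

lemma exceptional_part_Near:
  "exceptional_part \<mu> (Near q t) = exc_equation t ^ \<mu> q * blow_up t (exceptional_part \<mu> q)"
proof -
  have q: "q \<notin> predecessors q" using predecessors_size[of q q] by blast
  then have "(\<Prod>p\<in>predecessors q. exc_total_transform p (Near q t) ^ \<mu> p) =
    (\<Prod>p\<in>predecessors q. blow_up t (exc_total_transform p q) ^ \<mu> p)"
    by (intro prod.cong refl) auto
  then show ?thesis
    unfolding exceptional_part_def ring_map_prod[OF ring_map_blow_up] ring_map_power[OF ring_map_blow_up]
    using q by (simp add: finite_predecessors del: blow_up.simps exc_equation.simps)
qed

lemma exceptional_part_nonzero: "exceptional_part \<mu> q \<noteq> 0"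
  by (induction q) (simp_all add: exceptional_part_Proper exceptional_part_Near exc_equation_nonzero blow_up_eq_0_iff
      del: blow_up.simps exc_equation.simps)

lemma coeff2_cst_mult: "coeff2 (cst c * F) i j = c * coeff2 F i j"
  by simp

text \<open>
  The first three parts say that the base system at q consists of generic forms; they are proved
  together with the last two by induction on q. Let h be in the base system at q. For any g in
  the linear system, g + ch is in the base system for infinitely many c, so the quotient of its
  total transform by the exceptional part is its proper transform, of order at least the
  multiplicity at q. The same holds for h, hence the quotient for g has this order too. In the
  step, g + ch stays in the base system as long as one coefficient of minimal degree does not
  vanish; this excludes at most one more c.
\<close>

lemma base_system_facts:
  fixes I :: "'k::alg_closed_field poly3 set"
  assumes I: "ideal I Rxyz" and ne: "\<exists>f\<in>I \<inter> forms d. f \<noteq> 0"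
  defines "E \<equiv> exceptional_part (base_mult I d)"
  shows "base_system I d q \<noteq> {} \<and> base_system I d q \<subseteq> I \<inter> forms d - {0} \<and>
    (\<forall>g\<in>I \<inter> forms d. \<forall>h\<in>base_system I d q. finite {c. g + const3 c * h \<notin> base_system I d q}) \<and>
    (\<forall>f\<in>base_system I d q. total_transform f q = E q * proper_transform f q) \<and>
    (\<forall>g\<in>I \<inter> forms d. \<exists>h. total_transform g q = E q * h \<and> ord_ge (base_mult I d q) h)" (is "?P q")
proof -
  let ?B = "base_system I d" and ?L = "I \<inter> forms d" and ?T = total_transform
  have L: "g + const3 c * h \<in> ?L" if "g \<in> ?L" "h \<in> ?L" for g h c
    using that forms_add[OF _ forms_const_mult, of g d h c] ideal_closed(2)[OF I _ ideal_closed(3)[OF I], of g h "const3 c"]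
    by blast
  have E0: "E q \<noteq> 0" for q unfolding E_def by (rule exceptional_part_nonzero)
  have Tlin: "?T (g + const3 c * h) q = ?T g q + cst c * ?T h q" for g c h q
    by (simp only: ring_map_add[OF ring_map_total_transform] ring_map_mult[OF ring_map_total_transform] total_transform_const)
  \<comment> \<open>the first four parts for q and divisibility by the exceptional part imply the last\<close>
  have virtual: "\<forall>g\<in>?L. \<exists>h. ?T g q = E q * h \<and> ord_ge (base_mult I d q) h"
    if B: "?B q \<noteq> {}" "?B q \<subseteq> ?L - {0}" "\<forall>g\<in>?L. \<forall>h\<in>?B q. finite {c. g + const3 c * h \<notin> ?B q}"
      "\<forall>f\<in>?B q. ?T f q = E q * proper_transform f q" and dvd: "\<forall>g\<in>?L. E q dvd ?T g q" for q
  proof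
    fix g assume g: "g \<in> ?L"
    obtain h where h: "h \<in> ?B q" using B(1) by blast
    obtain v where v: "?T g q = E q * v" using dvd g by (auto elim: dvdE)
    have ord: "ord_ge (base_mult I d q) (proper_transform f q)" if f: "f \<in> ?B q" for f
    proof -
      have "proper_transform f q \<noteq> 0"
        using B(2,4) f total_transform_eq_0_iff[of f d q] by auto
      moreover have "base_mult I d q \<le> mult0 (proper_transform f q)"
        unfolding base_mult_def multiplicity_at_def[symmetric] using f by (intro cINF_lower) auto
      ultimately show ?thesis using ord_ge_mult0_iff by blast
    qed
    have "infinite (UNIV - {c. g + const3 c * h \<notin> ?B q})"
      using B(3) g h alg_closed_infinite by (metis Diff_infinite_finite)
    then obtain c where c: "g + const3 c * h \<in> ?B q"
      by (metis (mono_tags, lifting) Diff_iff finite.emptyI finite_subset mem_Collect_eq subsetI)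
    have "E q * proper_transform (g + const3 c * h) q = E q * (v + cst c * proper_transform h q)"
      using B(4) c h Tlin[of g c h q] v by (simp add: algebra_simps del: mult_pCons_left mult_pCons_right)
    then have "proper_transform (g + const3 c * h) q = v + cst c * proper_transform h q"
      using E0 by simp
    then have "ord_ge (base_mult I d q) (v + cst c * proper_transform h q)" using ord[OF c] by simp
    then have "ord_ge (base_mult I d q) v"
      using ord[OF h] unfolding ord_ge_def coeff_add coeff2_cst_mult by auto
    with v show "\<exists>h. ?T g q = E q * h \<and> ord_ge (base_mult I d q) h" by blast
  qed
  show "?P q"
  proof (induction q)
    case (Proper p)
    have fin: "finite {c. g + const3 c * h \<notin> ?B (Proper p)}" if g: "g \<in> ?L" and h: "h \<in> ?B (Proper p)" for g h
    proof -
      have "c = c'" if "g + const3 c * h = 0" "g + const3 c' * h = 0" for c c'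
      proof -
        have "const3 (c - c') * h = (g + const3 c * h) - (g + const3 c' * h)"
          by (simp only: ring_map_diff[OF ring_map_const3] algebra_simps)
        then have "const3 (c - c') * h = 0" by (simp only: that diff_self)
        then show "c = c'" using h by auto
      qed
      then have "{c. g + const3 c * h = 0} \<subseteq> {SOME c. g + const3 c * h = 0}"
        by (metis (mono_tags, lifting) mem_Collect_eq singleton_iff someI subsetI)
      then have "finite {c. g + const3 c * h = 0}" by (rule finite_subset) simp
      moreover have "{c. g + const3 c * h \<notin> ?B (Proper p)} = {c. g + const3 c * h = 0}"
        using L[OF g] h by (auto simp del: mult_pCons_left)
      ultimately show ?thesis by simp
    qed
    have B: "?B (Proper p) \<noteq> {}" "?B (Proper p) \<subseteq> ?L - {0}" using ne by auto
    have T: "\<forall>f\<in>?B (Proper p). ?T f (Proper p) = E (Proper p) * proper_transform f (Proper p)"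
      by (simp add: E_def exceptional_part_Proper)
    show ?case
      using B fin T virtual[OF B _ T] by (simp add: E_def exceptional_part_Proper del: mult_pCons_left)
  next
    case (Near q t)
    let ?\<mu> = "base_mult I d q"
    have B: "?B q \<noteq> {}" "?B q \<subseteq> ?L - {0}" using Near by auto
    have mem: "f \<in> ?B (Near q t) \<longleftrightarrow> f \<in> ?B q \<and> mult0 (proper_transform f q) = ?\<mu>" for f
      by (auto simp: base_mult_def multiplicity_at_def)
    have T: "\<And>f. f \<in> ?B q \<Longrightarrow> ?T f q = E q * proper_transform f q" using Near by auto
    have pt0: "proper_transform f q \<noteq> 0" if "f \<in> ?B q" for f
      using that B(2) T total_transform_eq_0_iff[of f d q] by auto
    have V: "\<exists>h. ?T g q = E q * h \<and> ord_ge ?\<mu> h" if "g \<in> ?L" for g using Near that by blast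
    have EN: "E (Near q t) = exc_equation t ^ ?\<mu> * blow_up t (E q)"
      unfolding E_def by (rule exceptional_part_Near)
    have "?\<mu> \<in> (\<lambda>f. multiplicity_at f q) ` ?B q"
      unfolding base_mult_def by (rule Inf_nat_def1) (use B in auto)
    then have ne': "?B (Near q t) \<noteq> {}" using mem by (auto simp: multiplicity_at_def)
    have sub': "?B (Near q t) \<subseteq> ?L - {0}" using mem B(2) by blast
    have fin': "finite {c. g + const3 c * h \<notin> ?B (Near q t)}" if g: "g \<in> ?L" and h: "h \<in> ?B (Near q t)" for g h
    proof -
      have hq: "h \<in> ?B q" "mult0 (proper_transform h q) = ?\<mu>" using h mem by auto
      obtain v where v: "?T g q = E q * v" "ord_ge ?\<mu> v" using V g by blast
      have "\<not> ord_ge (Suc ?\<mu>) (proper_transform h q)"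
        using ord_ge_mult0_iff[OF pt0[OF hq(1)]] hq(2) by simp
      moreover have "ord_ge ?\<mu> (proper_transform h q)"
        using ord_ge_mult0_iff[OF pt0[OF hq(1)]] hq(2) by simp
      ultimately obtain i j where ij: "i + j = ?\<mu>" "coeff2 (proper_transform h q) i j \<noteq> 0"
        unfolding ord_ge_def by (metis less_Suc_eq)
      \<comment> \<open>the factor for which the coefficient at (i,j) cancels\<close>
      let ?c0 = "- coeff2 v i j / coeff2 (proper_transform h q) i j"
      have "g + const3 c * h \<in> ?B (Near q t)" if c: "g + const3 c * h \<in> ?B q" "c \<noteq> ?c0" for c
      proof -
        let ?f = "g + const3 c * h"
        have "E q * proper_transform ?f q = E q * (v + cst c * proper_transform h q)"
          using T[OF c(1)] T[OF hq(1)] Tlin[of g c h q] v(1)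
          by (simp add: algebra_simps del: mult_pCons_left mult_pCons_right)
        then have pt: "proper_transform ?f q = v + cst c * proper_transform h q" using E0 by simp
        have "coeff2 (proper_transform ?f q) i j \<noteq> 0"
          unfolding pt coeff_add coeff2_cst_mult using ij(2) c(2) by (auto simp: field_simps eq_neg_iff_add_eq_0)
        then have "\<not> ord_ge (Suc ?\<mu>) (proper_transform ?f q)" by (metis ij(1) lessI ord_ge_def)
        then have "mult0 (proper_transform ?f q) \<le> ?\<mu>"
          using ord_ge_mult0_iff[OF pt0[OF c(1)]] by (metis not_less_eq_eq)
        moreover have "?\<mu> \<le> mult0 (proper_transform ?f q)"
          unfolding base_mult_def multiplicity_at_def[symmetric] using c(1) by (intro cINF_lower) auto
        ultimately show ?thesis using mem c(1) by simp
      qed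
      then have "{c. g + const3 c * h \<notin> ?B (Near q t)} \<subseteq> insert ?c0 {c. g + const3 c * h \<notin> ?B q}" by blast
      moreover have "finite {c. g + const3 c * h \<notin> ?B q}" using Near g hq(1) by blast
      ultimately show ?thesis by (meson finite.insertI finite_subset)
    qed
    have T': "\<forall>f\<in>?B (Near q t). ?T f (Near q t) = E (Near q t) * proper_transform f (Near q t)"
    proof
      fix f assume "f \<in> ?B (Near q t)"
      then have f: "f \<in> ?B q" "mult0 (proper_transform f q) = ?\<mu>" using mem by auto
      have "exc_equation t ^ ?\<mu> dvd blow_up t (proper_transform f q)"
        unfolding exc_power_dvd_blow_up_iff using ord_ge_mult0_iff[OF pt0[OF f(1)]] f(2) by simp
      then have "blow_up t (proper_transform f q) = exc_equation t ^ ?\<mu> * proper_transform f (Near q t)"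
        unfolding proper_transform.simps f(2) by (rule dvd_mult_div_cancel[symmetric])
      then show "?T f (Near q t) = E (Near q t) * proper_transform f (Near q t)"
        unfolding EN total_transform.simps T[OF f(1)] ring_map_mult[OF ring_map_blow_up] by (simp only: mult_ac)
    qed
    have dvd': "\<forall>g\<in>?L. E (Near q t) dvd ?T g (Near q t)"
    proof
      fix g assume "g \<in> ?L"
      then obtain v where v: "?T g q = E q * v" "ord_ge ?\<mu> v" using V by blast
      have "exc_equation t ^ ?\<mu> dvd blow_up t v" unfolding exc_power_dvd_blow_up_iff by (rule v(2))
      then show "E (Near q t) dvd ?T g (Near q t)"
        unfolding EN total_transform.simps v(1) ring_map_mult[OF ring_map_blow_up]
        by (simp only: mult.commute[of "exc_equation t ^ ?\<mu>"] mult_dvd_mono dvd_refl)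
    qed
    show ?case using ne' sub' fin' T' virtual[OF ne' sub' _ T' dvd'] by blast
  qed
qed


section \<open>Residue fields of valuation rings\<close>

abbreviation val_subring :: "'k::field frac3 set \<Rightarrow> 'k frac3 ring" where
  "val_subring V \<equiv> Frac\<lparr>carrier := V\<rparr>"

definition residue :: "'k::field frac3 set \<Rightarrow> 'k frac3 \<Rightarrow> 'k frac3 set" where
  "residue V a = val_max_ideal V +>\<^bsub>val_subring V\<^esub> a"

lemma val_max_ideal_iff:
  assumes "valuation_ring V"
  shows "a \<in> val_max_ideal V \<longleftrightarrow> a \<in> V \<and> (a = 0 \<or> inverse a \<notin> V)"
proof -
  have "a \<in> Units (val_subring V) \<longleftrightarrow> a \<in> V \<and> a \<noteq> 0 \<and> inverse a \<in> V"
  proof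
    assume "a \<in> Units (val_subring V)"
    then obtain b where "a \<in> V" "b \<in> V" "a * b = 1" by (auto simp: Units_def ring_of_type_algebra_simps)
    moreover from this have "b = inverse a" by (simp add: inverse_unique)
    ultimately show "a \<in> V \<and> a \<noteq> 0 \<and> inverse a \<in> V" by auto
  next
    assume "a \<in> V \<and> a \<noteq> 0 \<and> inverse a \<in> V"
    then show "a \<in> Units (val_subring V)"
      by (auto simp: Units_def ring_of_type_algebra_simps intro!: bexI[of _ "inverse a"])
  qed
  then show ?thesis unfolding val_max_ideal_def by blast
qed

context
  fixes V :: "'k::field frac3 set"
  assumes V: "valuation_ring V"
begin

lemma val_subring_cring: "cring (val_subring V)"
proof -
  interpret cring "Frac :: 'k frac3 ring" by (rule cring_from_type_algebra)
  have "subring V Frac" using V by (simp add: valuation_ring_def)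
  then have "subcring V Frac" by (rule subcringI') 
  then show ?thesis using subcring_iff[of V] by (simp add: ring_of_type_algebra_simps)
qed

lemma max_ideal_add:
  assumes "a \<in> val_max_ideal V" "b \<in> val_max_ideal V" shows "a + b \<in> val_max_ideal V"
proof -
  note c = valuation_ring_closed[OF V]
  have *: "a + b \<in> val_max_ideal V"
    if ab: "a \<in> val_max_ideal V" "b \<in> val_max_ideal V" "a / b \<in> V" "b \<noteq> 0" for a b
  proof -
    have "inverse (a + b) \<notin> V" if "a + b \<noteq> 0"
    proof
      assume "inverse (a + b) \<in> V"
      then have "inverse (a + b) * (1 + a / b) \<in> V" using c(2-4) ab(3) by blast
      moreover have "inverse (a + b) * (1 + a / b) = inverse b"
        using that ab(4) by (simp add: field_simps)
      ultimately show False using ab(2,4) val_max_ideal_iff[OF V] by auto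
    qed
    then show ?thesis using ab(1,2) c(3) val_max_ideal_iff[OF V] by blast
  qed
  show ?thesis
  proof (cases "a = 0 \<or> b = 0")
    case False
    then have "a / b \<in> V \<or> b / a \<in> V" using c(6)[of "a / b"] by simp
    then show ?thesis using *[of a b] *[of b a] assms False by (auto simp: add.commute)
  qed (use assms in auto)
qed

lemma max_ideal_mult:
  assumes "a \<in> val_max_ideal V" "r \<in> V" shows "r * a \<in> val_max_ideal V"
proof -
  note c = valuation_ring_closed[OF V]
  have a: "a \<in> V" "a = 0 \<or> inverse a \<notin> V" using assms val_max_ideal_iff[OF V] by auto
  have "inverse (r * a) \<notin> V" if "r * a \<noteq> 0"
  proof
    assume "inverse (r * a) \<in> V"
    then have "r * inverse (r * a) \<in> V" using c(4) assms(2) by blast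
    moreover have "r * inverse (r * a) = inverse a" using that by (simp add: field_simps)
    ultimately have "inverse a \<in> V" by (simp only:)
    then show False using a(2) that by auto
  qed
  then show ?thesis using a c(4)[OF assms(2)] val_max_ideal_iff[OF V] by blast
qed

lemma val_a_inv: "a \<in> V \<Longrightarrow> \<ominus>\<^bsub>val_subring V\<^esub> a = - a"
proof -
  interpret cring "val_subring V" by (rule val_subring_cring)
  show "a \<in> V \<Longrightarrow> \<ominus>\<^bsub>val_subring V\<^esub> a = - a"
    by (rule minus_equality) (use valuation_ring_closed[OF V] in \<open>auto simp: ring_of_type_algebra_simps\<close>)
qed

lemma max_ideal_ideal: "ideal (val_max_ideal V) (val_subring V)"
proof -
  interpret cring "val_subring V" by (rule val_subring_cring)
  note c = valuation_ring_closed[OF V]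
  show ?thesis
  proof (rule idealI[OF ring_axioms])
    show "subgroup (val_max_ideal V) (add_monoid (val_subring V))"
    proof (rule add.subgroupI)
      fix a assume a: "a \<in> val_max_ideal V"
      then have "- a \<in> val_max_ideal V" using max_ideal_mult[OF a, of "-1"] c(2,5) by simp
      then show "\<ominus>\<^bsub>val_subring V\<^esub> a \<in> val_max_ideal V"
        using a val_a_inv val_max_ideal_iff[OF V] by auto
    next
      show "val_max_ideal V \<noteq> {}" using c(1) val_max_ideal_iff[OF V, of 0] by blast
    next
      show "val_max_ideal V \<subseteq> carrier (val_subring V)" using val_max_ideal_iff[OF V] by auto
    next
      show "a \<oplus>\<^bsub>val_subring V\<^esub> b \<in> val_max_ideal V" if "a \<in> val_max_ideal V" "b \<in> val_max_ideal V" for a b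
        using max_ideal_add[OF that] by (simp add: ring_of_type_algebra_simps)
    qed
  qed (use max_ideal_mult in \<open>auto simp: ring_of_type_algebra_simps mult.commute\<close>)
qed

lemma residue_field_ops:
  shows "carrier (val_residue_field V) = residue V ` V"
    and "a \<in> V \<Longrightarrow> b \<in> V \<Longrightarrow> residue V (a + b) = residue V a \<oplus>\<^bsub>val_residue_field V\<^esub> residue V b"
    and "a \<in> V \<Longrightarrow> b \<in> V \<Longrightarrow> residue V (a * b) = residue V a \<otimes>\<^bsub>val_residue_field V\<^esub> residue V b"
    and "residue V 1 = \<one>\<^bsub>val_residue_field V\<^esub>"
    and "residue V 0 = \<zero>\<^bsub>val_residue_field V\<^esub>"
    and "a \<in> V \<Longrightarrow> residue V (- a) = \<ominus>\<^bsub>val_residue_field V\<^esub> residue V a"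
    and "a \<in> V \<Longrightarrow> b \<in> V \<Longrightarrow> residue V a = residue V b \<longleftrightarrow> a - b \<in> val_max_ideal V"
proof -
  interpret W: cring "val_subring V" by (rule val_subring_cring)
  interpret m: ideal "val_max_ideal V" "val_subring V" by (rule max_ideal_ideal)
  note c = valuation_ring_closed[OF V]
  have hom: "residue V \<in> ring_hom (val_subring V) (val_residue_field V)"
    using m.rcos_ring_hom unfolding residue_def[abs_def] val_residue_field_def .
  show "carrier (val_residue_field V) = residue V ` V"
    unfolding residue_def[abs_def] val_residue_field_def FactRing_def A_RCOSETS_def'
    by (auto simp: A_RCOSETS_def RCOSETS_def a_r_coset_def)
  show "a \<in> V \<Longrightarrow> b \<in> V \<Longrightarrow> residue V (a + b) = residue V a \<oplus>\<^bsub>val_residue_field V\<^esub> residue V b"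
    "a \<in> V \<Longrightarrow> b \<in> V \<Longrightarrow> residue V (a * b) = residue V a \<otimes>\<^bsub>val_residue_field V\<^esub> residue V b"
    using ring_hom_add[OF hom, of a b] ring_hom_mult[OF hom, of a b] by (simp_all add: ring_of_type_algebra_simps)
  show "residue V 1 = \<one>\<^bsub>val_residue_field V\<^esub>"
    using ring_hom_one[OF hom] by (simp add: ring_of_type_algebra_simps)
  interpret L: ring "val_residue_field V" unfolding val_residue_field_def by (rule m.quotient_is_ring)
  show "residue V 0 = \<zero>\<^bsub>val_residue_field V\<^esub>"
    using ring_hom_zero[OF hom W.ring_axioms L.ring_axioms] by (simp add: ring_of_type_algebra_simps)
  then have "residue V (- a) \<oplus>\<^bsub>val_residue_field V\<^esub> residue V a = \<zero>\<^bsub>val_residue_field V\<^esub>" if "a \<in> V"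
    using ring_hom_add[OF hom, of "- a" a] that c(5) by (simp add: ring_of_type_algebra_simps)
  then show "a \<in> V \<Longrightarrow> residue V (- a) = \<ominus>\<^bsub>val_residue_field V\<^esub> residue V a"
    using L.minus_equality[of "residue V (- a)" "residue V a"] ring_hom_closed[OF hom, of a] ring_hom_closed[OF hom, of "- a"] c(5)
    by simp
  show "a \<in> V \<Longrightarrow> b \<in> V \<Longrightarrow> residue V a = residue V b \<longleftrightarrow> a - b \<in> val_max_ideal V"
    using W.quotient_eq_iff_same_a_r_cos[OF max_ideal_ideal, of a b] val_a_inv[of b]
    unfolding residue_def a_minus_def by (simp add: ring_of_type_algebra_simps)
qed

lemma residue_eq_0_iff: "a \<in> V \<Longrightarrow> residue V a = \<zero>\<^bsub>val_residue_field V\<^esub> \<longleftrightarrow> a \<in> val_max_ideal V"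
  using residue_field_ops(7)[of a 0] valuation_ring_closed(1)[OF V] by (simp add: residue_field_ops(5))

lemma residue_field_field: "field (val_residue_field V)"
proof -
  interpret m: ideal "val_max_ideal V" "val_subring V" by (rule max_ideal_ideal)
  interpret L: cring "val_residue_field V"
    unfolding val_residue_field_def by (rule m.quotient_is_cring[OF val_subring_cring])
  show ?thesis
  proof (rule L.cring_fieldI2)
    have "1 \<notin> val_max_ideal V" using val_max_ideal_iff[OF V, of 1] valuation_ring_closed(2)[OF V] by simp
    then show "\<zero>\<^bsub>val_residue_field V\<^esub> \<noteq> \<one>\<^bsub>val_residue_field V\<^esub>"
      using residue_eq_0_iff[of 1] valuation_ring_closed(2)[OF V] residue_field_ops(4) by metis
  next
    fix x assume x: "x \<in> carrier (val_residue_field V)" "x \<noteq> \<zero>\<^bsub>val_residue_field V\<^esub>"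
    then obtain a where a: "a \<in> V" "x = residue V a" using residue_field_ops(1) by blast
    then have "a \<notin> val_max_ideal V" using residue_eq_0_iff x(2) by simp
    then have a': "a \<noteq> 0" "inverse a \<in> V" using a(1) val_max_ideal_iff[OF V] by auto
    have "x \<otimes>\<^bsub>val_residue_field V\<^esub> residue V (inverse a) = \<one>\<^bsub>val_residue_field V\<^esub>"
      unfolding a(2) residue_field_ops(3)[OF a(1) a'(2), symmetric] using a'(1) by (simp add: residue_field_ops(4))
    then show "\<exists>y\<in>carrier (val_residue_field V). x \<otimes>\<^bsub>val_residue_field V\<^esub> y = \<one>\<^bsub>val_residue_field V\<^esub>"
      using a'(2) residue_field_ops(1) by blast
  qed
qed

lemma residue_inverse:
  assumes "a \<in> V" "a \<notin> val_max_ideal V"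
  shows "inverse a \<in> V" "residue V (inverse a) = inv\<^bsub>val_residue_field V\<^esub> residue V a"
proof -
  interpret L: field "val_residue_field V" by (rule residue_field_field)
  have a': "a \<noteq> 0" "inverse a \<in> V" using assms val_max_ideal_iff[OF V] by auto
  then show "inverse a \<in> V" by simp
  show "residue V (inverse a) = inv\<^bsub>val_residue_field V\<^esub> residue V a"
    by (rule L.comm_inv_char[symmetric]) (use a' assms(1) residue_field_ops(1) in
      \<open>auto simp flip: residue_field_ops(3,4)\<close>)
qed

definition center_local_ring :: "'k frac3 set" where
  "center_local_ring = {Fract r s | r s. s \<notin> val_center V}"

lemma center_residue_field_eq: "center_residue_field V = residue V ` center_local_ring"
  unfolding center_residue_field_def center_local_ring_def residue_def[abs_def] ..

context
  assumes R: "\<And>r. Fract r 1 \<in> V"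
begin

lemma inverse_in_valuation_ring: "s \<notin> val_center V \<Longrightarrow> inverse (Fract s 1) \<in> V"
  using residue_inverse(1)[OF R] unfolding val_center_def by blast

lemma center_nonzero: "s \<notin> val_center V \<Longrightarrow> s \<noteq> 0"
  using valuation_ring_closed(1)[OF V] val_max_ideal_iff[OF V, of 0]
  by (auto simp: val_center_def Fract_1_eq_0_iff[THEN iffD2])

lemma center_complement_mult: "s \<notin> val_center V \<Longrightarrow> t \<notin> val_center V \<Longrightarrow> s * t \<notin> val_center V"
proof
  assume s: "s \<notin> val_center V" and t: "t \<notin> val_center V" and st: "s * t \<in> val_center V"
  have "inverse (Fract s 1) \<in> V"
    using s by (rule inverse_in_valuation_ring)
  then have "inverse (Fract s 1) * Fract (s * t) 1 \<in> val_max_ideal V"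
    by (rule max_ideal_mult[rotated]) (use st in \<open>simp add: val_center_def\<close>)
  moreover have "inverse (Fract s 1) * Fract (s * t) 1 = Fract t 1"
    using center_nonzero[OF s] by (simp add: eq_fract)
  ultimately show False using t by (simp add: val_center_def)
qed

lemma center_local_ring_subset: "center_local_ring \<subseteq> V"
proof
  fix a assume "a \<in> center_local_ring"
  then obtain r s where a: "a = Fract r s" "s \<notin> val_center V" unfolding center_local_ring_def by blast
  have "inverse (Fract s 1) \<in> V"
    using a(2) by (rule inverse_in_valuation_ring)
  then have "Fract r 1 * inverse (Fract s 1) \<in> V" using R valuation_ring_closed(4)[OF V] by blast
  then show "a \<in> V" by (simp add: a(1))
qed

lemma center_local_ring_closed:
  assumes a: "a \<in> center_local_ring" and b: "b \<in> center_local_ring"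
  shows "a + b \<in> center_local_ring" "a * b \<in> center_local_ring" "- a \<in> center_local_ring"
    "a \<notin> val_max_ideal V \<Longrightarrow> inverse a \<in> center_local_ring"
proof -
  obtain r s where rs: "a = Fract r s" "s \<notin> val_center V" using a unfolding center_local_ring_def by blast
  obtain r' s' where rs': "b = Fract r' s'" "s' \<notin> val_center V" using b unfolding center_local_ring_def by blast
  note ne = center_nonzero[OF rs(2)] center_nonzero[OF rs'(2)] and c = center_complement_mult[OF rs(2) rs'(2)]
  show "a + b \<in> center_local_ring" "a * b \<in> center_local_ring" "- a \<in> center_local_ring"
    using c rs ne unfolding rs rs' center_local_ring_def by (auto simp: ne)
  assume a': "a \<notin> val_max_ideal V"
  have "r \<notin> val_center V"
  proof
    assume "r \<in> val_center V"
    then have "inverse (Fract s 1) * Fract r 1 \<in> val_max_ideal V"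
      by (intro max_ideal_mult inverse_in_valuation_ring rs(2)) (simp add: val_center_def)
    then show False using a' by (simp add: rs(1))
  qed
  then show "inverse a \<in> center_local_ring" unfolding rs center_local_ring_def by auto
qed

lemma Fract_in_center_local_ring: "Fract r 1 \<in> center_local_ring"
proof -
  have "1 \<notin> val_center V"
    using val_max_ideal_iff[OF V, of 1] by (simp add: val_center_def One_fract_def[symmetric])
  then show ?thesis unfolding center_local_ring_def by blast
qed

lemma one_in_center_local_ring: "1 \<in> center_local_ring"
  unfolding One_fract_def by (rule Fract_in_center_local_ring)

text \<open>
  The residue of b is transcendental over the residue field K at the center. If a polynomial
  over K vanishes at it, then its constant coefficient is the residue of a multiple of b in S. A
  nonzero element of K is the residue of a unit of S, and b is not a unit of S, even modulo the
  maximal ideal of V. So the constant coefficient is zero; cancel one factor b and continue.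
\<close>

lemma has_trdeg_1:
  assumes S: "S \<subseteq> V" "center_local_ring \<subseteq> S" "\<And>s t. s \<in> S \<Longrightarrow> t \<in> S \<Longrightarrow> s + t \<in> S \<and> s * t \<in> S"
    and b: "b \<in> S" "b \<notin> val_max_ideal V" "\<And>s. s \<in> S \<Longrightarrow> b * s - 1 \<notin> val_max_ideal V"
    and gen: "\<And>x. x \<in> V \<Longrightarrow>
      residue V x \<in> generate_field (val_residue_field V) (center_residue_field V \<union> {residue V b})"
  shows "has_trdeg (val_residue_field V) (center_residue_field V) 1"
proof -
  let ?L = "val_residue_field V" and ?K = "center_residue_field V" and ?b = "residue V b"
  interpret L: field ?L by (rule residue_field_field)
  note cV = subsetD[OF center_local_ring_subset]
  have KL: "?K \<subseteq> carrier ?L"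
    unfolding center_residue_field_eq residue_field_ops(1) using center_local_ring_subset by blast
  have bV: "b \<in> V" using b S by blast
  have bL: "?b \<in> carrier ?L" using bV residue_field_ops(1) by blast
  have K: "generate_field ?L ?K \<subseteq> ?K"
  proof
    fix x assume "x \<in> generate_field ?L ?K"
    then show "x \<in> ?K"
    proof (induction rule: generate_field.induct)
      case one
      show ?case unfolding center_residue_field_eq residue_field_ops(4)[symmetric]
        using one_in_center_local_ring by blast
    next
      case (a_inv h)
      then obtain a where a: "a \<in> center_local_ring" "h = residue V a" unfolding center_residue_field_eq by blast
      show ?case unfolding a(2) residue_field_ops(6)[OF cV[OF a(1)], symmetric] center_residue_field_eq
        using center_local_ring_closed(3)[OF a(1) a(1)] by blast
    next
      case (m_inv h)
      then obtain a where a: "a \<in> center_local_ring" "h = residue V a" unfolding center_residue_field_eq by blast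
      then have "a \<notin> val_max_ideal V" using m_inv residue_eq_0_iff[OF cV[OF a(1)]] by simp
      then show ?case unfolding a(2) center_residue_field_eq
        using residue_inverse(2)[OF cV[OF a(1)]] center_local_ring_closed(4)[OF a(1) a(1)] by (metis imageI)
    next
      case (eng_add h h')
      then obtain a a' where a: "a \<in> center_local_ring" "h = residue V a" "a' \<in> center_local_ring" "h' = residue V a'"
        unfolding center_residue_field_eq by blast
      show ?case unfolding a(2,4) residue_field_ops(2)[OF cV[OF a(1)] cV[OF a(3)], symmetric] center_residue_field_eq
        using center_local_ring_closed(1)[OF a(1,3)] by blast
    next
      case (eng_mult h h')
      then obtain a a' where a: "a \<in> center_local_ring" "h = residue V a" "a' \<in> center_local_ring" "h' = residue V a'"
        unfolding center_residue_field_eq by blast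
      show ?case unfolding a(2,4) residue_field_ops(3)[OF cV[OF a(1)] cV[OF a(3)], symmetric] center_residue_field_eq
        using center_local_ring_closed(2)[OF a(1,3)] by blast
    qed
  qed
  have ev: "\<exists>s\<in>S. L.eval p ?b = residue V s" if "set p \<subseteq> ?K" for p
    using that
  proof (induction p rule: rev_induct)
    case Nil
    have "0 \<in> S" using S(2) Fract_in_center_local_ring[of 0] by (auto simp: Zero_fract_def)
    then show ?case using residue_field_ops(5) by (metis L.eval.simps(1))
  next
    case (snoc e p)
    then obtain s a where s: "s \<in> S" "L.eval p ?b = residue V s"
      and a: "a \<in> center_local_ring" "e = residue V a" unfolding center_residue_field_eq by auto
    have "L.eval (p @ [e]) ?b = L.eval p ?b \<otimes>\<^bsub>?L\<^esub> ?b \<oplus>\<^bsub>?L\<^esub> e"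
      by (rule L.eval_append_aux) (use snoc.prems KL bL in auto)
    also have "\<dots> = residue V (s * b + a)"
      unfolding s(2) a(2) residue_field_ops(3)[OF subsetD[OF S(1) s(1)] bV, symmetric]
      by (rule residue_field_ops(2)[OF valuation_ring_closed(4)[OF V subsetD[OF S(1) s(1)] bV] cV[OF a(1)], symmetric])
    finally have "L.eval (p @ [e]) ?b = residue V (s * b + a)" .
    moreover have "s * b + a \<in> S" using S(3)[OF s(1) b(1)] S(3)[of "s * b" a] subsetD[OF S(2) a(1)] by blast
    ultimately show ?case by (rule bexI)
  qed
  have zero: "set p \<subseteq> {\<zero>\<^bsub>?L\<^esub>}" if "set p \<subseteq> ?K" "L.eval p ?b = \<zero>\<^bsub>?L\<^esub>" for p
    using that
  proof (induction p rule: rev_induct)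
    case (snoc e p)
    then obtain s a where s: "s \<in> S" "L.eval p ?b = residue V s"
      and a: "a \<in> center_local_ring" "e = residue V a" using ev[of p] unfolding center_residue_field_eq by auto
    note V' = subsetD[OF S(1) s(1)] cV[OF a(1)]
    have sb: "s * b \<in> V" using V' bV valuation_ring_closed(4)[OF V] by blast
    have "L.eval (p @ [e]) ?b = L.eval p ?b \<otimes>\<^bsub>?L\<^esub> ?b \<oplus>\<^bsub>?L\<^esub> e"
      by (rule L.eval_append_aux) (use snoc.prems KL bL in auto)
    then have eq: "residue V s \<otimes>\<^bsub>?L\<^esub> ?b \<oplus>\<^bsub>?L\<^esub> e = \<zero>\<^bsub>?L\<^esub>" using snoc.prems(2) s(2) by simp
    then have "residue V (s * b + a) = \<zero>\<^bsub>?L\<^esub>"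
      unfolding a(2) by (simp add: residue_field_ops(2)[OF sb V'(2)] residue_field_ops(3)[OF V'(1) bV])
    then have m: "s * b + a \<in> val_max_ideal V"
      using residue_eq_0_iff valuation_ring_closed(3)[OF V sb V'(2)] by blast
    have "a \<in> val_max_ideal V"
    proof (rule ccontr)
      assume na: "a \<notin> val_max_ideal V"
      then have inv: "inverse a \<in> center_local_ring" by (rule center_local_ring_closed(4)[OF a(1,1)])
      have a0: "a \<noteq> 0" using na val_max_ideal_iff[OF V, of 0] valuation_ring_closed(1)[OF V] by auto
      have "- inverse a * (s * b + a) \<in> val_max_ideal V"
        by (intro max_ideal_mult m valuation_ring_closed(5)[OF V] cV inv)
      moreover have "- inverse a * (s * b + a) = b * (s * - inverse a) - 1"
        using a0 by (simp add: field_simps)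
      moreover have "s * - inverse a \<in> S"
        using S(2,3) s(1) center_local_ring_closed(3)[OF inv inv] by blast
      ultimately show False using b(3) by metis
    qed
    then have e0: "e = \<zero>\<^bsub>?L\<^esub>" using residue_eq_0_iff[OF V'(2)] a(2) by simp
    have "residue V s \<in> carrier ?L" using V' residue_field_ops(1) by blast
    then have "residue V s \<otimes>\<^bsub>?L\<^esub> ?b = \<zero>\<^bsub>?L\<^esub>" using eq e0 bL by simp
    moreover have "?b \<noteq> \<zero>\<^bsub>?L\<^esub>" using residue_eq_0_iff[OF bV] b(2) by simp
    ultimately have "L.eval p ?b = \<zero>\<^bsub>?L\<^esub>"
      using L.integral bL \<open>residue V s \<in> carrier ?L\<close> s(2) by metis
    then show ?case using snoc e0 by auto
  qed simp
  have sub: "subfield (generate_field ?L ?K) ?L" by (rule L.generate_field_is_subfield[OF KL])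
  have trans: "L.transcendental (generate_field ?L ?K) ?b"
  proof (rule ccontr)
    assume "\<not> ?thesis"
    then obtain p where p: "p \<in> carrier (generate_field ?L ?K [X]\<^bsub>?L\<^esub>)" "p \<noteq> []" "L.eval p ?b = \<zero>\<^bsub>?L\<^esub>"
      using L.algebraicE[OF subfieldE(1)[OF sub] bL] unfolding over_def by blast
    then have "polynomial\<^bsub>?L\<^esub> (generate_field ?L ?K) p" by (simp add: univ_poly_carrier)
    then have "set p \<subseteq> generate_field ?L ?K" "hd p \<noteq> \<zero>\<^bsub>?L\<^esub>" using p(2) unfolding polynomial_def by auto
    then show False using zero[of p] K p(2,3) by (metis hd_in_set order_trans singletonD subsetD)
  qed
  have KbL: "?K \<union> {?b} \<subseteq> carrier ?L" by (intro Un_least KL insert_subsetI bL empty_subsetI)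
  have alg: False if x: "x \<in> carrier ?L" and tr: "L.transcendental (generate_field ?L (?K \<union> {?b})) x" for x
  proof -
    obtain a where a: "a \<in> V" "x = residue V a" using x residue_field_ops(1) by blast
    have xE: "x \<in> generate_field ?L (?K \<union> {?b})" unfolding a(2) by (rule gen[OF a(1)])
    from L.algebraic_self[OF subfieldE(1)[OF L.generate_field_is_subfield[OF KbL]] xE] tr
    show False unfolding over_def by (rule notE)
  qed
  show ?thesis
    unfolding has_trdeg_def transcendence_basis_def
  proof (intro exI[of _ "{?b}"] conjI ballI)
    show "L.transcendental (generate_field ?L (?K \<union> ({?b} - {x}))) x" if "x \<in> {?b}" for x
      using trans that by simp
  qed (use bL alg in \<open>simp_all only: singleton_iff subset_iff finite.intros card.empty card_insert_disjoint, auto\<close>)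
qed

end

end


section \<open>The valuation ring of the order in u\<close>

text \<open>
  From here on, the variables of \<open>'k poly3\<close> are also read as u, v, w, in this
  order: u and v are the local coordinates at a point of a blowup of the plane, and w is the
  coordinate along the lines through the origin of affine space.
\<close>

lemma varX3_power: "varX3 ^ n = [:varU ^ n:]"
  by (simp add: poly_const_pow)

text \<open>
  Removing the largest common power of u from a fraction g/h shows that it or its inverse is
  regular along u = 0.
\<close>

lemma varX3_power_decomp2:
  assumes "h \<noteq> 0"
  shows "\<exists>n g' h'. g = varX3 ^ n * g' \<and> h = varX3 ^ n * h' \<and> (\<not> varX3 dvd g' \<or> \<not> varX3 dvd h')"
proof -
  obtain l where l: "Polynomial.coeff h l \<noteq> 0" using assms by (metis coeff_0 poly_eqI)
  obtain i j where ij: "coeff2 (Polynomial.coeff h l) i j \<noteq> 0" using poly2_nonzero_coeff[OF l] by blast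
  have bound: "n \<le> i" if "varX3 ^ n dvd h" for n
    using that ij unfolding varX3_power const_poly_dvd_iff varU_power_dvd_iff by (meson not_le)
  let ?P = "\<lambda>n. varX3 ^ n dvd g \<and> varX3 ^ n dvd h"
  define n where "n = (GREATEST n. ?P n)"
  have n: "?P n" unfolding n_def by (rule GreatestI_nat[of ?P 0 i]) (use bound in auto)
  obtain g' h' where gh: "g = varX3 ^ n * g'" "h = varX3 ^ n * h'" using n by (auto elim!: dvdE)
  have "\<not> ?P (Suc n)"
    using Greatest_le_nat[of ?P "Suc n" i] bound unfolding n_def by fastforce
  then have "\<not> varX3 dvd g' \<or> \<not> varX3 dvd h'"
    unfolding gh power_Suc2 by (meson dvd_refl mult_dvd_mono)
  with gh show ?thesis by blast
qed

definition u_adic_ring :: "'k::field frac3 set" where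
  "u_adic_ring = {Fract g h | g h. \<not> varX3 dvd h}"

lemma not_varX3_dvd_mult: "\<not> varX3 dvd g \<Longrightarrow> \<not> varX3 dvd h \<Longrightarrow> \<not> varX3 dvd g * (h :: 'k::field poly3)"
  using prime_elem_dvd_mult_iff[OF prime_elem_varX3] by blast

lemma not_varX3_dvd_1: "\<not> varX3 dvd (1 :: 'k::field poly3)"
  using prime_elem_varX3 by (auto simp: prime_elem_def)

lemma u_adic_ring_closed:
  shows "Fract g 1 \<in> u_adic_ring" "a \<in> u_adic_ring \<Longrightarrow> b \<in> u_adic_ring \<Longrightarrow> a + b \<in> u_adic_ring"
    "a \<in> u_adic_ring \<Longrightarrow> b \<in> u_adic_ring \<Longrightarrow> a * b \<in> u_adic_ring" "a \<in> u_adic_ring \<Longrightarrow> - a \<in> u_adic_ring"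
    "a \<in> u_adic_ring \<or> inverse a \<in> u_adic_ring"
proof -
  show "Fract g 1 \<in> u_adic_ring" unfolding u_adic_ring_def using not_varX3_dvd_1 by blast
  show "a + b \<in> u_adic_ring" "a * b \<in> u_adic_ring" if ab: "a \<in> u_adic_ring" "b \<in> u_adic_ring"
  proof -
    obtain g h g' h' where gh: "a = Fract g h" "\<not> varX3 dvd h" "b = Fract g' h'" "\<not> varX3 dvd h'"
      using ab unfolding u_adic_ring_def by blast
    then have "h \<noteq> 0" "h' \<noteq> 0" by auto
    then show "a + b \<in> u_adic_ring" "a * b \<in> u_adic_ring"
      unfolding gh u_adic_ring_def using not_varX3_dvd_mult[OF gh(2,4)] by auto
  qed
  show "- a \<in> u_adic_ring" if a: "a \<in> u_adic_ring"
  proof -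
    obtain g h where "- a = Fract (- g) h" "\<not> varX3 dvd h" using a unfolding u_adic_ring_def by auto
    then show ?thesis unfolding u_adic_ring_def by blast
  qed
  show "a \<in> u_adic_ring \<or> inverse a \<in> u_adic_ring"
  proof -
    obtain g h where gh: "a = Fract g h" "h \<noteq> 0" by (cases a)
    obtain n g' h' where d: "g = varX3 ^ n * g'" "h = varX3 ^ n * h'" "\<not> varX3 dvd g' \<or> \<not> varX3 dvd h'"
      using varX3_power_decomp2[OF gh(2)] by blast
    have "a = Fract g' h'" unfolding gh(1) d(1,2) by (rule mult_fract_cancel) simp
    then show ?thesis using d(3) unfolding u_adic_ring_def by auto
  qed
qed

lemma u_adic_valuation_ring:
  assumes \<Psi>: "ring_map \<Psi>"
  shows "valuation_ring {a :: 'k::field frac3. \<Psi> a \<in> (u_adic_ring :: 'k frac3 set)}" (is "valuation_ring ?V")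
proof -
  interpret F: ring "Frac :: 'k frac3 ring" by (rule ring_from_type_algebra)
  have inv: "\<ominus>\<^bsub>Frac\<^esub> a = - a" for a :: "'k frac3"
    by (rule F.minus_equality) (auto simp: ring_of_type_algebra_simps)
  have "1 \<in> (u_adic_ring :: 'k frac3 set)" using u_adic_ring_closed(1)[of 1] by (simp add: One_fract_def)
  then have "subring ?V Frac"
    by (intro F.subringI) (use u_adic_ring_closed in
      \<open>auto simp: ring_of_type_algebra_simps inv ring_map_add[OF \<Psi>] ring_map_mult[OF \<Psi>] ring_map_uminus[OF \<Psi>]
         ring_map_one[OF \<Psi>]\<close>)
  moreover have "\<Psi> (inverse a) = inverse (\<Psi> a)" for a
  proof (cases "a = 0")
    case False
    then have "\<Psi> (inverse a) * \<Psi> a = 1" by (simp flip: ring_map_mult[OF \<Psi>] add: ring_map_one[OF \<Psi>])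
    then show ?thesis by (metis inverse_unique mult.commute)
  qed (simp add: ring_map_zero[OF \<Psi>])
  ultimately show ?thesis unfolding valuation_ring_def using u_adic_ring_closed(5) by auto
qed

text \<open>
  Setting u = 0, and setting u = v = 0. In the first image v and w are the variables, in the
  second w.
\<close>

definition restrict_exc :: "'k::field poly3 \<Rightarrow> 'k poly2" where
  "restrict_exc = ev3 cst 0 varU varV"

definition restrict_origin :: "'k::field poly3 \<Rightarrow> 'k poly" where
  "restrict_origin g = ev2 (\<lambda>c. [:c:]) 0 [:0, 1:] (restrict_exc g)"

lemma ring_map_restrict_exc: "ring_map restrict_exc"
  unfolding restrict_exc_def by (intro ring_map_ev3 ring_map_cst)

lemma ring_map_restrict_origin: "ring_map restrict_origin"
  unfolding restrict_origin_def[abs_def]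
  by (rule ring_map_comp[OF ring_map_ev2[OF ring_map_const] ring_map_restrict_exc])

text \<open>
  Modulo u, every polynomial is congruent to its restriction, read as a polynomial in v and w.
\<close>

lemma restrict_exc_eq_0_iff: "restrict_exc g = 0 \<longleftrightarrow> varX3 dvd g"
proof
  assume eq: "restrict_exc g = 0"
  let ?l = "ev2 const3 varY3 varZ3"
  note l = ring_map_ev2[OF ring_map_const3, of varY3 varZ3] and r = ring_map_restrict_exc
  let ?A = "{g. varX3 dvd g - ?l (restrict_exc g)}"
  have "g \<in> ?A"
  proof (rule poly3_in_subring)
    show "r + s \<in> ?A" "r * s \<in> ?A" if rs: "r \<in> ?A" "s \<in> ?A" for r s
    proof -
      have dvd: "varX3 dvd r - ?l (restrict_exc r)" "varX3 dvd s - ?l (restrict_exc s)" using rs by simp_all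
      have "r + s - ?l (restrict_exc (r + s)) = (r - ?l (restrict_exc r)) + (s - ?l (restrict_exc s))"
        by (simp only: ring_map_add[OF l] ring_map_add[OF r] add_diff_add)
      then show "r + s \<in> ?A" using dvd_add[OF dvd] by (simp only: mem_Collect_eq)
      have "r * s - ?l (restrict_exc (r * s)) = (r - ?l (restrict_exc r)) * s + (s - ?l (restrict_exc s)) * ?l (restrict_exc r)"
        by (simp only: ring_map_mult[OF l] ring_map_mult[OF r] algebra_simps)
      then show "r * s \<in> ?A" using dvd_add[OF dvd_mult2[OF dvd(1)] dvd_mult2[OF dvd(2)]]
        by (simp only: mem_Collect_eq)
    qed
  qed (simp_all only: restrict_exc_def ev3_vars[OF ring_map_cst] ev2_vars[OF ring_map_const3] ring_map_zero[OF l]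
      mem_Collect_eq diff_self dvd_0_right diff_zero dvd_refl)
  then show "varX3 dvd g" by (simp add: eq ring_map_zero[OF l])
next
  assume "varX3 dvd g"
  then obtain h where "g = varX3 * h" by (elim dvdE)
  then show "restrict_exc g = 0"
    by (simp only: ring_map_mult[OF ring_map_restrict_exc]) (simp only: restrict_exc_def ev3_vars[OF ring_map_cst] mult_zero_left)
qed

text \<open>
  The valuation is the order in u, transported to Frac R by an isomorphism \<Psi> onto k(u,v,w).
  By the assumptions on the center, the restriction of \<open>\<psi> s\<close> to the line u = v
  = 0 is the restriction of s to the line in affine space over p, so the center is the prime of
  this line, of height two. The residue field is generated by the residues of v and of elements
  of R, so it remains to show that v is transcendental. This is \<open>has_trdeg_1\<close> for
  the fractions whose denominator does not vanish on the line u = v = 0: the element v vanishes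
  there and so has no inverse among them.
\<close>

lemma divisorial_u_adic:
  fixes \<psi> :: "'k::field poly3 \<Rightarrow> 'k poly3" and \<Psi> :: "'k frac3 \<Rightarrow> 'k frac3"
  assumes \<Psi>: "ring_map \<Psi>" "surj \<Psi>" and \<psi>: "\<And>r. \<Psi> (Fract r 1) = Fract (\<psi> r) 1"
    and const: "\<And>c. \<psi> (const3 c) = const3 c" and w: "\<psi> w = varZ3"
    and center: "\<And>s. cone_map p s = 0 \<Longrightarrow> varX3 dvd \<psi> s" "\<And>s. restrict_origin (\<psi> s) = cone_map p s"
  shows "divisorial {a. \<Psi> a \<in> (u_adic_ring :: 'k frac3 set)}" (is "divisorial ?V")
proof -
  have V: "valuation_ring ?V" by (rule u_adic_valuation_ring[OF \<Psi>(1)])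
  have R: "Fract r 1 \<in> ?V" for r using \<psi> u_adic_ring_closed(1) by simp
  have inj: "x = y" if "\<Psi> x = \<Psi> y" for x y
  proof (rule ccontr)
    assume "x \<noteq> y"
    then have "\<Psi> (inverse (x - y) * (x - y)) = 1" by (simp add: ring_map_one[OF \<Psi>(1)])
    then show False using that by (simp add: ring_map_mult[OF \<Psi>(1)] ring_map_diff[OF \<Psi>(1)])
  qed
  have max: "a \<in> val_max_ideal ?V \<longleftrightarrow> varX3 dvd g" if a: "\<Psi> a = Fract g h" "\<not> varX3 dvd h" for a g h
  proof -
    have aV: "a \<in> ?V" using a unfolding u_adic_ring_def by blast
    have h0: "h \<noteq> 0" using a(2) by auto
    show ?thesis
    proof (cases "a = 0")
      case True
      then have "Fract g h = Fract 0 1" using a(1) ring_map_zero[OF \<Psi>(1)] by (simp add: Zero_fract_def)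
      then have "g = 0" using h0 by (simp add: eq_fract)
      then show ?thesis using True val_max_ideal_iff[OF V, of a] aV by simp
    next
      case False
      have "\<Psi> (inverse a) * \<Psi> a = 1" using False by (simp flip: ring_map_mult[OF \<Psi>(1)] add: ring_map_one[OF \<Psi>(1)])
      then have "\<Psi> (inverse a) = inverse (\<Psi> a)" by (metis inverse_unique mult.commute)
      then have i: "\<Psi> (inverse a) = Fract h g" using a(1) by simp
      have g0: "g \<noteq> 0"
      proof
        assume "g = 0"
        then have "\<Psi> a = \<Psi> 0" using a(1) h0 ring_map_zero[OF \<Psi>(1)] by (simp add: Zero_fract_def eq_fract)
        then show False using inj False by blast
      qed
      have "Fract h g \<in> u_adic_ring \<longleftrightarrow> \<not> varX3 dvd g"
      proof
        assume "Fract h g \<in> u_adic_ring"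
        then obtain x y where xy: "Fract h g = Fract x y" "\<not> varX3 dvd y" unfolding u_adic_ring_def by blast
        moreover from xy have "y \<noteq> 0" by auto
        ultimately have "h * y = x * g" using g0 by (simp add: eq_fract)
        then show "\<not> varX3 dvd g" using not_varX3_dvd_mult[OF a(2) xy(2)] by (metis dvd_mult)
      qed (auto simp: u_adic_ring_def)
      then show ?thesis using val_max_ideal_iff[OF V, of a] aV False i by auto
    qed
  qed
  have center': "val_center ?V = {s. cone_map p s = 0}"
  proof -
    have "s \<in> val_center ?V \<longleftrightarrow> cone_map p s = 0" for s
    proof -
      have "s \<in> val_center ?V \<longleftrightarrow> varX3 dvd \<psi> s"
        unfolding val_center_def mem_Collect_eq by (rule max[OF \<psi> not_varX3_dvd_1])
      moreover have "cone_map p s = 0" if "varX3 dvd \<psi> s"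
      proof -
        have "restrict_exc (\<psi> s) = 0" using that restrict_exc_eq_0_iff by blast
        then show ?thesis unfolding center(2)[symmetric] restrict_origin_def
          by (simp add: ring_map_zero[OF ring_map_ev2[OF ring_map_const]])
      qed
      ultimately show ?thesis using center(1) by blast
    qed
    then show ?thesis by blast
  qed
  have not_dvd: "\<not> varX3 dvd h" if "restrict_origin h \<noteq> 0" for h
    using that unfolding restrict_origin_def restrict_exc_eq_0_iff[symmetric]
    by (auto simp: ring_map_zero[OF ring_map_ev2[OF ring_map_const]])
  define T where "T g = inv_into UNIV \<Psi> (Fract g 1)" for g
  have T: "\<Psi> (T g) = Fract g 1" for g unfolding T_def by (rule surj_f_inv_f[OF \<Psi>(2)])
  have TV: "T g \<in> ?V" for g using T u_adic_ring_closed(1) by simp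
  have Tmax: "T g \<in> val_max_ideal ?V \<longleftrightarrow> varX3 dvd g" for g by (rule max[OF T not_varX3_dvd_1])
  have Tadd: "T (g + h) = T g + T h" and Tmult: "T (g * h) = T g * T h" for g h
    by (rule inj, simp add: T ring_map_add[OF \<Psi>(1)] ring_map_mult[OF \<Psi>(1)])+
  let ?b = "T varY3" and ?L = "val_residue_field ?V"
  let ?S = "{a. \<exists>g h. \<Psi> a = Fract g h \<and> restrict_origin h \<noteq> 0}"
  note ro = ring_map_restrict_origin
  have ro_Y: "restrict_origin varY3 = 0"
    unfolding restrict_origin_def restrict_exc_def
    by (simp only: ev3_vars[OF ring_map_cst] ev2_vars[OF ring_map_const])
  have ro_1: "restrict_origin 1 \<noteq> 0" by (simp add: ring_map_one[OF ro])
  have "has_trdeg ?L (center_residue_field ?V) 1"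
  proof (rule has_trdeg_1[OF V R, where b = ?b and S = ?S])
    show "?S \<subseteq> ?V" unfolding u_adic_ring_def using not_dvd by blast
    show "center_local_ring ?V \<subseteq> ?S"
    proof
      fix a assume "a \<in> center_local_ring ?V"
      then obtain r s where rs: "a = Fract r s" "s \<notin> val_center ?V" unfolding center_local_ring_def[OF V] by blast
      have s: "restrict_origin (\<psi> s) \<noteq> 0" using rs(2) center(2) center' by auto
      then have \<psi>s: "\<psi> s \<noteq> 0" using ring_map_zero[OF ro] by auto
      have "s \<noteq> 0" using rs(2) center' ring_map_zero[OF ring_map_cone_map] by auto
      then have "a * Fract s 1 = Fract r 1" unfolding rs(1) by (simp add: eq_fract)
      then have "\<Psi> a * Fract (\<psi> s) 1 = Fract (\<psi> r) 1"
        unfolding \<psi>[symmetric] ring_map_mult[OF \<Psi>(1), symmetric] by simp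
      then have "\<Psi> a = Fract (\<psi> r) 1 / Fract (\<psi> s) 1"
        using \<psi>s by (subst nonzero_eq_divide_eq) (simp_all add: Fract_1_eq_0_iff)
      then have "\<Psi> a = Fract (\<psi> r) (\<psi> s)" by simp
      with s show "a \<in> ?S" by blast
    qed
    show "a + b \<in> ?S \<and> a * b \<in> ?S" if ab: "a \<in> ?S" "b \<in> ?S" for a b
    proof -
      obtain g h g' h' where gh: "\<Psi> a = Fract g h" "restrict_origin h \<noteq> 0" "\<Psi> b = Fract g' h'" "restrict_origin h' \<noteq> 0"
        using ab by blast
      then have "h \<noteq> 0" "h' \<noteq> 0" using ring_map_zero[OF ro] by auto
      then have "\<Psi> (a + b) = Fract (g * h' + g' * h) (h * h')" "\<Psi> (a * b) = Fract (g * g') (h * h')"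
        using gh by (simp_all add: ring_map_add[OF \<Psi>(1)] ring_map_mult[OF \<Psi>(1)])
      moreover have "restrict_origin (h * h') \<noteq> 0" using gh by (simp add: ring_map_mult[OF ro])
      ultimately show ?thesis by blast
    qed
    show "?b \<in> ?S" using T ro_1 by blast
    show "?b \<notin> val_max_ideal ?V"
      unfolding Tmax restrict_exc_eq_0_iff[symmetric] restrict_exc_def ev3_vars[OF ring_map_cst] by simp
    show "?b * s - 1 \<notin> val_max_ideal ?V" if s: "s \<in> ?S" for s
    proof -
      obtain g h where gh: "\<Psi> s = Fract g h" "restrict_origin h \<noteq> 0" using s by blast
      then have h0: "h \<noteq> 0" using ring_map_zero[OF ro] by auto
      have hh: "Fract h h = 1" using h0 by (simp add: One_fract_def eq_fract)
      have alg: "Fract a 1 * Fract g h - Fract h h = Fract ((a * g - h) * h) (h * h)" for a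
        using h0 by (simp add: algebra_simps)
      have "\<Psi> (?b * s - 1) = Fract varY3 1 * Fract g h - Fract h h"
        by (simp only: ring_map_diff[OF \<Psi>(1)] ring_map_mult[OF \<Psi>(1)] ring_map_one[OF \<Psi>(1)] T gh(1) hh)
      also have "\<dots> = Fract ((varY3 * g - h) * h) (h * h)"
        by (rule alg)
      also have "\<dots> = Fract (varY3 * g - h) h"
        using h0 by (simp add: eq_fract mult_ac)
      finally have "?b * s - 1 \<in> val_max_ideal ?V \<longleftrightarrow> varX3 dvd varY3 * g - h"
        by (rule max[OF _ not_dvd[OF gh(2)]])
      moreover have "restrict_origin (varY3 * g - h) \<noteq> 0"
        using gh(2) by (simp only: ring_map_diff[OF ro] ring_map_mult[OF ro] ro_Y) simp
      ultimately show ?thesis using not_dvd by blast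
    qed
    \<comment> \<open>the preimages of u, v and w have residues 0, b and one coming from R\<close>
    show "residue ?V x \<in> generate_field ?L (center_residue_field ?V \<union> {residue ?V ?b})" (is "_ \<in> ?E") if x: "x \<in> ?V" for x
    proof -
      interpret L: field ?L by (rule residue_field_field[OF V])
      have E0: "\<zero>\<^bsub>?L\<^esub> \<in> ?E" by (rule L.zero_in_generate)
      have Fr: "residue ?V (Fract r 1) \<in> ?E" for r
        using Fract_in_center_local_ring[OF V R, of r] center_residue_field_eq[OF V]
        by (intro generate_field.incl) blast
      have gE: "residue ?V (T g) \<in> ?E" for g
      proof -
        have "g \<in> {g. residue ?V (T g) \<in> ?E}"
        proof (rule poly3_in_subring; unfold mem_Collect_eq)
          show "residue ?V (T (const3 c)) \<in> ?E" for c
          proof -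
            have "T (const3 c) = Fract (const3 c) 1" by (rule inj) (simp add: T \<psi> const)
            with Fr show ?thesis by (simp only:)
          qed
          show "residue ?V (T (r + s)) \<in> ?E" if "residue ?V (T r) \<in> ?E" "residue ?V (T s) \<in> ?E" for r s
            unfolding Tadd residue_field_ops(2)[OF V TV TV] by (intro generate_field.eng_add that)
          show "residue ?V (T (r * s)) \<in> ?E" if "residue ?V (T r) \<in> ?E" "residue ?V (T s) \<in> ?E" for r s
            unfolding Tmult residue_field_ops(3)[OF V TV TV] by (intro generate_field.eng_mult that)
          have "residue ?V (T varX3) = \<zero>\<^bsub>?L\<^esub>"
            by (rule iffD2[OF residue_eq_0_iff[OF V TV] iffD2[OF Tmax dvd_refl]])
          with E0 show "residue ?V (T varX3) \<in> ?E" by (simp only:)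
          show "residue ?V (T varY3) \<in> ?E" by (rule generate_field.incl[OF UnI2[OF singletonI]])
          have "T varZ3 = Fract w 1" by (rule inj) (simp add: T \<psi> w)
          with Fr show "residue ?V (T varZ3) \<in> ?E" by (simp only:)
        qed
        then show ?thesis by simp
      qed
      obtain g h where gh: "\<Psi> x = Fract g h" "\<not> varX3 dvd h" using x unfolding u_adic_ring_def by blast
      then have h0: "h \<noteq> 0" by auto
      have "T h \<notin> val_max_ideal ?V" using gh(2) Tmax by blast
      note i = residue_inverse[OF V TV this]
      have "T h \<noteq> 0" using T[of h] h0 ring_map_zero[OF \<Psi>(1)] Fract_1_eq_0_iff[of h] by auto
      have "x * T h = T g" by (rule inj) (use h0 in \<open>simp add: ring_map_mult[OF \<Psi>(1)] T gh(1) eq_fract\<close>)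
      then have "x = T g * inverse (T h)" using \<open>T h \<noteq> 0\<close> by (simp add: field_simps)
      then have "residue ?V x = residue ?V (T g) \<otimes>\<^bsub>?L\<^esub> inv\<^bsub>?L\<^esub> residue ?V (T h)"
        using residue_field_ops(3)[OF V TV i(1)] i(2) by simp
      moreover have "residue ?V (T h) \<noteq> \<zero>\<^bsub>?L\<^esub>"
        using residue_eq_0_iff[OF V TV, of h] \<open>T h \<notin> val_max_ideal ?V\<close> by simp
      ultimately show ?thesis
        using generate_field.eng_mult[OF gE generate_field.m_inv[OF gE]] by simp
    qed
  qed
  moreover have "prime_height (val_center ?V) = enat (1 + 1)"
    unfolding center' by (simp only: prime_height_cone one_add_one)
  ultimately show ?thesis unfolding divisorial_def using V R by blast
qed


section \<open>The valuations of the exceptional curves are divisorial\<close>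

text \<open>
  The total transform at q, made injective on all of R by the variable w that records the
  degree: a form f of degree m goes to \<open>w ^ m\<close> times its total transform
  (\<open>graded_transform_forms\<close>).
\<close>

definition graded_transform :: "'k::field near_point \<Rightarrow> 'k poly3 \<Rightarrow> 'k poly3" where
  "graded_transform q = ev3 const3 (varZ3 * [:total_transform varX3 q:]) (varZ3 * [:total_transform varY3 q:])
     (varZ3 * [:total_transform varZ3 q:])"

lemma ring_map_graded_transform: "ring_map (graded_transform q)"
  unfolding graded_transform_def by (intro ring_map_ev3 ring_map_const3)

lemma graded_transform_vars:
  "graded_transform q (const3 c) = const3 c" "graded_transform q varX3 = varZ3 * [:total_transform varX3 q:]"
  "graded_transform q varY3 = varZ3 * [:total_transform varY3 q:]" "graded_transform q varZ3 = varZ3 * [:total_transform varZ3 q:]"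
  unfolding graded_transform_def by (rule ev3_vars[OF ring_map_const3])+

lemma graded_transform_forms:
  assumes "f \<in> forms m" shows "graded_transform q f = Polynomial.monom (total_transform f q) m"
proof -
  have "ev3 const3 [:total_transform varX3 q:] [:total_transform varY3 q:] [:total_transform varZ3 q:] f = [:total_transform f q:]"
    by (rule ring_map_eqI3[OF ring_map_ev3[OF ring_map_const3] ring_map_comp[OF ring_map_const ring_map_total_transform]])
      (simp_all only: ev3_vars[OF ring_map_const3] total_transform_const)
  then have "graded_transform q f = varZ3 ^ m * [:total_transform f q:]"
    unfolding graded_transform_def ev3_homogeneous[OF ring_map_const3 assms] by (simp only:)
  then show ?thesis by (simp add: monom_altdef mult.commute)
qed

lemma graded_transform_eq_0: "graded_transform q f = 0 \<Longrightarrow> f = 0"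
proof -
  assume eq: "graded_transform q f = 0"
  obtain N g where g: "\<And>m. g m \<in> forms m" "\<And>m. m > N \<Longrightarrow> g m = 0" "f = (\<Sum>m\<le>N. g m)"
    using homogeneous_decomposition by blast
  have sum0: "(\<Sum>m\<le>N. Polynomial.monom (total_transform (g m) q) m) = 0"
    using eq unfolding g(3) ring_map_sum[OF ring_map_graded_transform] graded_transform_forms[OF g(1)] .
  have "total_transform (g m) q = 0" if m: "m \<le> N" for m
    using arg_cong[OF sum0, of "\<lambda>p. Polynomial.coeff p m"] m by (simp add: coeff_sum)
  then have "g m = 0" if "m \<le> N" for m using that total_transform_eq_0_iff[OF g(1)] by blast
  then show "f = 0" unfolding g(3) by simp
qed

definition graded_blow_up :: "'k::field direction \<Rightarrow> 'k poly3 \<Rightarrow> 'k poly3" where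
  "graded_blow_up t = eval_map (\<lambda>g. [:blow_up t g:]) varZ3"

lemma ring_map_graded_blow_up: "ring_map (graded_blow_up t)"
  unfolding graded_blow_up_def by (intro ring_map_eval_map ring_map_comp[OF ring_map_const ring_map_blow_up])

lemma graded_blow_up_const: "graded_blow_up t [:g:] = [:blow_up t g:]"
  unfolding graded_blow_up_def
  by (rule eval_map_const) (simp add: ring_map_zero[OF ring_map_blow_up] del: blow_up.simps)

lemma graded_blow_up_varZ: "graded_blow_up t varZ3 = varZ3"
  unfolding graded_blow_up_def by (rule eval_map_var[OF ring_map_comp[OF ring_map_const ring_map_blow_up]])

lemma graded_transform_Near: "graded_transform (Near q t) f = graded_blow_up t (graded_transform q f)"
  by (rule ring_map_eqI3[OF ring_map_graded_transform ring_map_comp[OF ring_map_graded_blow_up ring_map_graded_transform]])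
    (simp_all only: graded_transform_vars ring_map_mult[OF ring_map_graded_blow_up] graded_blow_up_varZ graded_blow_up_const
      total_transform.simps blow_up_cst)

fun root_point :: "'k near_point \<Rightarrow> 'k plane_point" where
  "root_point (Proper p) = p"
| "root_point (Near q t) = root_point q"

lemma total_transform_linW: "total_transform (linW (root_point q)) q = 1"
  by (induction q) (simp_all add: local_equation_lin ring_map_one[OF ring_map_blow_up] del: blow_up.simps local_equation.simps)

lemma graded_transform_linW: "graded_transform q (linW (root_point q)) = varZ3"
  using graded_transform_forms[OF forms_lin(3), of q "root_point q"]
  by (simp add: total_transform_linW monom_Suc flip: one_pCons)

text \<open>
  The extension of an injective endomorphism to the field of fractions; injectivity makes the
  choice of the fraction irrelevant (\<open>frac_map_Fract\<close>).
\<close>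

definition frac_map :: "('a::idom \<Rightarrow> 'a) \<Rightarrow> 'a fract \<Rightarrow> 'a fract" where
  "frac_map \<phi> x = (THE y. \<exists>r s. s \<noteq> 0 \<and> x = Fract r s \<and> y = Fract (\<phi> r) (\<phi> s))"

context
  fixes \<phi> :: "'a::idom \<Rightarrow> 'a"
  assumes hom: "ring_map \<phi>" and inj: "\<And>r. \<phi> r = 0 \<Longrightarrow> r = 0"
begin

lemma frac_map_Fract: "s \<noteq> 0 \<Longrightarrow> frac_map \<phi> (Fract r s) = Fract (\<phi> r) (\<phi> s)"
  unfolding frac_map_def
proof (rule the_equality, blast)
  fix y assume s: "s \<noteq> 0" and "\<exists>r' s'. s' \<noteq> 0 \<and> Fract r s = Fract r' s' \<and> y = Fract (\<phi> r') (\<phi> s')"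
  then obtain r' s' where *: "s' \<noteq> 0" "Fract r s = Fract r' s'" "y = Fract (\<phi> r') (\<phi> s')" by blast
  then have "r * s' = r' * s" using s by (simp add: eq_fract)
  then have "\<phi> r * \<phi> s' = \<phi> r' * \<phi> s" by (simp flip: ring_map_mult[OF hom])
  moreover have "\<phi> s \<noteq> 0" "\<phi> s' \<noteq> 0" using inj s *(1) by blast+
  ultimately show "y = Fract (\<phi> r) (\<phi> s)" unfolding *(3) by (simp add: eq_fract)
qed

lemma frac_map_Fract_1: "frac_map \<phi> (Fract r 1) = Fract (\<phi> r) 1"
  by (simp add: frac_map_Fract ring_map_one[OF hom])

lemma ring_map_frac_map: "ring_map (frac_map \<phi>)"
proof (rule ring_mapI)
  show "frac_map \<phi> 1 = 1" by (simp add: One_fract_def frac_map_Fract ring_map_one[OF hom])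
  fix a b :: "'a fract"
  obtain r s where a: "a = Fract r s" "s \<noteq> 0" by (cases a)
  obtain r' s' where b: "b = Fract r' s'" "s' \<noteq> 0" by (cases b)
  have "\<phi> s \<noteq> 0" "\<phi> s' \<noteq> 0" using inj a(2) b(2) by blast+
  then show "frac_map \<phi> (a + b) = frac_map \<phi> a + frac_map \<phi> b" "frac_map \<phi> (a * b) = frac_map \<phi> a * frac_map \<phi> b"
    using a(2) b(2) by (simp_all add: a(1) b(1) frac_map_Fract ring_map_add[OF hom] ring_map_mult[OF hom])
qed

end

abbreviation function_field_map :: "'k::field near_point \<Rightarrow> 'k frac3 \<Rightarrow> 'k frac3" where
  "function_field_map q \<equiv> frac_map (graded_transform q)"

lemma ring_map_function_field_map: "ring_map (function_field_map q)"
  by (rule ring_map_frac_map[OF ring_map_graded_transform graded_transform_eq_0])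

lemma function_field_map_Fract:
  "s \<noteq> 0 \<Longrightarrow> function_field_map q (Fract r s) = Fract (graded_transform q r) (graded_transform q s)"
  by (rule frac_map_Fract[OF ring_map_graded_transform graded_transform_eq_0])

lemma function_field_map_Fract_1: "function_field_map q (Fract r 1) = Fract (graded_transform q r) 1"
  by (rule frac_map_Fract_1[OF ring_map_graded_transform graded_transform_eq_0])

lemma function_field_map_Near:
  assumes "function_field_map q x = Fract g 1"
  shows "function_field_map (Near q t) x = Fract (graded_blow_up t g) 1"
proof -
  obtain r s where x: "x = Fract r s" "s \<noteq> 0" by (cases x)
  have s: "graded_transform q' s \<noteq> 0" for q' using x(2) graded_transform_eq_0 by blast
  have "graded_transform q r = g * graded_transform q s"
    using assms s[of q] unfolding x(1) function_field_map_Fract[OF x(2)] by (simp add: eq_fract)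
  then have "graded_transform (Near q t) r = graded_blow_up t g * graded_transform (Near q t) s"
    unfolding graded_transform_Near by (simp add: ring_map_mult[OF ring_map_graded_blow_up])
  then show ?thesis
    using s[of "Near q t"] unfolding x(1) function_field_map_Fract[OF x(2)] by (simp add: eq_fract)
qed

lemma range_field_closed:
  fixes \<Psi> :: "'a::field \<Rightarrow> 'b::field"
  assumes \<Psi>: "ring_map \<Psi>" and xy: "x \<in> range \<Psi>" "y \<in> range \<Psi>"
  shows "x + y \<in> range \<Psi>" "x - y \<in> range \<Psi>" "x * y \<in> range \<Psi>" "x / y \<in> range \<Psi>"
proof -
  obtain a b where ab: "x = \<Psi> a" "y = \<Psi> b" using xy by blast
  show "x + y \<in> range \<Psi>" "x - y \<in> range \<Psi>" "x * y \<in> range \<Psi>"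
    unfolding ab ring_map_add[OF \<Psi>, symmetric] ring_map_diff[OF \<Psi>, symmetric] ring_map_mult[OF \<Psi>, symmetric]
    by (rule rangeI)+
  show "x / y \<in> range \<Psi>"
  proof (cases "b = 0")
    case True
    then have "x / y = \<Psi> 0" using ab by (simp add: ring_map_zero[OF \<Psi>])
    then show ?thesis by blast
  next
    case False
    then have *: "\<Psi> (inverse b) * y = 1" unfolding ab by (simp flip: ring_map_mult[OF \<Psi>] add: ring_map_one[OF \<Psi>])
    then have "inverse y = \<Psi> (inverse b)" by (metis inverse_unique mult.commute)
    then have "x / y = \<Psi> (a * inverse b)" unfolding ab(1) by (simp add: ring_map_mult[OF \<Psi>] divide_inverse)
    then show ?thesis by blast
  qed
qed

lemma Fract_div: "s \<noteq> 0 \<Longrightarrow> Fract (r * s) 1 / Fract s 1 = Fract (r::'a::idom) 1"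
  by (simp add: eq_fract)

text \<open>
  Blowing up is birational. At a proper point, u and v are the quotients of the adapted linear
  coordinates; a blowup replaces u and v by u and u(v + c), or by uv and v, from which they are
  recovered by division. The variable w is the image of the linear form that does not vanish at
  the proper point.
\<close>

lemma surj_function_field_map: "surj (function_field_map (q :: 'k::field near_point))"
proof -
  let ?Fr = "\<lambda>g :: 'k poly3. Fract g 1"
  note \<Psi> = ring_map_function_field_map
  have gen: "?Fr varX3 \<in> range (function_field_map q) \<and> ?Fr varY3 \<in> range (function_field_map q)" for q
  proof (induction q)
    case (Proper p)
    let ?\<Psi> = "function_field_map (Proper p)"
    have 1: "?Fr (varZ3 * [:total_transform f (Proper p):]) \<in> range ?\<Psi>" if f: "f \<in> forms 1" for f
    proof -
      have "?\<Psi> (?Fr f) = ?Fr (varZ3 * [:total_transform f (Proper p):])"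
        unfolding function_field_map_Fract_1 graded_transform_forms[OF f]
        by (simp add: monom_Suc monom_0)
      then show ?thesis by (metis rangeI)
    qed
    have X: "?Fr (varX3 * varZ3) \<in> range ?\<Psi>"
      using 1[OF forms_lin(1)[of p]] unfolding total_transform.simps local_equation_lin by (simp only: mult.commute)
    have Y: "?Fr (varY3 * varZ3) \<in> range ?\<Psi>"
      using 1[OF forms_lin(2)[of p]] unfolding total_transform.simps local_equation_lin by (simp only: mult.commute)
    have Z: "?Fr varZ3 \<in> range ?\<Psi>"
      using 1[OF forms_lin(3)[of p]] unfolding total_transform.simps local_equation_lin by (simp flip: one_pCons)
    have Z0: "varZ3 \<noteq> (0 :: 'k poly3)" by simp
    show ?case
      using range_field_closed(4)[OF \<Psi> X Z] range_field_closed(4)[OF \<Psi> Y Z]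
      unfolding Fract_div[OF Z0] by blast
  next
    case (Near q t)
    let ?\<Psi> = "function_field_map (Near q t)"
    have step: "?Fr (graded_blow_up t g) \<in> range ?\<Psi>" if g: "?Fr g \<in> range (function_field_map q)" for g
    proof -
      obtain x where "function_field_map q x = ?Fr g" using g by (metis imageE)
      then have "?\<Psi> x = ?Fr (graded_blow_up t g)" by (rule function_field_map_Near)
      then show ?thesis by (metis rangeI)
    qed
    have c: "?Fr (const3 c) \<in> range ?\<Psi>" for c
      using function_field_map_Fract_1[of "Near q t" "const3 c"] unfolding graded_transform_vars by (metis rangeI)
    have X: "?Fr [:blow_up t varU:] \<in> range ?\<Psi>" and Y: "?Fr [:blow_up t varV:] \<in> range ?\<Psi>"
      using step Near unfolding graded_blow_up_const[symmetric] by blast+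
    have m: "[:a * b:] = [:a:] * [:b:]" for a b :: "'k poly2" by simp
    show ?case
    proof (cases t)
      case (Slope c)
      have X': "?Fr varX3 \<in> range ?\<Psi>"
        using X unfolding Slope blow_up_Slope ev2_vars[OF ring_map_cst] .
      have Y': "?Fr ((varY3 + const3 c) * varX3) \<in> range ?\<Psi>"
        using Y unfolding Slope blow_up_Slope ev2_vars[OF ring_map_cst] m by (simp add: mult.commute)
      have X0: "varX3 \<noteq> (0 :: 'k poly3)" by simp
      have "?Fr (varY3 + const3 c) \<in> range ?\<Psi>"
        using range_field_closed(4)[OF \<Psi> Y' X'] unfolding Fract_div[OF X0] .
      then have "?Fr (varY3 + const3 c) - ?Fr (const3 c) \<in> range ?\<Psi>"
        using range_field_closed(2)[OF \<Psi> _ c] by blast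
      then have "?Fr varY3 \<in> range ?\<Psi>"
        unfolding ring_map_diff[OF ring_map_Fract, symmetric] by (simp only: add_diff_cancel_right')
      with X' show ?thesis by blast
    next
      case Vertical
      have Y': "?Fr varY3 \<in> range ?\<Psi>"
        using Y unfolding Vertical blow_up_Vertical ev2_vars[OF ring_map_cst] .
      have X': "?Fr (varX3 * varY3) \<in> range ?\<Psi>"
        using X unfolding Vertical blow_up_Vertical ev2_vars[OF ring_map_cst] m .
      have Y0: "varY3 \<noteq> (0 :: 'k poly3)" by simp
      have "?Fr varX3 \<in> range ?\<Psi>"
        using range_field_closed(4)[OF \<Psi> X' Y'] unfolding Fract_div[OF Y0] .
      with Y' show ?thesis by blast
    qed
  qed
  let ?\<Psi> = "function_field_map q"
  have "g \<in> {g. ?Fr g \<in> range ?\<Psi>}" for g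
  proof (rule poly3_in_subring; unfold mem_Collect_eq)
    show "?Fr (const3 c) \<in> range ?\<Psi>" for c
      using function_field_map_Fract_1[of q "const3 c"] unfolding graded_transform_vars by (metis rangeI)
    show "?Fr varZ3 \<in> range ?\<Psi>"
      using function_field_map_Fract_1[of q "linW (root_point q)"] unfolding graded_transform_linW by (metis rangeI)
    show "?Fr (r + s) \<in> range ?\<Psi>" if "?Fr r \<in> range ?\<Psi>" "?Fr s \<in> range ?\<Psi>" for r s
      unfolding ring_map_add[OF ring_map_Fract] by (rule range_field_closed(1)[OF \<Psi> that])
    show "?Fr (r * s) \<in> range ?\<Psi>" if "?Fr r \<in> range ?\<Psi>" "?Fr s \<in> range ?\<Psi>" for r s
      unfolding ring_map_mult[OF ring_map_Fract] by (rule range_field_closed(3)[OF \<Psi> that])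
  qed (use gen in blast)+
  then have Fr: "?Fr g \<in> range ?\<Psi>" for g by blast
  have "x \<in> range ?\<Psi>" for x
  proof -
    obtain r s where x: "x = Fract r s" "s \<noteq> 0" by (cases x)
    have "x = ?Fr r / ?Fr s" by (simp add: x(1))
    then show ?thesis using range_field_closed(4)[OF \<Psi> Fr Fr] by (simp only:)
  qed
  then show ?thesis by blast
qed

lemma total_transform_at_origin:
  "homog_coords (root_point q) = (poly (poly (total_transform varX3 q) 0) 0,
     poly (poly (total_transform varY3 q) 0) 0, poly (poly (total_transform varZ3 q) 0) 0)"
proof (induction q)
  case (Proper p)
  show ?case
    by (cases p) (simp_all only: root_point.simps homog_coords.simps total_transform.simps local_equation_eq
      plane_point.case ev3_vars[OF ring_map_cst], simp_all)
next
  case (Near q t)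
  have "poly (poly (blow_up t F) 0) 0 = poly (poly F 0) 0" for F
    by (rule ring_map_eqI2[OF ring_map_comp[OF ring_map_poly ring_map_comp[OF ring_map_poly ring_map_blow_up]]
        ring_map_comp[OF ring_map_poly ring_map_poly]])
      (cases t; simp only: blow_up_cst blow_up_Slope blow_up_Vertical ev2_vars[OF ring_map_cst]; simp)+
  with Near show ?case by (simp del: blow_up.simps)
qed

text \<open>
  The homogeneous coordinates of the plane are constant on the exceptional curve, because it
  lies over the single point \<open>root_point q\<close>.
\<close>

lemma restrict_exc_graded_transform:
  "restrict_exc (graded_transform (Near q (Slope 0)) f) = eval_map cst varV (cone_map (root_point q) f)"
proof -
  let ?x = "Near q (Slope (0 :: 'a))"
  note r = ring_map_restrict_exc
  have const: "restrict_exc [:F:] = ev2 cst 0 varU F" for F :: "'a poly2"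
    unfolding restrict_exc_def ev3_def by (rule eval_map_const) (rule ring_map_zero[OF ring_map_ev2[OF ring_map_cst]])
  have bl: "ev2 cst 0 varU (blow_up (Slope 0) F) = cst (poly (poly F 0) 0)" for F :: "'a poly2"
    by (rule ring_map_eqI2[OF ring_map_comp[OF ring_map_ev2[OF ring_map_cst] ring_map_blow_up]
        ring_map_comp[OF ring_map_cst ring_map_comp[OF ring_map_poly ring_map_poly]]];
      simp only: blow_up_cst blow_up_Slope ev2_vars[OF ring_map_cst] ring_map_mult[OF ring_map_ev2[OF ring_map_cst]]; simp)
  have Z: "restrict_exc varZ3 = varV" unfolding restrict_exc_def by (rule ev3_vars[OF ring_map_cst])
  have e: "eval_map cst varV [:0, c:] = varV * cst c" for c :: 'a
    by (simp add: eval_map_pCons eval_map_0)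
  show ?thesis
  proof (rule ring_map_eqI3[OF ring_map_comp[OF r ring_map_graded_transform]
        ring_map_comp[OF ring_map_eval_map[OF ring_map_cst] ring_map_cone_map]])
    show "restrict_exc (graded_transform ?x (const3 c)) = eval_map cst varV (cone_map (root_point q) (const3 c))" for c
      unfolding graded_transform_vars cone_map_const by (simp add: eval_map_const const ev2_vars[OF ring_map_cst])
  qed (simp_all only: graded_transform_vars ring_map_mult[OF r] Z const total_transform.simps bl cone_map_def
      total_transform_at_origin prod.case ev3_vars[OF ring_map_const] e)
qed

text \<open>
  The chart \<open>Slope 0\<close> serves to represent the exceptional curve of q by the
  equation u = 0; the charts \<open>Slope c\<close> differ from it by a translation.
\<close>

lemma divisorial_exceptional_curve:
  "divisorial {a. function_field_map (Near q (Slope 0)) a \<in> u_adic_ring}"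
proof (rule divisorial_u_adic[OF ring_map_function_field_map surj_function_field_map function_field_map_Fract_1
      graded_transform_vars(1) graded_transform_linW, where p = "root_point q"])
  let ?x = "Near q (Slope 0)"
  show "varX3 dvd graded_transform ?x s" if "cone_map (root_point q) s = 0" for s
    unfolding restrict_exc_eq_0_iff[symmetric] restrict_exc_graded_transform that by (rule eval_map_0)
  show "restrict_origin (graded_transform ?x s) = cone_map (root_point q) s" for s
  proof -
    have "ev2 (\<lambda>c. [:c:]) 0 [:0, 1:] (eval_map cst varV h) = h" for h
      by (rule ring_map_eqI_poly[OF ring_map_comp[OF ring_map_ev2[OF ring_map_const] ring_map_eval_map[OF ring_map_cst]] ring_map_id])
        (simp_all only: eval_map_const[of cst, OF ring_map_zero[OF ring_map_cst]] eval_map_var[OF ring_map_cst] ev2_vars[OF ring_map_const])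
    then show ?thesis unfolding restrict_origin_def restrict_exc_graded_transform .
  qed
qed

text \<open>
  An element g of least value in I transfers its order along the exceptional curve of q to f.
  Since f is a form, its graded transform is a power of w times its total transform, so nothing
  is lost in passing from one to the other.
\<close>

lemma order_along_exceptional_curve:
  assumes S: "S \<subseteq> forms d" and f: "f \<in> forms m"
    and le: "\<And>V. divisorial V \<Longrightarrow> val_ideal_le V (Idl\<^bsub>Rxyz\<^esub> S) f"
    and dvd: "\<And>s. s \<in> S \<Longrightarrow> varU ^ n dvd total_transform s (Near q (Slope 0))"
  shows "varU ^ n dvd total_transform f (Near q (Slope 0))"
proof -
  let ?x = "Near q (Slope 0)"
  note r = ring_map_graded_transform[of ?x]
  have monom_dvd: "varX3 ^ n dvd Polynomial.monom F m \<longleftrightarrow> varU ^ n dvd F" for F :: "'a poly2" and m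
    unfolding varX3_power const_poly_dvd_iff by auto
  have "ideal {g. varX3 ^ n dvd graded_transform ?x g} Rxyz"
    by (rule idealI_type) (auto simp: ring_map_zero[OF r] ring_map_add[OF r] ring_map_mult[OF r])
  moreover have "S \<subseteq> {g. varX3 ^ n dvd graded_transform ?x g}"
  proof
    fix s assume s: "s \<in> S"
    with S have "s \<in> forms d" by blast
    from graded_transform_forms[OF this, of ?x] show "s \<in> {g. varX3 ^ n dvd graded_transform ?x g}"
      using dvd[OF s] monom_dvd by (simp only: mem_Collect_eq)
  qed
  ultimately have I: "varX3 ^ n dvd graded_transform ?x g" if "g \<in> Idl\<^bsub>Rxyz\<^esub> S" for g
    using genideal_least that by blast
  obtain g c where g: "g \<in> Idl\<^bsub>Rxyz\<^esub> S" and c: "function_field_map ?x c \<in> u_adic_ring" "Fract f 1 = Fract g 1 * c"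
    using le[OF divisorial_exceptional_curve[of q]] unfolding val_ideal_le_def val_le_def by blast
  obtain a b where ab: "function_field_map ?x c = Fract a b" "\<not> varX3 dvd b"
    using c(1) unfolding u_adic_ring_def by blast
  then have b0: "b \<noteq> 0" by auto
  have "Fract (graded_transform ?x f) 1 = Fract (graded_transform ?x g) 1 * Fract a b"
    unfolding function_field_map_Fract_1[symmetric] ab(1)[symmetric] c(2) by (rule ring_map_mult[OF ring_map_function_field_map])
  then have "b * graded_transform ?x f = graded_transform ?x g * a"
    using b0 by (simp add: eq_fract mult.commute)
  then have "varX3 ^ n dvd b * graded_transform ?x f" using I[OF g] by (metis dvd_mult2)
  then have "varX3 ^ n dvd graded_transform ?x f"
    by (rule prime_elem_power_dvd_multD[OF prime_elem_varX3 ab(2)])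
  then show ?thesis unfolding graded_transform_forms[OF f] monom_dvd .
qed


section \<open>The divisorial cover is contained in the full ideal\<close>

text \<open>
  Let h be the quotient at q. Along the exceptional curve of q, the exceptional part has an
  order e, and all elements of I have order at least e + \<mu>(q). By the divisorial valuation
  of this curve, so has f; hence h has order at least \<mu>(q), which is what the next
  exceptional part requires.
\<close>

lemma exceptional_part_dvd_total_transform:
  fixes I :: "'k::alg_closed_field poly3 set"
  assumes S: "S \<subseteq> forms d" "\<not> S \<subseteq> {0}" and I: "I = Idl\<^bsub>Rxyz\<^esub> S" and f: "f \<in> forms m"
    and le: "\<And>V. divisorial V \<Longrightarrow> val_ideal_le V I f"
  shows "exceptional_part (base_mult I d) q dvd total_transform f q"
proof (induction q)
  case (Proper p)
  show ?case by (simp add: exceptional_part_Proper)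
next
  case (Near q t)
  let ?E = "exceptional_part (base_mult I d)" and ?\<mu> = "base_mult I d q" and ?x = "Near q (Slope 0)"
  have idI: "ideal I Rxyz" and SI: "S \<subseteq> I" unfolding I by (rule genideal_ideal_type genideal_incl)+
  have ne: "\<exists>f\<in>I \<inter> forms d. f \<noteq> 0" using S SI by blast
  obtain h where h: "total_transform f q = ?E q * h" using Near by (auto elim: dvdE)
  have "blow_up (Slope 0) (?E q) \<noteq> 0"
    unfolding blow_up_eq_0_iff by (rule exceptional_part_nonzero)
  then obtain e G where eG: "blow_up (Slope 0) (?E q) = varU ^ e * G" "\<not> varU dvd G"
    using varU_power_decomp by blast
  have "varU ^ (e + ?\<mu>) dvd total_transform f ?x"
  proof (rule order_along_exceptional_curve[OF S(1) f le[unfolded I]])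
    fix s assume s: "s \<in> S"
    then have "s \<in> I \<inter> forms d" using S(1) SI by blast
    then obtain v where v: "total_transform s q = ?E q * v" "ord_ge ?\<mu> v"
      using base_system_facts[OF idI ne, of q] by blast
    have "varU ^ ?\<mu> dvd blow_up (Slope 0) v"
      using exc_power_dvd_blow_up_iff[of "Slope 0" ?\<mu> v] v(2) by (simp only: exc_equation.simps)
    then have "varU ^ e * varU ^ ?\<mu> dvd (varU ^ e * G) * blow_up (Slope 0) v"
      by (intro mult_dvd_mono dvd_triv_left)
    then show "varU ^ (e + ?\<mu>) dvd total_transform s ?x"
      unfolding total_transform.simps v(1) ring_map_mult[OF ring_map_blow_up] eG(1) power_add .
  qed
  then have "varU ^ e * varU ^ ?\<mu> dvd varU ^ e * (G * blow_up (Slope 0) h)"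
    unfolding total_transform.simps h ring_map_mult[OF ring_map_blow_up] eG(1) power_add mult.assoc .
  then have "varU ^ ?\<mu> dvd G * blow_up (Slope 0) h"
    by (subst (asm) dvd_mult_cancel_left) auto
  then have "varU ^ ?\<mu> dvd blow_up (Slope 0) h"
    by (rule prime_elem_power_dvd_multD[OF prime_elem_varU eG(2)])
  then have "ord_ge ?\<mu> h"
    using exc_power_dvd_blow_up_iff[of "Slope 0" ?\<mu> h] by (simp only: exc_equation.simps)
  then have "exc_equation t ^ ?\<mu> dvd blow_up t h" by (simp only: exc_power_dvd_blow_up_iff)
  then have "exc_equation t ^ ?\<mu> * blow_up t (?E q) dvd blow_up t h * blow_up t (?E q)"
    by (rule mult_dvd_mono[OF _ dvd_refl])
  then show ?case
    unfolding exceptional_part_Near total_transform.simps h ring_map_mult[OF ring_map_blow_up]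
    by (simp only: mult.commute)
qed

text \<open>
  The divisibility holds in k[u,v], before localizing, so the unit in the definition of virtual
  passage is 1.
\<close>

lemma divisorial_cover_subset_full_ideal:
  fixes I :: "'k::alg_closed_field poly3 set"
  assumes S: "S \<subseteq> forms d" "\<not> S \<subseteq> {0}" and I: "I = Idl\<^bsub>Rxyz\<^esub> S"
  shows "divisorial_cover I \<subseteq> full_ideal K (base_mult I d)"
proof -
  have "passes_virtually K (base_mult I d) f"
    if "f \<in> forms m" "\<And>V. divisorial V \<Longrightarrow> val_ideal_le V I f" for f m
    unfolding passes_virtually_def
    using exceptional_part_dvd_total_transform[OF S I that] unfolding exceptional_part_def
    by (intro ballI exI[of _ 1]) (simp del: exc_total_transform.simps)
  then show ?thesis
    unfolding divisorial_cover_def full_ideal_def graded_sum_def by blast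
qed


section \<open>The full ideal is contained in the fat ideal\<close>

lemma point_ideal_lin: "linX p \<in> point_ideal p" "linY p \<in> point_ideal p"
proof -
  have "vanishes_at (linX p) p" "vanishes_at (linY p) p"
    by (cases p; simp add: vanishes_at_def)+
  then show "linX p \<in> point_ideal p" "linY p \<in> point_ideal p"
    unfolding point_ideal_def
    using genideal_incl[of "{f. (\<exists>m. f \<in> forms m) \<and> vanishes_at f p}"] forms_lin by blast+
qed

lemma point_ideal_ideal: "ideal (point_ideal p) Rxyz"
  unfolding point_ideal_def by (rule genideal_ideal_type)

text \<open>
  Each monomial of f in the adapted coordinates has degree at least n in the two that vanish at
  p.
\<close>

lemma form_in_point_ideal_power:
  assumes f: "f \<in> forms m" and ord: "ord_ge n (local_equation f p)"
  shows "f \<in> ideal_power (point_ideal p) n"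
proof -
  obtain g where g: "g \<in> forms m" "f = lin_map p g" using forms_eq_lin_map[OF f] by blast
  note id = ideal_power_ideal[OF point_ideal_ideal, of p n]
  note r = ring_map_ev3[OF ring_map_const3, of "linX p" "linY p" "linW p"]
  have "lin_map p g \<in> ideal_power (point_ideal p) n"
  proof (rule poly3_monomial_induct[of "\<lambda>g. lin_map p g \<in> ideal_power (point_ideal p) n"])
    fix i j l
    let ?c = "coeff3 g i j l"
    show "lin_map p (mono3 ?c i j l) \<in> ideal_power (point_ideal p) n"
    proof (cases "?c = 0")
      case True
      then show ?thesis by (simp add: ring_map_zero[OF r] ideal_closed(1)[OF id])
    next
      case False
      then have "coeff2 (local_equation f p) i j \<noteq> 0"
        unfolding g(2) local_equation_lin_map using coeff3_dehomogenization[OF g(1) False] by simp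
      then have "n \<le> i + j" using ord unfolding ord_ge_def by (meson not_le)
      then have "linX p ^ i * linY p ^ j * (const3 ?c * linW p ^ l) \<in> ideal_power (point_ideal p) n"
        by (rule power_mult_in_ideal_power[OF point_ideal_ideal point_ideal_lin])
      moreover have "lin_map p (mono3 ?c i j l) = linX p ^ i * linY p ^ j * (const3 ?c * linW p ^ l)"
        unfolding ev3_mono3[OF ring_map_const3] by (simp only: mult_ac)
      ultimately show ?thesis by (simp only:)
    qed
  qed (simp_all add: ring_map_zero[OF r] ring_map_add[OF r] ideal_closed(1,2)[OF id])
  then show ?thesis by (simp only: g(2))
qed

text \<open>
  A form in the base system decides which directions at q are base points. With n the
  multiplicity of its proper transform, the blown up equation is \<open>u ^ n * G\<close> with u
  not dividing G, and the proper transform passes through the direction of slope c iff the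
  nonzero polynomial G(0,v) vanishes at c.
\<close>

lemma exists_non_base_direction:
  fixes I :: "'k::alg_closed_field poly3 set"
  assumes I: "ideal I Rxyz" and ne: "\<exists>f\<in>I \<inter> forms d. f \<noteq> 0"
  shows "\<exists>c. Near q (Slope c) \<notin> base_points I d"
proof -
  obtain f where f: "f \<in> base_system I d (Near q Vertical)"
    using base_system_facts[OF I ne, of "Near q Vertical"] by blast
  then have fc: "f \<in> base_system I d (Near q (Slope c))" and fq: "f \<in> base_system I d q" for c by simp_all
  let ?P = "proper_transform f q"
  have "f \<in> forms d" "f \<noteq> 0" "total_transform f q = exceptional_part (base_mult I d) q * ?P"
    using base_system_facts[OF I ne, of q] fq by blast+
  then have P0: "?P \<noteq> 0" using total_transform_eq_0_iff[of f d q] by auto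
  let ?n = "mult0 ?P"
  have o: "ord_ge ?n ?P" "\<not> ord_ge (Suc ?n) ?P" using ord_ge_mult0_iff[OF P0] by auto
  have "varU ^ ?n dvd blow_up (Slope 0) ?P" "\<not> varU ^ Suc ?n dvd blow_up (Slope 0) ?P"
    using exc_power_dvd_blow_up_iff[of "Slope 0" _ ?P, unfolded exc_equation.simps] o by blast+
  then obtain G where G: "blow_up (Slope 0) ?P = varU ^ ?n * G" "\<not> varU dvd G"
    by (metis dvdE dvd_refl mult_dvd_mono power_Suc2)
  have pt: "proper_transform f (Near q (Slope c)) = shift c G" for c
  proof -
    have "blow_up (Slope c) ?P = varU ^ ?n * shift c G"
      unfolding blow_up_Slope_shift[of c] G(1) ring_map_mult[OF ring_map_shift] ring_map_power[OF ring_map_shift] shift_vars ..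
    then show ?thesis
      unfolding proper_transform.simps exc_equation.simps by (simp del: blow_up.simps)
  qed
  define \<phi> where "\<phi> = eval_map (\<lambda>h. [:poly h 0:]) [:0, 1:] G"
  have const: "eval_map (\<lambda>h. [:poly h 0:]) [:0, 1:] [:h:] = [:poly h 0:]" for h :: "'k poly"
    by (rule eval_map_const) simp
  have val: "poly (poly (shift c F) 0) 0 = poly (eval_map (\<lambda>h. [:poly h 0:]) [:0, 1:] F) c" for c :: 'k and F
  proof (rule ring_map_eqI2[OF ring_map_comp[OF ring_map_poly ring_map_comp[OF ring_map_poly ring_map_shift]]
      ring_map_comp[OF ring_map_poly ring_map_eval_map[OF ring_map_comp[OF ring_map_const ring_map_poly]]]])
  qed (simp_all only: shift_vars const eval_map_var[OF ring_map_comp[OF ring_map_const ring_map_poly]], simp_all)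
  have "\<phi> \<noteq> 0"
  proof
    assume "\<phi> = 0"
    have "Polynomial.coeff (eval_map (\<lambda>h. [:poly h 0:]) [:0, 1:] F) j = poly (Polynomial.coeff F j) 0" for F :: "'k poly2" and j
      by (induction F arbitrary: j) (simp_all add: eval_map_0 eval_map_pCons coeff_pCons split: nat.split)
    then have "poly (Polynomial.coeff G j) 0 = 0" for j using \<open>\<phi> = 0\<close> unfolding \<phi>_def by (metis coeff_0)
    then have "varU dvd G" unfolding const_poly_dvd_iff using poly_eq_0_iff_dvd[of _ 0] by auto
    then show False using G(2) by blast
  qed
  then have "finite {c. poly \<phi> c = 0}" by (rule poly_roots_finite)
  then obtain c where c: "poly \<phi> c \<noteq> 0"
    using alg_closed_infinite[where 'k='k] by (metis (mono_tags, lifting) UNIV_I finite_subset mem_Collect_eq subsetI)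
  have "poly (poly (proper_transform f (Near q (Slope c))) 0) 0 \<noteq> 0"
    using c unfolding pt val \<phi>_def .
  then have "\<not> is_base_point I d (Near q (Slope c))"
    unfolding is_base_point.simps using fc by blast
  then show ?thesis unfolding base_points_def by blast
qed

text \<open>
  At a direction outside the cluster, the exceptional part is the power \<open>\<mu> p\<close>
  of u. The unit of the local ring is prime to u, so it can be cancelled.
\<close>

lemma full_ideal_subset_fat_ideal:
  fixes I :: "'k::alg_closed_field poly3 set"
  assumes I: "ideal I Rxyz" and ne: "\<exists>f\<in>I \<inter> forms d. f \<noteq> 0"
  shows "full_ideal (base_points I d) \<mu> \<subseteq> fat_ideal (base_points I d) \<mu>"
proof
  let ?K = "base_points I d"
  fix F assume "F \<in> full_ideal ?K \<mu>"
  then obtain N g where g: "\<And>m. g m \<in> forms m" "\<And>m. g m = 0 \<or> passes_virtually ?K \<mu> (g m)" "F = (\<Sum>m\<le>N. g m)"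
    unfolding full_ideal_def graded_sum_def by blast
  have "g m \<in> ideal_power (point_ideal p) (\<mu> (Proper p))" if p: "Proper p \<in> ?K" for m p
  proof (cases "g m = 0")
    case True
    then show ?thesis using ideal_closed(1)[OF ideal_power_ideal[OF point_ideal_ideal]] by simp
  next
    case False
    let ?f = "g m"
    obtain c where c: "Near (Proper p) (Slope c) \<notin> ?K" using exists_non_base_direction[OF I ne] by blast
    let ?x = "Near (Proper p) (Slope c)"
    have "?x \<in> blowup_surface ?K" unfolding blowup_surface_def using c p by simp
    then obtain s where s: "poly (poly s 0) 0 \<noteq> 0" "varU ^ \<mu> (Proper p) dvd s * total_transform ?f ?x"
      using g(2)[of m] False unfolding passes_virtually_def by fastforce
    have "\<not> varU dvd s" using s(1) by (auto elim!: dvdE)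
    then have "varU ^ \<mu> (Proper p) dvd total_transform ?f ?x"
      using prime_elem_power_dvd_multD[OF prime_elem_varU _ s(2)] by blast
    then have "ord_ge (\<mu> (Proper p)) (local_equation ?f p)"
      using exc_power_dvd_blow_up_iff[of "Slope c"] by (simp only: exc_equation.simps total_transform.simps)
    then show ?thesis by (rule form_in_point_ideal_power[OF g(1)])
  qed
  then have "F \<in> ideal_power (point_ideal p) (\<mu> (Proper p))" if "Proper p \<in> ?K" for p
    unfolding g(3) using that by (intro ideal_sum[OF ideal_power_ideal[OF point_ideal_ideal]])
  then show "F \<in> fat_ideal ?K \<mu>" unfolding fat_ideal_def by blast
qed

theorem theorem1p16:
  fixes f0 f1 f2 :: "'k::alg_closed_field poly poly poly" and d :: nat
    and I :: "'k poly poly poly set"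
    and K :: "'k near_point set" and \<mu> :: "'k near_point \<Rightarrow> nat"
  assumes "f0 \<in> forms d" and "f1 \<in> forms d" and "f2 \<in> forms d"
    and "\<And>h. h dvd f0 \<Longrightarrow> h dvd f1 \<Longrightarrow> h dvd f2 \<Longrightarrow> is_unit h"
    and "I = Idl\<^bsub>Rxyz\<^esub> {f0, f1, f2}"
    and "K = base_points I d" and "\<mu> = base_mult I d"
  shows "I \<subseteq> integral_closure I \<and>
         integral_closure I \<subseteq> divisorial_cover I \<and>
         divisorial_cover I \<subseteq> full_ideal K \<mu> \<and>
         full_ideal K \<mu> \<subseteq> fat_ideal K \<mu>"
proof -
  let ?S = "{f0, f1, f2}"
  have idI: "ideal I Rxyz" and SI: "?S \<subseteq> I" unfolding assms(5) by (rule genideal_ideal_type genideal_incl)+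
  have S: "?S \<subseteq> forms d" using assms(1-3) by blast
  have ne: "\<not> ?S \<subseteq> {0}"
  proof
    assume "?S \<subseteq> {0}"
    then have "is_unit (0 :: 'k poly poly poly)" using assms(4)[of 0] by auto
    then show False by simp
  qed
  then have ne': "\<exists>f\<in>I \<inter> forms d. f \<noteq> 0" using S SI by blast
  show ?thesis
    unfolding assms(6,7)
    using ideal_subset_integral_closure[OF idI]
      integral_closure_subset_divisorial_cover[OF _ S ne assms(5)]
      divisorial_cover_subset_full_ideal[OF S ne assms(5)]
      full_ideal_subset_fat_ideal[OF idI ne'] by blast
qed

end
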